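(* Let $G$ be a locally compact group and $H$ a closed subgroup. Then $G$ has the discretized $H$-separation property if and only if $\chi_H$ is $B(G)$-approximable.
   Context: For a locally compact group $G$, $B(G)$ is the Fourier–Stieltjes algebra (coefficient functions of strongly continuous unitary representations of $G$), identified with the dual of the group $C^*$-algebra $C^*(G)$. $G_d$ is $G$ with the discrete topology; $B(G)\subset B(G_d)$ isometrically, and $B(G_d)$ carries the weak$^*$ topology as the dual of $C^*(G_d)$. $B^d(G)$ denotes the weak$^*$ closure of $B(G)$ in $B(G_d)$. The function $\chi_H$ is $B(G)$-approximable if it lies in the weak$^*$ closure of $B(G)$ in $B(G_d)$, i.e. $\chi_H\in B^d(G)$. $P(G_d)\subset B(G_d)$ is the set of positive definite functions on $G_d$ and $P_H(G_d)=\{u\in P(G_d): u(h)=1\text{ for all }h\in H\}$. $G$ has the discretized $H$-separation property if for each $s\in G\setminus H$ there exists $u\in B^d(G)\cap P_H(G_d)$ with $u(s)\neq 1$. *)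

theory Defs
  imports "HOL-Analysis.Analysis" "HOL-Algebra.Module" "HOL-Library.Nonpos_Ints"
begin

section \<open>Topological groups\<close>

locale topological_group = group G for G (structure) and T :: "'g topology" +
  assumes topspace_eq: "topspace T = carrier G"
    and continuous_mult:
      "continuous_map (prod_topology T T) T (\<lambda>(x, y). x \<otimes> y)"
    and continuous_inv: "continuous_map T T (\<lambda>x. inv x)"

text \<open>Locally compact groups are Hausdorff by convention.\<close>

locale locally_compact_group = topological_group +
  assumes locally_compact: "locally_compact_space T"
    and Hausdorff: "Hausdorff_space T"


section \<open>Complex Hilbert spaces\<close>

definition complex_ring :: "complex ring" where
  "complex_ring = \<lparr>carrier = UNIV, monoid.mult = (*), one = 1, zero = 0, add = (+)\<rparr>"

text \<open>The multiplicative fields that a record of type module inherits from rings carry no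
  meaning for a Hilbert space, and the locale below says nothing about them.\<close>

record 'h hspace = "(complex, 'h) module" +
  cinner :: "'h \<Rightarrow> 'h \<Rightarrow> complex"

definition hnorm :: "('h, 'm) hspace_scheme \<Rightarrow> 'h \<Rightarrow> real" where
  "hnorm V x = sqrt (Re (cinner V x x))"

locale complex_hilbert_space = module complex_ring V for V (structure) +
  assumes cinner_add:
      "\<lbrakk>x \<in> carrier V; y \<in> carrier V; z \<in> carrier V\<rbrakk> \<Longrightarrow>
        cinner V (x \<oplus>\<^bsub>V\<^esub> y) z = cinner V x z + cinner V y z"
    and cinner_smult:
      "\<lbrakk>x \<in> carrier V; y \<in> carrier V\<rbrakk> \<Longrightarrow> cinner V (c \<odot>\<^bsub>V\<^esub> x) y = c * cinner V x y"
    and cinner_commute: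
      "\<lbrakk>x \<in> carrier V; y \<in> carrier V\<rbrakk> \<Longrightarrow> cinner V y x = cnj (cinner V x y)"
    and cinner_pos:
      "\<lbrakk>x \<in> carrier V; x \<noteq> \<zero>\<^bsub>V\<^esub>\<rbrakk> \<Longrightarrow> 0 < Re (cinner V x x)"
    and complete:
      "\<lbrakk>range \<sigma> \<subseteq> carrier V;
        \<And>e. 0 < e \<Longrightarrow> \<exists>N::nat. \<forall>m\<ge>N. \<forall>n\<ge>N. hnorm V (\<sigma> m \<ominus>\<^bsub>V\<^esub> \<sigma> n) < e\<rbrakk> \<Longrightarrow>
        \<exists>x\<in>carrier V. (\<lambda>n. hnorm V (\<sigma> n \<ominus>\<^bsub>V\<^esub> x)) \<longlonglongrightarrow> 0"


section \<open>Strongly continuous unitary representations\<close>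

text \<open>Since every \<open>\<pi> s\<close> is an isometry with inverse \<open>\<pi> (inv s)\<close>, it is unitary.\<close>

locale unitary_rep = topological_group G T + complex_hilbert_space V
  for G (structure) and T :: "'g topology" and V :: "'h hspace" and \<pi> :: "'g \<Rightarrow> 'h \<Rightarrow> 'h" +
  assumes rep_closed:
      "\<lbrakk>s \<in> carrier G; x \<in> carrier V\<rbrakk> \<Longrightarrow> \<pi> s x \<in> carrier V"
    and rep_add:
      "\<lbrakk>s \<in> carrier G; x \<in> carrier V; y \<in> carrier V\<rbrakk> \<Longrightarrow>
        \<pi> s (x \<oplus>\<^bsub>V\<^esub> y) = \<pi> s x \<oplus>\<^bsub>V\<^esub> \<pi> s y"
    and rep_smult:
      "\<lbrakk>s \<in> carrier G; x \<in> carrier V\<rbrakk> \<Longrightarrow> \<pi> s (c \<odot>\<^bsub>V\<^esub> x) = c \<odot>\<^bsub>V\<^esub> \<pi> s x"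
    and rep_isometry:
      "\<lbrakk>s \<in> carrier G; x \<in> carrier V; y \<in> carrier V\<rbrakk> \<Longrightarrow>
        cinner V (\<pi> s x) (\<pi> s y) = cinner V x y"
    and rep_one: "x \<in> carrier V \<Longrightarrow> \<pi> \<one> x = x"
    and rep_mult:
      "\<lbrakk>s \<in> carrier G; t \<in> carrier G; x \<in> carrier V\<rbrakk> \<Longrightarrow> \<pi> (s \<otimes> t) x = \<pi> s (\<pi> t x)"
    and strongly_continuous:
      "\<lbrakk>x \<in> carrier V; s\<^sub>0 \<in> carrier G\<rbrakk> \<Longrightarrow>
        ((\<lambda>s. hnorm V (\<pi> s x \<ominus>\<^bsub>V\<^esub> \<pi> s\<^sub>0 x)) \<longlongrightarrow> 0) (atin T s\<^sub>0)"

text \<open>Functions on \<open>G\<close> are represented by functions on the underlying type that vanish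
  off \<open>carrier G\<close>.\<close>

definition coefficient ::
  "('g, 'b) monoid_scheme \<Rightarrow> 'h hspace \<Rightarrow> ('g \<Rightarrow> 'h \<Rightarrow> 'h) \<Rightarrow> 'h \<Rightarrow> 'h \<Rightarrow> 'g \<Rightarrow> complex"
where
  "coefficient G V \<pi> \<xi> \<eta> = (\<lambda>s. if s \<in> carrier G then cinner V (\<pi> s \<xi>) \<eta> else 0)"

text \<open>HOL cannot quantify over the type underlying a Hilbert space inside a definition, so the
  underlying sets of Hilbert spaces are taken inside the fixed type below (the operations and
  the inner product remain arbitrary). This loses nothing: the part of a
  representation that matters for the coefficient of \<open>\<xi>\<close> and \<open>\<eta>\<close> is a closed invariant subspace
  containing \<open>\<xi>\<close> and \<open>\<eta>\<close> on which \<open>\<zeta>\<close> is determined by the two functions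
  \<open>s \<mapsto> \<langle>\<zeta>, \<pi>(s)\<xi>\<rangle>\<close> and \<open>s \<mapsto> \<langle>\<zeta>, \<pi>(s)\<eta>\<rangle>\<close>. See \<open>coefficient_in_fourier_stieltjes\<close> and
  \<open>rep_op_le_cstar_norm\<close> below.\<close>

type_synonym 'g hvec = "'g \<times> bool \<Rightarrow> complex"


section \<open>The Fourier--Stieltjes algebra\<close>

definition fourier_stieltjes ::
  "('g, 'b) monoid_scheme \<Rightarrow> 'g topology \<Rightarrow> ('g \<Rightarrow> complex) set" where
  "fourier_stieltjes G T =
    {coefficient G V \<pi> \<xi> \<eta> | (V :: 'g hvec hspace) \<pi> \<xi> \<eta>.
      unitary_rep G T V \<pi> \<and> \<xi> \<in> carrier V \<and> \<eta> \<in> carrier V}"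

text \<open>\<open>G\<^sub>d\<close> is the group \<open>G\<close> with this topology.\<close>

abbreviation discrete :: "('g, 'b) monoid_scheme \<Rightarrow> 'g topology" where
  "discrete G \<equiv> discrete_topology (carrier G)"


section \<open>The group C*-algebra of the discrete group and its dual\<close>

definition group_algebra :: "('g, 'b) monoid_scheme \<Rightarrow> ('g \<Rightarrow> complex) set" where
  "group_algebra G = {f. finite {s. f s \<noteq> 0} \<and> {s. f s \<noteq> 0} \<subseteq> carrier G}"

definition rep_op :: "'h hspace \<Rightarrow> ('g \<Rightarrow> 'h \<Rightarrow> 'h) \<Rightarrow> ('g \<Rightarrow> complex) \<Rightarrow> 'h \<Rightarrow> 'h" where
  "rep_op V \<pi> f \<xi> = finsum V (\<lambda>s. f s \<odot>\<^bsub>V\<^esub> \<pi> s \<xi>) {s. f s \<noteq> 0}"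

text \<open>The supremum of the operator norms of \<open>\<pi>(f)\<close> over all unitary representations \<open>\<pi>\<close>
  of \<open>G\<^sub>d\<close>; it is bounded by the l1-norm of \<open>f\<close>.\<close>

definition cstar_norm :: "('g, 'b) monoid_scheme \<Rightarrow> ('g \<Rightarrow> complex) \<Rightarrow> real" where
  "cstar_norm G f =
    Sup {hnorm V (rep_op V \<pi> f \<xi>) | (V :: 'g hvec hspace) \<pi> \<xi>.
      unitary_rep G (discrete G) V \<pi> \<and> \<xi> \<in> carrier V \<and> hnorm V \<xi> \<le> 1}"

definition cstar_Cauchy :: "('g, 'b) monoid_scheme \<Rightarrow> (nat \<Rightarrow> 'g \<Rightarrow> complex) set" where
  "cstar_Cauchy G =
    {a. range a \<subseteq> group_algebra G \<and>
      (\<forall>e>0. \<exists>N. \<forall>m\<ge>N. \<forall>n\<ge>N. cstar_norm G (\<lambda>s. a m s - a n s) < e)}"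

definition cstar_equiv ::
  "('g, 'b) monoid_scheme \<Rightarrow> ((nat \<Rightarrow> 'g \<Rightarrow> complex) \<times> (nat \<Rightarrow> 'g \<Rightarrow> complex)) set" where
  "cstar_equiv G =
    {(a, b). a \<in> cstar_Cauchy G \<and> b \<in> cstar_Cauchy G \<and>
      (\<lambda>n. cstar_norm G (\<lambda>s. a n s - b n s)) \<longlonglongrightarrow> 0}"

text \<open>The completion of the group algebra in the universal C*-norm. Only its elements and their
  pairing with \<open>B(G\<^sub>d)\<close> are needed, not its algebra structure.\<close>

definition cstar_algebra :: "('g, 'b) monoid_scheme \<Rightarrow> (nat \<Rightarrow> 'g \<Rightarrow> complex) set set" where
  "cstar_algebra G = cstar_Cauchy G // cstar_equiv G"

definition pairing :: "('g \<Rightarrow> complex) \<Rightarrow> ('g \<Rightarrow> complex) \<Rightarrow> complex" where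
  "pairing f u = (\<Sum>s | f s \<noteq> 0. f s * u s)"

text \<open>The functional on \<open>C*(G\<^sub>d)\<close> that \<open>u \<in> B(G\<^sub>d)\<close> is identified with: the continuous
  extension of \<open>pairing\<close>. It is well defined by \<open>cstar_pairing_ex1\<close> below.\<close>

definition cstar_pairing :: "(nat \<Rightarrow> 'g \<Rightarrow> complex) set \<Rightarrow> ('g \<Rightarrow> complex) \<Rightarrow> complex" where
  "cstar_pairing A u = (THE z. \<forall>a\<in>A. (\<lambda>n. pairing (a n) u) \<longlonglongrightarrow> z)"

definition weak_star :: "('g, 'b) monoid_scheme \<Rightarrow> ('g \<Rightarrow> complex) topology" where
  "weak_star G =
    topology_generated_by
      {{u \<in> fourier_stieltjes G (discrete G). cstar_pairing A u \<in> U} | A U.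
        A \<in> cstar_algebra G \<and> open U}"

definition Bd :: "('g, 'b) monoid_scheme \<Rightarrow> 'g topology \<Rightarrow> ('g \<Rightarrow> complex) set" where
  "Bd G T = weak_star G closure_of fourier_stieltjes G T"

definition approximable ::
  "('g, 'b) monoid_scheme \<Rightarrow> 'g topology \<Rightarrow> ('g \<Rightarrow> complex) \<Rightarrow> bool" where
  "approximable G T u \<longleftrightarrow> u \<in> Bd G T"


section \<open>The separation property\<close>

definition positive_definite :: "('g, 'b) monoid_scheme \<Rightarrow> ('g \<Rightarrow> complex) set" where
  "positive_definite G =
    {u. (\<forall>s. s \<notin> carrier G \<longrightarrow> u s = 0) \<and>
      (\<forall>F c. finite F \<and> F \<subseteq> carrier G \<longrightarrow>
        (\<Sum>s\<in>F. \<Sum>t\<in>F. cnj (c s) * c t * u (inv\<^bsub>G\<^esub> s \<otimes>\<^bsub>G\<^esub> t)) \<in> \<real>\<^sub>\<ge>\<^sub>0)}"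

definition positive_definite_on ::
  "('g, 'b) monoid_scheme \<Rightarrow> 'g set \<Rightarrow> ('g \<Rightarrow> complex) set" where
  "positive_definite_on G H = {u \<in> positive_definite G. \<forall>h\<in>H. u h = 1}"

definition discretized_separation ::
  "('g, 'b) monoid_scheme \<Rightarrow> 'g topology \<Rightarrow> 'g set \<Rightarrow> bool" where
  "discretized_separation G T H \<longleftrightarrow>
    (\<forall>s \<in> carrier G - H. \<exists>u \<in> Bd G T \<inter> positive_definite_on G H. u s \<noteq> 1)"


section \<open>The definitions are independent of the choice of universe and well defined\<close>

lemma complex_ring_simps [simp]:
  "carrier complex_ring = UNIV" "x \<otimes>\<^bsub>complex_ring\<^esub> y = x * y" "\<one>\<^bsub>complex_ring\<^esub> = 1"
  "\<zero>\<^bsub>complex_ring\<^esub> = 0" "x \<oplus>\<^bsub>complex_ring\<^esub> y = x + y"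
  by (simp_all add: complex_ring_def)

lemma cring_complex_ring: "cring complex_ring"
proof (rule cringI)
  show "abelian_group complex_ring"
  proof (rule abelian_groupI)
    show "\<exists>y\<in>carrier complex_ring. y \<oplus>\<^bsub>complex_ring\<^esub> x = \<zero>\<^bsub>complex_ring\<^esub>" for x
      by (rule bexI[of _ "-x"]) auto
  qed auto
  show "comm_monoid complex_ring"
    by unfold_locales auto
qed (auto simp: algebra_simps)

context complex_hilbert_space
begin

lemma smult_cl [simp]: "x \<in> carrier V \<Longrightarrow> c \<odot>\<^bsub>V\<^esub> x \<in> carrier V"
  by (rule smult_closed) auto

lemma smult_minus_one: "x \<in> carrier V \<Longrightarrow> (-1) \<odot>\<^bsub>V\<^esub> x = \<ominus>\<^bsub>V\<^esub> x"
proof -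
  assume x: "x \<in> carrier V"
  have "(-1) \<odot>\<^bsub>V\<^esub> x \<oplus>\<^bsub>V\<^esub> x = (-1) \<odot>\<^bsub>V\<^esub> x \<oplus>\<^bsub>V\<^esub> 1 \<odot>\<^bsub>V\<^esub> x"
    using x smult_one by simp
  also have "\<dots> = (-1 + 1) \<odot>\<^bsub>V\<^esub> x" using x smult_l_distr[of "-1" 1 x] by simp
  also have "\<dots> = \<zero>\<^bsub>V\<^esub>" using smult_l_null[OF x] by simp
  finally show ?thesis using x M.minus_equality by simp
qed

lemma cinner_zero_left [simp]: "y \<in> carrier V \<Longrightarrow> cinner V \<zero>\<^bsub>V\<^esub> y = 0"
  using cinner_add[of "\<zero>\<^bsub>V\<^esub>" "\<zero>\<^bsub>V\<^esub>" y] by simp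

lemma cinner_diff:
  "\<lbrakk>x \<in> carrier V; y \<in> carrier V; z \<in> carrier V\<rbrakk> \<Longrightarrow>
    cinner V (x \<ominus>\<^bsub>V\<^esub> y) z = cinner V x z - cinner V y z"
  using cinner_smult[of y z "-1"] by (simp add: M.minus_eq cinner_add smult_minus_one)

lemma cinner_right:
  assumes "x \<in> carrier V" "y \<in> carrier V" "z \<in> carrier V"
  shows "cinner V z (x \<oplus>\<^bsub>V\<^esub> y) = cinner V z x + cinner V z y"
    and "cinner V z (x \<ominus>\<^bsub>V\<^esub> y) = cinner V z x - cinner V z y"
    and "cinner V z (c \<odot>\<^bsub>V\<^esub> x) = cnj c * cinner V z x"
    and "cinner V z \<zero>\<^bsub>V\<^esub> = 0"
proof -
  note c = cinner_commute[OF _ assms(3)]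
  show "cinner V z (x \<oplus>\<^bsub>V\<^esub> y) = cinner V z x + cinner V z y"
    using assms by (subst (1 2 3) c) (auto simp: cinner_add)
  show "cinner V z (x \<ominus>\<^bsub>V\<^esub> y) = cinner V z x - cinner V z y"
    using assms by (subst (1 2 3) c) (auto simp: cinner_diff)
  show "cinner V z (c \<odot>\<^bsub>V\<^esub> x) = cnj c * cinner V z x"
    using assms by (subst (1 2) c) (auto simp: cinner_smult)
  show "cinner V z \<zero>\<^bsub>V\<^esub> = 0"
    using assms by (subst c) auto
qed

lemma cinner_self:
  assumes "x \<in> carrier V"
  shows "0 \<le> Re (cinner V x x)" "cinner V x x = complex_of_real ((hnorm V x)\<^sup>2)"
proof -
  show 1: "0 \<le> Re (cinner V x x)"
    using cinner_pos[OF assms] assms by (cases "x = \<zero>\<^bsub>V\<^esub>") auto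
  have "Im (cinner V x x) = 0"
    using cinner_commute[OF assms assms] by (metis cnj.simps(2) neg_equal_zero)
  then show "cinner V x x = complex_of_real ((hnorm V x)\<^sup>2)"
    using 1 by (simp add: complex_eq_iff hnorm_def)
qed

lemma hnorm_nonneg [simp]: "x \<in> carrier V \<Longrightarrow> 0 \<le> hnorm V x"
  using cinner_self(1) by (simp add: hnorm_def)

lemma hnorm_sq: "x \<in> carrier V \<Longrightarrow> (hnorm V x)\<^sup>2 = Re (cinner V x x)"
  using cinner_self(1) by (simp add: hnorm_def)

lemma hnorm_pos: "\<lbrakk>x \<in> carrier V; x \<noteq> \<zero>\<^bsub>V\<^esub>\<rbrakk> \<Longrightarrow> 0 < hnorm V x"
  using cinner_pos by (simp add: hnorm_def)

lemma hnorm_zero [simp]: "hnorm V \<zero>\<^bsub>V\<^esub> = 0"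
  by (simp add: hnorm_def)

lemma hnorm_smult: "x \<in> carrier V \<Longrightarrow> hnorm V (c \<odot>\<^bsub>V\<^esub> x) = cmod c * hnorm V x"
proof -
  assume x: "x \<in> carrier V"
  have "complex_of_real ((hnorm V (c \<odot>\<^bsub>V\<^esub> x))\<^sup>2) = (c * cnj c) * complex_of_real ((hnorm V x)\<^sup>2)"
    using x by (simp add: cinner_self(2)[symmetric] cinner_smult cinner_right del: of_real_power)
  also have "\<dots> = complex_of_real ((cmod c * hnorm V x)\<^sup>2)"
    by (simp add: complex_norm_square[symmetric] power_mult_distrib)
  finally have "(hnorm V (c \<odot>\<^bsub>V\<^esub> x))\<^sup>2 = (cmod c * hnorm V x)\<^sup>2"
    using of_real_eq_iff by blast
  then show ?thesis using x by (simp add: power2_eq_iff_nonneg)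
qed

lemma Cauchy_Schwarz:
  assumes x: "x \<in> carrier V" and y: "y \<in> carrier V"
  shows "cmod (cinner V x y) \<le> hnorm V x * hnorm V y"
proof (cases "y = \<zero>\<^bsub>V\<^esub>")
  case True
  then show ?thesis using x cinner_right(4)[OF x x x] by simp
next
  case False
  then have n: "hnorm V y > 0" using y hnorm_pos by simp
  define c where "c = cinner V x y / complex_of_real ((hnorm V y)\<^sup>2)"
  define r where "r = cmod (cinner V x y)"
  have rr: "cinner V x y * cnj (cinner V x y) = complex_of_real (r\<^sup>2)"
    by (simp only: r_def complex_norm_square)
  have w: "x \<ominus>\<^bsub>V\<^esub> c \<odot>\<^bsub>V\<^esub> y \<in> carrier V" using x y by simp
  have "cinner V (x \<ominus>\<^bsub>V\<^esub> c \<odot>\<^bsub>V\<^esub> y) (x \<ominus>\<^bsub>V\<^esub> c \<odot>\<^bsub>V\<^esub> y)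
    = cinner V x x - cnj c * cinner V x y - c * cnj (cinner V x y) + c * cnj c * cinner V y y"
    using x y by (simp add: cinner_diff cinner_right cinner_smult cinner_commute[of x y] algebra_simps)
  also have "\<dots> = complex_of_real ((hnorm V x)\<^sup>2 - r\<^sup>2 / (hnorm V y)\<^sup>2)"
    using n x y rr by (simp add: cinner_self(2) c_def field_simps power2_eq_square)
  finally have "0 \<le> (hnorm V x)\<^sup>2 - r\<^sup>2 / (hnorm V y)\<^sup>2"
    using cinner_self(1)[OF w] by simp
  then have "r\<^sup>2 \<le> (hnorm V x * hnorm V y)\<^sup>2"
    using n by (simp add: field_simps power_mult_distrib)
  then show ?thesis using x y unfolding r_def
    by (meson hnorm_nonneg mult_nonneg_nonneg power2_le_imp_le)
qed

lemma hnorm_triangle: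
  assumes x: "x \<in> carrier V" and y: "y \<in> carrier V"
  shows "hnorm V (x \<oplus>\<^bsub>V\<^esub> y) \<le> hnorm V x + hnorm V y"
proof -
  have "(hnorm V (x \<oplus>\<^bsub>V\<^esub> y))\<^sup>2 = Re (cinner V (x \<oplus>\<^bsub>V\<^esub> y) (x \<oplus>\<^bsub>V\<^esub> y))"
    using x y by (simp add: hnorm_sq)
  also have "\<dots> = (hnorm V x)\<^sup>2 + (hnorm V y)\<^sup>2 + 2 * Re (cinner V x y)"
    using x y by (simp add: cinner_add cinner_right cinner_commute[of x y] hnorm_sq)
  also have "\<dots> \<le> (hnorm V x)\<^sup>2 + (hnorm V y)\<^sup>2 + 2 * (hnorm V x * hnorm V y)"
    using Cauchy_Schwarz[OF x y] complex_Re_le_cmod[of "cinner V x y"] by linarith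
  also have "\<dots> = (hnorm V x + hnorm V y)\<^sup>2" by (simp add: power2_sum)
  finally show ?thesis using x y by (meson add_nonneg_nonneg hnorm_nonneg power2_le_imp_le)
qed

lemma cinner_limit_zero:
  assumes "\<And>n. \<sigma> n \<in> carrier V" "x \<in> carrier V" "k \<in> carrier V"
    and "(\<lambda>n. hnorm V (\<sigma> n \<ominus>\<^bsub>V\<^esub> x)) \<longlonglongrightarrow> 0" and "\<And>n::nat. cinner V (\<sigma> n) k = 0"
  shows "cinner V x k = 0"
proof -
  have "cmod (cinner V x k) \<le> hnorm V (\<sigma> n \<ominus>\<^bsub>V\<^esub> x) * hnorm V k" for n
    using Cauchy_Schwarz[of "\<sigma> n \<ominus>\<^bsub>V\<^esub> x" k] assms(1-3,5) by (simp add: cinner_diff)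
  moreover have "(\<lambda>n. hnorm V (\<sigma> n \<ominus>\<^bsub>V\<^esub> x) * hnorm V k) \<longlonglongrightarrow> 0"
    using tendsto_mult_left_zero[OF assms(4)] by blast
  ultimately have "cmod (cinner V x k) \<le> 0"
    by (intro Lim_bounded2[where N = 0]) auto
  then show ?thesis by simp
qed

end

lemma unitary_rep_transfer:
  fixes V :: "'h hspace" and W :: "'k hspace"
  assumes "unitary_rep G T V \<pi>"
    and K: "K \<subseteq> carrier V" "\<zero>\<^bsub>V\<^esub> \<in> K"
      "\<And>x y. \<lbrakk>x \<in> K; y \<in> K\<rbrakk> \<Longrightarrow> x \<oplus>\<^bsub>V\<^esub> y \<in> K"
      "\<And>c x. x \<in> K \<Longrightarrow> c \<odot>\<^bsub>V\<^esub> x \<in> K"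
      "\<And>s x. \<lbrakk>s \<in> carrier G; x \<in> K\<rbrakk> \<Longrightarrow> \<pi> s x \<in> K"
      "\<And>(\<sigma> :: nat \<Rightarrow> 'h) x. \<lbrakk>range \<sigma> \<subseteq> K; x \<in> carrier V; (\<lambda>n. hnorm V (\<sigma> n \<ominus>\<^bsub>V\<^esub> x)) \<longlonglongrightarrow> 0\<rbrakk> \<Longrightarrow> x \<in> K"
    and f: "carrier W = f ` K"
      "f \<zero>\<^bsub>V\<^esub> = \<zero>\<^bsub>W\<^esub>"
      "\<And>x y. \<lbrakk>x \<in> K; y \<in> K\<rbrakk> \<Longrightarrow> f (x \<oplus>\<^bsub>V\<^esub> y) = f x \<oplus>\<^bsub>W\<^esub> f y"
      "\<And>c x. x \<in> K \<Longrightarrow> f (c \<odot>\<^bsub>V\<^esub> x) = c \<odot>\<^bsub>W\<^esub> f x"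
      "\<And>x y. \<lbrakk>x \<in> K; y \<in> K\<rbrakk> \<Longrightarrow> cinner W (f x) (f y) = cinner V x y"
      "\<And>s x. \<lbrakk>s \<in> carrier G; x \<in> K\<rbrakk> \<Longrightarrow> \<rho> s (f x) = f (\<pi> s x)"
  shows "unitary_rep G T W \<rho>"
proof -
  interpret unitary_rep G T V \<pi> by fact
  have KV: "x \<in> carrier V" if "x \<in> K" for x using that K(1) by blast
  note f' = f(2-6)[symmetric]
  have neg: "\<ominus>\<^bsub>V\<^esub> x \<in> K" if "x \<in> K" for x
    using K(4)[OF that, of "-1"] smult_minus_one[OF KV[OF that]] by simp
  have "abelian_group W"
  proof (rule abelian_groupI)
    fix x y z assume "x \<in> carrier W" "y \<in> carrier W" "z \<in> carrier W"
    then show "x \<oplus>\<^bsub>W\<^esub> y \<oplus>\<^bsub>W\<^esub> z = x \<oplus>\<^bsub>W\<^esub> (y \<oplus>\<^bsub>W\<^esub> z)"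
      using K(3) KV by (auto simp: f(1) f' M.a_assoc)
  next
    fix x y assume "x \<in> carrier W" "y \<in> carrier W"
    then show "x \<oplus>\<^bsub>W\<^esub> y = y \<oplus>\<^bsub>W\<^esub> x" 
      using KV by (auto simp: f(1) f' M.a_comm)
  next
    fix x assume "x \<in> carrier W"
    then obtain k where k: "k \<in> K" "x = f k" using f(1) by auto
    have "f (\<ominus>\<^bsub>V\<^esub> k) \<oplus>\<^bsub>W\<^esub> x = \<zero>\<^bsub>W\<^esub>"
      using k neg KV by (simp add: f' M.l_neg)
    then show "\<exists>y\<in>carrier W. y \<oplus>\<^bsub>W\<^esub> x = \<zero>\<^bsub>W\<^esub>" using k neg f(1) by auto
  qed (use K KV in \<open>auto simp: f(1) f'\<close>)
  then interpret W: abelian_group W .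
  have fminus: "f (x \<ominus>\<^bsub>V\<^esub> y) = f x \<ominus>\<^bsub>W\<^esub> f y" if "x \<in> K" "y \<in> K" for x y
  proof -
    have "f (\<ominus>\<^bsub>V\<^esub> y) \<oplus>\<^bsub>W\<^esub> f y = \<zero>\<^bsub>W\<^esub>"
      using that neg KV by (simp add: f' M.l_neg)
    then have "\<ominus>\<^bsub>W\<^esub> f y = f (\<ominus>\<^bsub>V\<^esub> y)"
      using that neg f(1) by (intro W.minus_equality) auto
    then show ?thesis using that neg by (simp add: M.minus_eq W.minus_eq f(3))
  qed
  have minK: "x \<ominus>\<^bsub>V\<^esub> y \<in> K" if "x \<in> K" "y \<in> K" for x y
    using that neg K(3) by (simp add: M.minus_eq)
  have fn: "hnorm W (f x) = hnorm V x" if "x \<in> K" for x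
    using that by (simp add: hnorm_def f(5))
  have "module complex_ring W"
    by (rule moduleI)
      (use cring_complex_ring K KV smult_l_distr smult_r_distr smult_assoc1 smult_one in
        \<open>auto simp: f(1) f' W.abelian_group_axioms\<close>)
  moreover have "complex_hilbert_space_axioms W"
  proof
    fix \<sigma> :: "nat \<Rightarrow> 'k"
    assume \<sigma>: "range \<sigma> \<subseteq> carrier W"
      and C: "\<And>e. 0 < e \<Longrightarrow> \<exists>N::nat. \<forall>m\<ge>N. \<forall>n\<ge>N. hnorm W (\<sigma> m \<ominus>\<^bsub>W\<^esub> \<sigma> n) < e"
    have "\<forall>n. \<exists>k\<in>K. \<sigma> n = f k" using \<sigma> f(1) by blast
    then obtain \<tau> where \<tau>: "\<And>n. \<tau> n \<in> K" "\<And>n. \<sigma> n = f (\<tau> n)" by metis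
    have eq: "hnorm W (\<sigma> m \<ominus>\<^bsub>W\<^esub> \<sigma> n) = hnorm V (\<tau> m \<ominus>\<^bsub>V\<^esub> \<tau> n)" for m n
      using \<tau>(1) by (simp add: \<tau>(2) fminus[symmetric] fn minK)
    obtain x where x: "x \<in> carrier V" "(\<lambda>n. hnorm V (\<tau> n \<ominus>\<^bsub>V\<^esub> x)) \<longlonglongrightarrow> 0"
      using complete[of \<tau>] C \<tau>(1) KV unfolding eq by blast
    then have xK: "x \<in> K" using K(6)[of \<tau> x] \<tau>(1) by blast
    have "hnorm W (\<sigma> n \<ominus>\<^bsub>W\<^esub> f x) = hnorm V (\<tau> n \<ominus>\<^bsub>V\<^esub> x)" for n
      using \<tau>(1) xK by (simp add: \<tau>(2) fminus[symmetric] fn minK)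
    then show "\<exists>x\<in>carrier W. (\<lambda>n. hnorm W (\<sigma> n \<ominus>\<^bsub>W\<^esub> x)) \<longlonglongrightarrow> 0"
      using x(2) xK f(1) by (intro bexI[of _ "f x"]) auto
  next
    fix x y assume "x \<in> carrier W" "y \<in> carrier W"
    then obtain k l where "k \<in> K" "x = f k" "l \<in> K" "y = f l" using f(1) by auto
    then show "cinner W y x = cnj (cinner W x y)"
      using cinner_commute[of k l] KV by (simp add: f(5))
  next
    fix x assume "x \<in> carrier W" "x \<noteq> \<zero>\<^bsub>W\<^esub>"
    then obtain k where "k \<in> K" "x = f k" "k \<noteq> \<zero>\<^bsub>V\<^esub>" using f(1,2) by auto
    then show "0 < Re (cinner W x x)"
      using cinner_pos[of k] KV by (simp add: f(5))
  qed (use K(3,4) KV cinner_add cinner_smult in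
        \<open>auto simp: f(1) f(5) f(3,4)[symmetric]\<close>)
  moreover have "unitary_rep_axioms G T W \<rho>"
  proof
    fix x s\<^sub>0 assume "x \<in> carrier W" and s: "s\<^sub>0 \<in> carrier G"
    then obtain k where k: "k \<in> K" "x = f k" using f(1) by auto
    have "hnorm W (\<rho> s x \<ominus>\<^bsub>W\<^esub> \<rho> s\<^sub>0 x) = hnorm V (\<pi> s k \<ominus>\<^bsub>V\<^esub> \<pi> s\<^sub>0 k)" if "s \<in> carrier G" for s
      using that s k K(5) by (simp add: f(6) fminus[symmetric] fn minK)
    moreover have "((\<lambda>s. hnorm V (\<pi> s k \<ominus>\<^bsub>V\<^esub> \<pi> s\<^sub>0 k)) \<longlongrightarrow> 0) (atin T s\<^sub>0)"
      using strongly_continuous k KV s by blast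
    moreover have "eventually (\<lambda>s. s \<in> carrier G) (atin T s\<^sub>0)"
      using topspace_eq openin_topspace[of T] s by (auto simp: eventually_atin)
    ultimately show "((\<lambda>s. hnorm W (\<rho> s x \<ominus>\<^bsub>W\<^esub> \<rho> s\<^sub>0 x)) \<longlongrightarrow> 0) (atin T s\<^sub>0)"
      by (elim Lim_transform_eventually) (auto elim: eventually_mono)
  qed (use KV K rep_add rep_smult rep_isometry rep_one rep_mult in
        \<open>auto simp: f(1) f(5,6) f(3,4)[symmetric]\<close>)
  ultimately show ?thesis
    by (intro unitary_rep.intro complex_hilbert_space.intro topological_group_axioms)
qed

lemma rep_embed:
  fixes V :: "'h hspace" and G :: "('g, 'b) monoid_scheme"
  assumes "unitary_rep G T V \<pi>" and \<xi>: "\<xi> \<in> carrier V" and \<eta>: "\<eta> \<in> carrier V"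
  shows "\<exists>(W :: 'g hvec hspace) \<rho> \<xi>' \<eta>'. unitary_rep G T W \<rho> \<and> \<xi>' \<in> carrier W \<and> \<eta>' \<in> carrier W
    \<and> (\<forall>s\<in>carrier G. cinner W (\<rho> s \<xi>') \<eta>' = cinner V (\<pi> s \<xi>) \<eta>)
    \<and> hnorm W \<xi>' = hnorm V \<xi>
    \<and> (\<forall>f\<in>group_algebra G. hnorm W (rep_op W \<rho> f \<xi>') = hnorm V (rep_op V \<pi> f \<xi>))"
proof -
  interpret unitary_rep G T V \<pi> by fact
  define v where "v b = (if b then \<xi> else \<eta>)" for b
  have v: "v b \<in> carrier V" for b using \<xi> \<eta> by (simp add: v_def)
  define N where "N = {z \<in> carrier V. \<forall>s\<in>carrier G. \<forall>b. cinner V z (\<pi> s (v b)) = 0}"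
  define K where "K = {z \<in> carrier V. \<forall>k\<in>N. cinner V z k = 0}"
  define f where "f z = (\<lambda>(s, b). if s \<in> carrier G then cinner V z (\<pi> s (v b)) else 0)" for z
  define S where "S = inv_into K f"
  define W :: "'g hvec hspace" where
    "W = \<lparr>carrier = f ` K, monoid.mult = undefined, one = undefined,
      zero = \<lambda>_. 0, add = \<lambda>x y p. x p + y p, smult = \<lambda>c x p. c * x p,
      cinner = \<lambda>x y. cinner V (S x) (S y)\<rparr>"
  define \<rho> where
    "\<rho> s x = (\<lambda>(t, b). if t \<in> carrier G then x (inv\<^bsub>G\<^esub> s \<otimes>\<^bsub>G\<^esub> t, b) else (0::complex))" for s and x :: "'g hvec"
  have KV: "K \<subseteq> carrier V" by (auto simp: K_def)
  have NV: "N \<subseteq> carrier V" by (auto simp: N_def)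
  have move: "cinner V (\<pi> s x) y = cinner V x (\<pi> (inv\<^bsub>G\<^esub> s) y)"
    if "s \<in> carrier G" "x \<in> carrier V" "y \<in> carrier V" for s x y
  proof -
    have "cinner V (\<pi> (inv\<^bsub>G\<^esub> s) (\<pi> s x)) (\<pi> (inv\<^bsub>G\<^esub> s) y) = cinner V (\<pi> s x) y"
      using that by (intro rep_isometry) (auto intro: rep_closed)
    moreover have "\<pi> (inv\<^bsub>G\<^esub> s) (\<pi> s x) = x"
      using that rep_mult[of "inv\<^bsub>G\<^esub> s" s x] by (simp add: rep_one)
    ultimately show ?thesis by simp
  qed
  have Ninv: "\<pi> s z \<in> N" if "s \<in> carrier G" "z \<in> N" for s z
    using that NV v by (auto simp: N_def rep_closed move rep_mult[symmetric])
  have inj: "inj_on f K"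
  proof (rule inj_onI)
    fix z w assume z: "z \<in> K" and w: "w \<in> K" and e: "f z = f w"
    have "cinner V z (\<pi> s (v b)) = cinner V w (\<pi> s (v b))" if "s \<in> carrier G" for s b
      using fun_cong[OF e, of "(s, b)"] that by (simp add: f_def)
    then have "z \<ominus>\<^bsub>V\<^esub> w \<in> N" using z w KV v by (auto simp: N_def cinner_diff rep_closed subset_iff)
    moreover have "z \<ominus>\<^bsub>V\<^esub> w \<in> K" using z w NV by (auto simp: K_def cinner_diff subset_iff)
    ultimately have "cinner V (z \<ominus>\<^bsub>V\<^esub> w) (z \<ominus>\<^bsub>V\<^esub> w) = 0" by (simp add: K_def)
    then have "z \<ominus>\<^bsub>V\<^esub> w = \<zero>\<^bsub>V\<^esub>" using cinner_pos[of "z \<ominus>\<^bsub>V\<^esub> w"] z w KV by (force simp: subset_iff)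
    then show "z = w" using z w KV M.minus_equality[of z "\<ominus>\<^bsub>V\<^esub> w"] by (simp add: M.minus_eq subset_iff)
  qed
  then have S: "S (f x) = x" if "x \<in> K" for x using that by (simp add: S_def)
  have Kpi: "\<pi> s x \<in> K" if "s \<in> carrier G" "x \<in> K" for s x
    using that KV NV Ninv by (auto simp: K_def rep_closed move subset_iff)
  have frho: "\<rho> s (f x) = f (\<pi> s x)" if "s \<in> carrier G" "x \<in> K" for s x
    using that KV v by (auto simp: \<rho>_def f_def fun_eq_iff move rep_closed rep_mult subset_iff)
  have rep: "unitary_rep G T W \<rho>"
  proof (rule unitary_rep_transfer[OF assms(1), of K _ f])
    show "x \<in> K" if "range \<sigma> \<subseteq> K" "x \<in> carrier V" "(\<lambda>n. hnorm V (\<sigma> n \<ominus>\<^bsub>V\<^esub> x)) \<longlonglongrightarrow> 0"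
      for \<sigma> :: "nat \<Rightarrow> 'h" and x
    proof -
      have "cinner V x k = 0" if "k \<in> N" for k
        using cinner_limit_zero[of \<sigma> x k] \<open>range \<sigma> \<subseteq> K\<close> \<open>x \<in> carrier V\<close>
          \<open>(\<lambda>n. hnorm V (\<sigma> n \<ominus>\<^bsub>V\<^esub> x)) \<longlonglongrightarrow> 0\<close> that NV
        by (auto simp: K_def)
      then show ?thesis using that by (simp add: K_def)
    qed
  qed (use KV NV v Kpi S frho in
      \<open>auto simp: W_def K_def f_def cinner_add cinner_smult rep_closed subset_iff fun_eq_iff\<close>)
  then interpret W: unitary_rep G T W \<rho> .
  have vK: "v b \<in> K" for b
  proof -
    have "cinner V (v b) k = 0" if "k \<in> N" for k
    proof -
      have "cinner V k (\<pi> \<one>\<^bsub>G\<^esub> (v b)) = 0" using that by (simp add: N_def)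
      then show ?thesis
        using that v[of b] NV cinner_commute[of k "v b"] by (auto simp: rep_one)
    qed
    then show ?thesis using v by (simp add: K_def)
  qed
  have xk: "\<xi> \<in> K" "\<eta> \<in> K" using vK[of True] vK[of False] by (simp_all add: v_def)
  have ci: "cinner W (f x) (f y) = cinner V x y" if "x \<in> K" "y \<in> K" for x y
    using that S by (simp add: W_def)
  have Kadd: "x \<oplus>\<^bsub>V\<^esub> y \<in> K" if "x \<in> K" "y \<in> K" for x y
    using that NV by (auto simp: K_def cinner_add subset_iff)
  have Ksm: "c \<odot>\<^bsub>V\<^esub> x \<in> K" if "x \<in> K" for c x
    using that NV by (auto simp: K_def cinner_smult subset_iff)
  have K0: "\<zero>\<^bsub>V\<^esub> \<in> K" using NV by (auto simp: K_def)
  have fW: "f x \<in> carrier W" if "x \<in> K" for x using that by (simp add: W_def)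
  have fadd: "f (x \<oplus>\<^bsub>V\<^esub> y) = f x \<oplus>\<^bsub>W\<^esub> f y" if "x \<in> K" "y \<in> K" for x y
    using that KV v by (auto simp: W_def f_def fun_eq_iff cinner_add rep_closed subset_iff)
  have fsm: "f (c \<odot>\<^bsub>V\<^esub> x) = c \<odot>\<^bsub>W\<^esub> f x" if "x \<in> K" for c x
    using that KV v by (auto simp: W_def f_def fun_eq_iff cinner_smult rep_closed subset_iff)
  have f0: "f \<zero>\<^bsub>V\<^esub> = \<zero>\<^bsub>W\<^esub>"
    using v by (auto simp: W_def f_def fun_eq_iff rep_closed)
  have fs: "finsum W (\<lambda>s. g s \<odot>\<^bsub>W\<^esub> \<rho> s (f \<xi>)) A = f (finsum V (\<lambda>s. g s \<odot>\<^bsub>V\<^esub> \<pi> s \<xi>) A)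
      \<and> finsum V (\<lambda>s. g s \<odot>\<^bsub>V\<^esub> \<pi> s \<xi>) A \<in> K"
    if "finite A" "A \<subseteq> carrier G" for g A
    using that
  proof (induction A)
    case empty
    then show ?case using K0 f0 by simp
  next
    case (insert a A)
    have mem: "g s \<odot>\<^bsub>V\<^esub> \<pi> s \<xi> \<in> K" if "s \<in> insert a A" for s
      using that insert.prems xk Kpi Ksm by blast
    have feq: "g s \<odot>\<^bsub>W\<^esub> \<rho> s (f \<xi>) = f (g s \<odot>\<^bsub>V\<^esub> \<pi> s \<xi>)" if "s \<in> insert a A" for s
      using that insert.prems xk Kpi by (auto simp: fsm frho)
    have "finsum V (\<lambda>s. g s \<odot>\<^bsub>V\<^esub> \<pi> s \<xi>) (insert a A)
      = g a \<odot>\<^bsub>V\<^esub> \<pi> a \<xi> \<oplus>\<^bsub>V\<^esub> finsum V (\<lambda>s. g s \<odot>\<^bsub>V\<^esub> \<pi> s \<xi>) A"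
      using insert.hyps mem KV by (intro M.finsum_insert) auto
    moreover have "finsum W (\<lambda>s. g s \<odot>\<^bsub>W\<^esub> \<rho> s (f \<xi>)) (insert a A)
      = g a \<odot>\<^bsub>W\<^esub> \<rho> a (f \<xi>) \<oplus>\<^bsub>W\<^esub> finsum W (\<lambda>s. g s \<odot>\<^bsub>W\<^esub> \<rho> s (f \<xi>)) A"
      using insert.hyps mem feq fW by (intro W.M.finsum_insert) auto
    ultimately show ?case
      using insert mem feq by (simp add: fadd Kadd)
  qed
  show ?thesis
  proof (intro exI conjI ballI)
    show "unitary_rep G T W \<rho>" by fact
    show "f \<xi> \<in> carrier W" "f \<eta> \<in> carrier W" using xk fW by auto
    show "cinner W (\<rho> s (f \<xi>)) (f \<eta>) = cinner V (\<pi> s \<xi>) \<eta>" if "s \<in> carrier G" for s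
      using that xk Kpi by (simp add: frho ci)
    show "hnorm W (f \<xi>) = hnorm V \<xi>" using xk by (simp add: hnorm_def ci)
    show "hnorm W (rep_op W \<rho> g (f \<xi>)) = hnorm V (rep_op V \<pi> g \<xi>)" if "g \<in> group_algebra G" for g
      using that fs[of "{s. g s \<noteq> 0}" g] by (simp add: group_algebra_def rep_op_def hnorm_def ci)
  qed
qed

text \<open>Coefficients of representations on Hilbert spaces over an arbitrary type \<open>'h\<close> give nothing new.\<close>

lemma coefficient_in_fourier_stieltjes:
  fixes V :: "'h hspace" and G :: "('g, 'b) monoid_scheme"
  assumes "unitary_rep G T V \<pi>" "\<xi> \<in> carrier V" "\<eta> \<in> carrier V"
  shows "coefficient G V \<pi> \<xi> \<eta> \<in> fourier_stieltjes G T"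
proof -
  obtain W :: "'g hvec hspace" and \<rho> \<xi>' \<eta>' where "unitary_rep G T (W :: 'g hvec hspace) \<rho>" "\<xi>' \<in> carrier W" "\<eta>' \<in> carrier W"
    "\<forall>s\<in>carrier G. cinner W (\<rho> s \<xi>') \<eta>' = cinner V (\<pi> s \<xi>) \<eta>"
    using rep_embed[OF assms] by blast
  moreover from this(4) have "coefficient G V \<pi> \<xi> \<eta> = coefficient G W \<rho> \<xi>' \<eta>'"
    by (auto simp: coefficient_def)
  ultimately show ?thesis unfolding fourier_stieltjes_def by blast
qed

lemma (in unitary_rep) hnorm_rep: "\<lbrakk>s \<in> carrier G; x \<in> carrier V\<rbrakk> \<Longrightarrow> hnorm V (\<pi> s x) = hnorm V x"
  by (simp add: hnorm_def rep_isometry)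

lemma (in unitary_rep) finsum_bound:
  assumes "finite A" "A \<subseteq> carrier G" "\<xi> \<in> carrier V"
  shows "finsum V (\<lambda>s. f s \<odot>\<^bsub>V\<^esub> \<pi> s \<xi>) A \<in> carrier V
    \<and> hnorm V (finsum V (\<lambda>s. f s \<odot>\<^bsub>V\<^esub> \<pi> s \<xi>) A) \<le> (\<Sum>s\<in>A. cmod (f s)) * hnorm V \<xi>
    \<and> (\<forall>\<eta>\<in>carrier V. cinner V (finsum V (\<lambda>s. f s \<odot>\<^bsub>V\<^esub> \<pi> s \<xi>) A) \<eta> = (\<Sum>s\<in>A. f s * cinner V (\<pi> s \<xi>) \<eta>))"
  using assms
proof (induction A)
  case empty
  then show ?case by simp
next
  case (insert a A)
  let ?F = "\<lambda>s. f s \<odot>\<^bsub>V\<^esub> \<pi> s \<xi>"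
  have m: "?F s \<in> carrier V" if "s \<in> insert a A" for s
    using that insert.prems rep_closed by auto
  have e: "finsum V ?F (insert a A) = ?F a \<oplus>\<^bsub>V\<^esub> finsum V ?F A"
    using insert.hyps m by (intro M.finsum_insert) auto
  have IH: "finsum V ?F A \<in> carrier V" "hnorm V (finsum V ?F A) \<le> (\<Sum>s\<in>A. cmod (f s)) * hnorm V \<xi>"
    "\<forall>\<eta>\<in>carrier V. cinner V (finsum V ?F A) \<eta> = (\<Sum>s\<in>A. f s * cinner V (\<pi> s \<xi>) \<eta>)"
    using insert by auto
  have "hnorm V (?F a \<oplus>\<^bsub>V\<^esub> finsum V ?F A) \<le> hnorm V (?F a) + hnorm V (finsum V ?F A)"
    using m IH by (intro hnorm_triangle) auto
  also have "hnorm V (?F a) = cmod (f a) * hnorm V \<xi>"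
    using insert.prems by (simp add: hnorm_smult hnorm_rep rep_closed)
  finally have "hnorm V (?F a \<oplus>\<^bsub>V\<^esub> finsum V ?F A) \<le> (\<Sum>s\<in>insert a A. cmod (f s)) * hnorm V \<xi>"
    using IH(2) insert.hyps by (simp add: algebra_simps)
  then show ?case
    using m IH insert.hyps insert.prems by (auto simp: e cinner_add cinner_smult rep_closed)
qed

lemma bdd_above_cstar_norm:
  assumes "f \<in> group_algebra G"
  shows "bdd_above {hnorm V (rep_op V \<pi> f \<xi>) | (V :: 'g hvec hspace) \<pi> \<xi>.
      unitary_rep (G :: ('g, 'b) monoid_scheme) (discrete G) V \<pi> \<and> \<xi> \<in> carrier V \<and> hnorm V \<xi> \<le> 1}"
proof (rule bdd_aboveI, clarify)
  fix V :: "'g hvec hspace" and \<pi> \<xi>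
  assume u: "unitary_rep G (discrete G) V \<pi>" and \<xi>: "\<xi> \<in> carrier V" "hnorm V \<xi> \<le> 1"
  interpret unitary_rep G "discrete G" V \<pi> by fact
  have "hnorm V (rep_op V \<pi> f \<xi>) \<le> (\<Sum>s | f s \<noteq> 0. cmod (f s)) * hnorm V \<xi>"
    using finsum_bound[of "{s. f s \<noteq> 0}" \<xi> f] assms \<xi> by (simp add: rep_op_def group_algebra_def)
  also have "\<dots> \<le> (\<Sum>s | f s \<noteq> 0. cmod (f s)) * 1"
    using \<xi> by (intro mult_left_mono sum_nonneg) auto
  finally show "hnorm V (rep_op V \<pi> f \<xi>) \<le> (\<Sum>s | f s \<noteq> 0. cmod (f s))" by simp
qed

text \<open>Nor do they enlarge the universal norm.\<close>

lemma rep_op_le_cstar_norm: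
  fixes V :: "'h hspace" and G :: "('g, 'b) monoid_scheme"
  assumes u: "unitary_rep G (discrete G) V \<pi>" and \<xi>: "\<xi> \<in> carrier V" and f: "f \<in> group_algebra G"
  shows "hnorm V (rep_op V \<pi> f \<xi>) \<le> cstar_norm G f * hnorm V \<xi>"
proof -
  interpret unitary_rep G "discrete G" V \<pi> by fact
  show ?thesis
  proof (cases "\<xi> = \<zero>\<^bsub>V\<^esub>")
    case True
    then show ?thesis
      using finsum_bound[of "{s. f s \<noteq> 0}" \<xi> f] f \<xi> by (simp add: rep_op_def group_algebra_def)
  next
    case False
    then have n: "hnorm V \<xi> > 0" using \<xi> hnorm_pos by simp
    define \<zeta> where "\<zeta> = complex_of_real (inverse (hnorm V \<xi>)) \<odot>\<^bsub>V\<^esub> \<xi>"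
    have \<zeta>: "\<zeta> \<in> carrier V" "hnorm V \<zeta> = 1"
      using \<xi> n by (simp_all add: \<zeta>_def hnorm_smult norm_inverse del: of_real_inverse)
    obtain W :: "'g hvec hspace" and \<rho> \<zeta>' where W: "unitary_rep G (discrete G) (W :: 'g hvec hspace) \<rho>" "\<zeta>' \<in> carrier W"
      "hnorm W \<zeta>' = hnorm V \<zeta>" "hnorm W (rep_op W \<rho> f \<zeta>') = hnorm V (rep_op V \<pi> f \<zeta>)"
      using rep_embed[OF u \<zeta>(1) \<zeta>(1)] f by blast
    have le: "hnorm V (rep_op V \<pi> f \<zeta>) \<le> cstar_norm G f"
      unfolding cstar_norm_def W(4)[symmetric]
      using W(1,2,3) \<zeta>(2) by (intro cSup_upper bdd_above_cstar_norm f) force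
    have S: "finite {s. f s \<noteq> 0}" "{s. f s \<noteq> 0} \<subseteq> carrier G" using f by (auto simp: group_algebra_def)
    have "rep_op V \<pi> f \<zeta> = complex_of_real (inverse (hnorm V \<xi>)) \<odot>\<^bsub>V\<^esub> rep_op V \<pi> f \<xi>" (is "?l = ?c \<odot>\<^bsub>V\<^esub> ?r")
    proof -
      have "?l = finsum V (\<lambda>s. ?c \<odot>\<^bsub>V\<^esub> (f s \<odot>\<^bsub>V\<^esub> \<pi> s \<xi>)) {s. f s \<noteq> 0}"
        unfolding rep_op_def \<zeta>_def
      proof (rule M.finsum_cong'[OF refl])
        show "f s \<odot>\<^bsub>V\<^esub> \<pi> s (?c \<odot>\<^bsub>V\<^esub> \<xi>) = ?c \<odot>\<^bsub>V\<^esub> (f s \<odot>\<^bsub>V\<^esub> \<pi> s \<xi>)" if "s \<in> {s. f s \<noteq> 0}" for s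
        proof -
          have s: "s \<in> carrier G" using that S by blast
          show ?thesis
            using s \<xi> rep_closed[OF s \<xi>] smult_assoc1[of "f s" ?c "\<pi> s \<xi>"] smult_assoc1[of ?c "f s" "\<pi> s \<xi>"]
            by (simp add: rep_smult mult.commute)
        qed
      qed (use S \<xi> rep_closed in auto)
      also have "\<dots> = ?c \<odot>\<^bsub>V\<^esub> ?r"
        unfolding rep_op_def
        using S \<xi> rep_closed by (intro finsum_smult_ldistr[symmetric]) auto
      finally show ?thesis .
    qed
    moreover have "?r \<in> carrier V" if "?r = rep_op V \<pi> f \<xi>" for r
      using finsum_bound[OF S \<xi>] by (simp add: rep_op_def)
    ultimately have "hnorm V (rep_op V \<pi> f \<zeta>) = inverse (hnorm V \<xi>) * hnorm V (rep_op V \<pi> f \<xi>)"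
      using n by (simp add: hnorm_smult norm_inverse del: of_real_inverse)
    then have "hnorm V (rep_op V \<pi> f \<xi>) = hnorm V (rep_op V \<pi> f \<zeta>) * hnorm V \<xi>"
      using n by (simp add: field_simps)
    then show ?thesis using le n by (simp add: mult_right_mono)
  qed
qed

lemma group_algebra_diff:
  assumes "f \<in> group_algebra G" "g \<in> group_algebra G"
  shows "(\<lambda>s. f s - g s) \<in> group_algebra G"
proof -
  have "{s. f s - g s \<noteq> 0} \<subseteq> {s. f s \<noteq> 0} \<union> {s. g s \<noteq> 0}" by auto
  then show ?thesis using assms finite_subset unfolding group_algebra_def by blast
qed

lemma pairing_eq_sum:
  assumes "finite A" "{s. f s \<noteq> 0} \<subseteq> A"
  shows "pairing f u = (\<Sum>s\<in>A. f s * u s)"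
  unfolding pairing_def using assms by (intro sum.mono_neutral_left) auto

lemma pairing_diff:
  assumes "f \<in> group_algebra G" "g \<in> group_algebra G"
  shows "pairing (\<lambda>s. f s - g s) u = pairing f u - pairing g u"
proof -
  let ?A = "{s. f s \<noteq> 0} \<union> {s. g s \<noteq> 0}"
  have "finite ?A" using assms by (simp add: group_algebra_def)
  then have "pairing f u = (\<Sum>s\<in>?A. f s * u s)" "pairing g u = (\<Sum>s\<in>?A. g s * u s)"
    "pairing (\<lambda>s. f s - g s) u = (\<Sum>s\<in>?A. (f s - g s) * u s)"
    by (auto intro!: pairing_eq_sum)
  then show ?thesis by (simp only: left_diff_distrib sum_subtractf)
qed

lemma pairing_bound:
  assumes "u \<in> fourier_stieltjes G (discrete G)"
  obtains C where "C > 0" "\<And>f. f \<in> group_algebra G \<Longrightarrow> cmod (pairing f u) \<le> C * cstar_norm G f"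
proof -
  obtain V :: "'a hvec hspace" and \<pi> \<xi> \<eta> where r: "unitary_rep G (discrete G) V \<pi>"
    and \<xi>: "\<xi> \<in> carrier V" and \<eta>: "\<eta> \<in> carrier V" and u: "u = coefficient G V \<pi> \<xi> \<eta>"
    using assms by (auto simp: fourier_stieltjes_def)
  interpret unitary_rep G "discrete G" V \<pi> by fact
  have b: "cmod (pairing f u) \<le> cstar_norm G f * hnorm V \<xi> * hnorm V \<eta> \<and> 0 \<le> cstar_norm G f"
    if f: "f \<in> group_algebra G" for f
  proof -
    have S: "finite {s. f s \<noteq> 0}" "{s. f s \<noteq> 0} \<subseteq> carrier G" using f by (auto simp: group_algebra_def)
    have fb: "rep_op V \<pi> f x \<in> carrier V" if "x \<in> carrier V" for x
      using finsum_bound[OF S that] by (simp add: rep_op_def)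
    have "pairing f u = (\<Sum>s | f s \<noteq> 0. f s * cinner V (\<pi> s \<xi>) \<eta>)"
      unfolding pairing_def u coefficient_def using S by (intro sum.cong) auto
    also have "\<dots> = cinner V (rep_op V \<pi> f \<xi>) \<eta>"
      using finsum_bound[OF S \<xi>] \<eta> by (simp add: rep_op_def)
    finally have "cmod (pairing f u) \<le> hnorm V (rep_op V \<pi> f \<xi>) * hnorm V \<eta>"
      using Cauchy_Schwarz[OF fb[OF \<xi>] \<eta>] by simp
    also have "\<dots> \<le> cstar_norm G f * hnorm V \<xi> * hnorm V \<eta>"
      using rep_op_le_cstar_norm[OF r \<xi> f] \<eta> by (intro mult_right_mono) auto
    finally have 1: "cmod (pairing f u) \<le> cstar_norm G f * hnorm V \<xi> * hnorm V \<eta>" .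
    have "hnorm V (rep_op V \<pi> f \<zero>\<^bsub>V\<^esub>) \<le> cstar_norm G f"
      unfolding cstar_norm_def using r by (intro cSup_upper bdd_above_cstar_norm f) force
    moreover have "0 \<le> hnorm V (rep_op V \<pi> f \<zero>\<^bsub>V\<^esub>)" using fb by simp
    ultimately show ?thesis using 1 by simp
  qed
  show thesis
  proof (rule that[of "hnorm V \<xi> * hnorm V \<eta> + 1"])
    show "0 < hnorm V \<xi> * hnorm V \<eta> + 1" using \<xi> \<eta> by (simp add: add_nonneg_pos)
    show "cmod (pairing f u) \<le> (hnorm V \<xi> * hnorm V \<eta> + 1) * cstar_norm G f"
      if "f \<in> group_algebra G" for f
      using b[OF that] by (simp add: algebra_simps)
  qed
qed

lemma cstar_pairing_ex1:
  assumes A: "A \<in> cstar_algebra G" and u: "u \<in> fourier_stieltjes G (discrete G)"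
  shows "\<exists>!z. \<forall>a\<in>A. (\<lambda>n. pairing (a n) u) \<longlonglongrightarrow> z"
proof -
  obtain C where C: "C > 0" "\<And>f. f \<in> group_algebra G \<Longrightarrow> cmod (pairing f u) \<le> C * cstar_norm G f"
    using pairing_bound[OF u] by blast
  obtain a where a: "a \<in> cstar_Cauchy G" and A_eq: "A = cstar_equiv G `` {a}"
    using A by (auto simp: cstar_algebra_def elim: quotientE)
  have ga: "b n \<in> group_algebra G" if "b \<in> cstar_Cauchy G" for b n
    using that by (auto simp: cstar_Cauchy_def)
  have d: "cmod (pairing f u - pairing g u) \<le> C * cstar_norm G (\<lambda>s. f s - g s)"
    if "f \<in> group_algebra G" "g \<in> group_algebra G" for f g
    using C(2)[OF group_algebra_diff[OF that]] by (simp add: pairing_diff[OF that])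
  have "Cauchy (\<lambda>n. pairing (a n) u)"
  proof (rule CauchyI)
    fix e :: real assume "0 < e"
    then obtain N where N: "\<forall>m\<ge>N. \<forall>n\<ge>N. cstar_norm G (\<lambda>s. a m s - a n s) < e / C"
      using a C(1) unfolding cstar_Cauchy_def by (auto dest!: spec[of _ "e / C"])
    have "cmod (pairing (a m) u - pairing (a n) u) < e" if "m \<ge> N" "n \<ge> N" for m n
    proof -
      have "C * cstar_norm G (\<lambda>s. a m s - a n s) < e"
        using N that C(1) by (simp add: field_simps)
      then show ?thesis using d[OF ga[OF a, of m] ga[OF a, of n]] by linarith
    qed
    then show "\<exists>M. \<forall>m\<ge>M. \<forall>n\<ge>M. norm (pairing (a m) u - pairing (a n) u) < e" by blast
  qed
  then obtain z where z: "(\<lambda>n. pairing (a n) u) \<longlonglongrightarrow> z"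
    using Cauchy_convergent_iff convergent_def by blast
  have lim: "(\<lambda>n. pairing (b n) u) \<longlonglongrightarrow> z" if "b \<in> A" for b
  proof -
    have b: "b \<in> cstar_Cauchy G" and ab: "(\<lambda>n. cstar_norm G (\<lambda>s. a n s - b n s)) \<longlonglongrightarrow> 0"
      using that A_eq by (auto simp: cstar_equiv_def)
    have "(\<lambda>n. pairing (a n) u - pairing (b n) u) \<longlonglongrightarrow> 0"
    proof (rule Lim_null_comparison)
      show "\<forall>\<^sub>F n in sequentially. norm (pairing (a n) u - pairing (b n) u)
          \<le> C * cstar_norm G (\<lambda>s. a n s - b n s)"
        using d ga a b by simp
      show "(\<lambda>n. C * cstar_norm G (\<lambda>s. a n s - b n s)) \<longlonglongrightarrow> 0"
        using tendsto_mult_right_zero[OF ab] by simp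
    qed
    from tendsto_diff[OF z this] show ?thesis by simp
  qed
  have ne: "a \<in> A"
  proof -
    interpret topological_group G "discrete G"
      using u by (auto simp: fourier_stieltjes_def unitary_rep_def)
    have "cstar_norm G (\<lambda>s. 0) = 0"
    proof -
      obtain V :: "'a hvec hspace" and \<pi> \<xi> where r: "unitary_rep G (discrete G) V \<pi>" 
        using u by (auto simp: fourier_stieltjes_def)
      interpret unitary_rep G "discrete G" V \<pi> by fact
      have "hnorm V (rep_op V \<pi> (\<lambda>s. 0) \<xi>) = 0" if "unitary_rep G (discrete G) V \<pi>"
        for V :: "'a hvec hspace" and \<pi> \<xi>
      proof -
        interpret unitary_rep G "discrete G" V \<pi> by fact
        show ?thesis by (simp add: rep_op_def)
      qed
      then have "{hnorm V (rep_op V \<pi> (\<lambda>s. 0) \<xi>) | (V :: 'a hvec hspace) \<pi> \<xi>.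
         unitary_rep G (discrete G) V \<pi> \<and> \<xi> \<in> carrier V \<and> hnorm V \<xi> \<le> 1} = {0}"
        using r M.zero_closed hnorm_zero by (force simp del: hnorm_zero)
      then show ?thesis by (simp add: cstar_norm_def)
    qed
    then show ?thesis using a A_eq by (simp add: cstar_equiv_def)
  qed
  show ?thesis
    using lim LIMSEQ_unique ne by (intro ex1I[of _ z]) blast+
qed

end

theory Submission
  imports Defs
begin

text \<open>If \<open>\<chi>\<^sub>H\<close> lies in \<open>B\<^sup>d(G)\<close>, then \<open>\<chi>\<^sub>H\<close> itself separates every point off \<open>H\<close>: it is positive definite,
because \<open>(s, t) \<mapsto> \<chi>\<^sub>H(t\<^sup>-\<^sup>1 s)\<close> is the Kronecker kernel of the cosets of \<open>H\<close>.

Conversely, suppose that \<open>u\<^sub>s\<close> separates \<open>s \<notin> H\<close> from \<open>H\<close>. Since \<open>\<bar>u\<^sub>s(s)\<bar> \<le> u\<^sub>s(1) = 1\<close> and \<open>u\<^sub>s(s) \<noteq> 1\<close>, strict convexity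
of the disc gives \<open>\<bar>v\<^sub>s(s)\<bar> < 1\<close> for \<open>v\<^sub>s = (1 + u\<^sub>s)/2\<close>, and \<open>v\<^sub>s\<close> still belongs to
\<open>M = B\<^sup>d(G) \<inter> P\<^sub>H(G\<^sub>d)\<close>. As \<open>M\<close> is closed under products, it contains \<open>\<Prod>\<^sub>s\<^sub>\<in>\<^sub>P v\<^sub>s\<^sup>n\<close> for every finite
\<open>P \<subseteq> G - H\<close>, and this net converges to \<open>\<chi>\<^sub>H\<close> pointwise as \<open>P\<close> and \<open>n\<close> grow. A positive definite
function with value 1 at the identity has norm at most 1 as a functional on \<open>C\<^sup>*(G\<^sub>d)\<close>
(\<open>pairing_positive_definite_bound\<close>), and finitely supported functions are dense there. On such a
bounded set pointwise convergence is therefore weak\<open>\<^sup>*\<close> convergence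
(\<open>weak_star_limit_of_normalized\<close>), so the limit \<open>\<chi>\<^sub>H\<close> stays in the closed set \<open>B\<^sup>d(G)\<close>.

That \<open>B\<^sup>d(G)\<close> is closed under products (\<open>Bd_mult\<close>) rests on two facts: \<open>B(G)\<close> is closed under products,
and multiplication by a fixed \<open>w \<in> B(G\<^sub>d)\<close> is weak\<open>\<^sup>*\<close> continuous. The second holds because
\<open>f \<mapsto> f w\<close> is bounded for the universal norm (\<open>cstar_norm_mult\<close>) and hence acts on \<open>C\<^sup>*(G\<^sub>d)\<close>.

A single construction supplies all representations. A positive definite kernel \<open>k\<close> on a set with
a \<open>G\<close>-action that preserves \<open>k\<close> has a reproducing kernel Hilbert space on which \<open>G\<close> acts
unitarily by translation, and the values \<open>k(s x, y)\<close> are its coefficients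
(\<open>unitary_rep_rkhs\<close>). For \<open>k(s, t) = u(t\<^sup>-\<^sup>1 s)\<close> on \<open>G\<close> this is the GNS representation of a positive definite
function \<open>u\<close>. For the product of two inner products it is the tensor product of two
representations, and positivity of the product kernel is Schur's theorem (\<open>Schur_product\<close>). Adding a constant
to a kernel amounts to adding a copy of the trivial representation.\<close>

section \<open>Positive definite kernels\<close>

text \<open>A list of pairs \<open>(a, x)\<close> stands for the formal combination \<open>\<Sum> a \<delta>\<^sub>x\<close>. With lists, addition is
concatenation and repeated points are harmless, so that identities about combinations are plain
inductions. The pairing with a function is conjugate linear in the combination because
inner products are linear in the first argument; it will be the inner product of \<open>F\<close> with the image
of the combination in the Hilbert space.\<close>

fun lincomb_pair :: "('x \<Rightarrow> complex) \<Rightarrow> (complex \<times> 'x) list \<Rightarrow> complex" where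
  "lincomb_pair F [] = 0"
| "lincomb_pair F ((b, y) # m) = cnj b * F y + lincomb_pair F m"

text \<open>The image of a formal combination in the Hilbert space of \<open>k\<close>: the point \<open>x\<close> becomes the
section \<open>k x\<close>.\<close>

fun kspan :: "('x \<Rightarrow> 'x \<Rightarrow> complex) \<Rightarrow> (complex \<times> 'x) list \<Rightarrow> 'x \<Rightarrow> complex" where
  "kspan k [] = (\<lambda>y. 0)"
| "kspan k ((a, x) # l) = (\<lambda>y. a * k x y + kspan k l y)"

definition hform :: "('x \<Rightarrow> 'x \<Rightarrow> complex) \<Rightarrow> (complex \<times> 'x) list \<Rightarrow> (complex \<times> 'x) list \<Rightarrow> complex" where
  "hform k l m = lincomb_pair (kspan k l) m"

definition lincomb_scale :: "complex \<Rightarrow> (complex \<times> 'x) list \<Rightarrow> (complex \<times> 'x) list" where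
  "lincomb_scale c l = map (\<lambda>(a, x). (c * a, x)) l"

definition lincomb_map :: "('x \<Rightarrow> 'y) \<Rightarrow> (complex \<times> 'x) list \<Rightarrow> (complex \<times> 'y) list" where
  "lincomb_map g l = map (\<lambda>(a, x). (a, g x)) l"

definition pd_kernel :: "('x \<Rightarrow> 'x \<Rightarrow> complex) \<Rightarrow> bool" where
  "pd_kernel k \<longleftrightarrow> (\<forall>l. hform k l l \<in> \<real>\<^sub>\<ge>\<^sub>0)"

lemma lincomb_pair_append [simp]: "lincomb_pair F (l @ m) = lincomb_pair F l + lincomb_pair F m"
  by (induction F l rule: lincomb_pair.induct) auto

lemma lincomb_pair_scale [simp]: "lincomb_pair F (lincomb_scale c m) = cnj c * lincomb_pair F m"
  by (induction F m rule: lincomb_pair.induct) (auto simp: lincomb_scale_def algebra_simps)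

lemma lincomb_pair_translate: "lincomb_pair F (lincomb_map g m) = lincomb_pair (\<lambda>x. F (g x)) m"
  by (induction m) (auto simp: lincomb_map_def)

lemma lincomb_pair_linear [simp]:
  "lincomb_pair (\<lambda>x. F x + F' x) m = lincomb_pair F m + lincomb_pair F' m"
  "lincomb_pair (\<lambda>x. F x - F' x) m = lincomb_pair F m - lincomb_pair F' m"
  "lincomb_pair (\<lambda>x. c * F x) m = c * lincomb_pair F m"
  "lincomb_pair (\<lambda>x. 0) m = 0"
  by (induction m; auto simp: algebra_simps)+

lemma kspan_append [simp]: "kspan k (l @ m) = (\<lambda>y. kspan k l y + kspan k m y)"
  by (induction k l rule: kspan.induct) auto

lemma kspan_scale [simp]: "kspan k (lincomb_scale c l) = (\<lambda>y. c * kspan k l y)"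
  by (induction k l rule: kspan.induct) (auto simp: lincomb_scale_def algebra_simps)

lemma hform_simps [simp]:
  "hform k [] m = 0" "hform k l [] = 0"
  "hform k (l @ l') m = hform k l m + hform k l' m"
  "hform k l (m @ m') = hform k l m + hform k l m'"
  "hform k (lincomb_scale c l) m = c * hform k l m"
  "hform k l (lincomb_scale c m) = cnj c * hform k l m"
  by (simp_all add: hform_def)

lemma hform_singletons: "hform k [(a, x)] [(b, y)] = a * cnj b * k x y"
  by (simp add: hform_def)

lemma hform_singleton_right: "hform k l [(b, y)] = cnj b * kspan k l y"
  by (simp add: hform_def)

lemma kspan_kernel_linear:
  "kspan (\<lambda>x y. k x y + k' x y) l = (\<lambda>y. kspan k l y + kspan k' l y)"
  "kspan (\<lambda>x y. c * k x y) l = (\<lambda>y. c * kspan k l y)"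
  by (induction l; auto simp: algebra_simps)+

lemma hform_kernel_linear:
  "hform (\<lambda>x y. k x y + k' x y) l m = hform k l m + hform k' l m"
  "hform (\<lambda>x y. c * k x y) l m = c * hform k l m"
  by (simp_all add: hform_def kspan_kernel_linear)

lemma pd_kernel_add: "pd_kernel k \<Longrightarrow> pd_kernel k' \<Longrightarrow> pd_kernel (\<lambda>x y. k x y + k' x y)"
  by (simp add: pd_kernel_def hform_kernel_linear nonneg_Reals_add_I)

lemma pd_kernel_scale: "pd_kernel k \<Longrightarrow> 0 \<le> r \<Longrightarrow> pd_kernel (\<lambda>x y. complex_of_real r * k x y)"
  by (simp add: pd_kernel_def hform_kernel_linear nonneg_Reals_mult_I)

text \<open>Weights on the points can be absorbed into the coefficients, so conjugating a kernel by a
function keeps it positive definite.\<close>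

lemma hform_weighted:
  "hform (\<lambda>x y. g x * cnj (g y) * k x y) l m
    = hform k (map (\<lambda>(a, x). (a * g x, x)) l) (map (\<lambda>(a, x). (a * g x, x)) m)"
proof -
  have 1: "kspan (\<lambda>x y. g x * cnj (g y) * k x y) l y = cnj (g y) * kspan k (map (\<lambda>(a, x). (a * g x, x)) l) y" for y
    by (induction l) (auto simp: algebra_simps)
  have 2: "lincomb_pair (\<lambda>y. cnj (g y) * F y) m = lincomb_pair F (map (\<lambda>(a, x). (a * g x, x)) m)" for F
    by (induction m) (auto simp: algebra_simps)
  show ?thesis unfolding hform_def 1 2 ..
qed

lemma pd_kernel_weighted: "pd_kernel k \<Longrightarrow> pd_kernel (\<lambda>x y. g x * cnj (g y) * k x y)"
  by (simp add: pd_kernel_def hform_weighted)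

lemma hform_pullback:
  "hform (\<lambda>x y. k (g x) (g y)) l m = hform k (lincomb_map g l) (lincomb_map g m)"
proof -
  have "kspan (\<lambda>x y. k (g x) (g y)) l = (\<lambda>y. kspan k (lincomb_map g l) (g y))"
    by (induction l) (auto simp: lincomb_map_def)
  then show ?thesis by (simp add: hform_def lincomb_pair_translate)
qed

lemma pd_kernel_pullback: "pd_kernel k \<Longrightarrow> pd_kernel (\<lambda>x y. k (g x) (g y))"
  by (simp add: pd_kernel_def hform_pullback)

lemma pd_kernel_one: "pd_kernel (\<lambda>(x :: 'b) (y :: 'b). 1)"
proof -
  have 1: "kspan (\<lambda>x y. 1) l = (\<lambda>y :: 'b. cnj (lincomb_pair (\<lambda>_. 1) l))" for l
    by (induction l) auto
  have 2: "lincomb_pair (\<lambda>y. c) l = c * lincomb_pair (\<lambda>_. 1) l" for c and l :: "(complex \<times> 'b) list"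
    using lincomb_pair_linear(3)[of c "\<lambda>_. 1" l] by simp
  show ?thesis
    unfolding pd_kernel_def
  proof
    fix l :: "(complex \<times> 'b) list"
    let ?z = "lincomb_pair (\<lambda>_. 1) l"
    have "hform (\<lambda>x y. 1) l l = cnj ?z * ?z"
      using 2[of "cnj ?z"] by (simp only: hform_def 1)
    also have "\<dots> = complex_of_real ((cmod ?z)\<^sup>2)"
      using complex_norm_square[of ?z] by (simp only: mult.commute)
    finally show "hform (\<lambda>x y. 1) l l \<in> \<real>\<^sub>\<ge>\<^sub>0"
      by (simp only: nonneg_Reals_of_real_iff zero_le_power2)
  qed
qed

definition knorm :: "('x \<Rightarrow> 'x \<Rightarrow> complex) \<Rightarrow> (complex \<times> 'x) list \<Rightarrow> real" where
  "knorm k l = sqrt (Re (hform k l l))"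

context
  fixes k :: "'x \<Rightarrow> 'x \<Rightarrow> complex"
  assumes pd: "pd_kernel k"
begin

lemma hform_self: "0 \<le> Re (hform k l l)" "hform k l l = complex_of_real ((knorm k l)\<^sup>2)"
proof -
  have "hform k l l \<in> \<real>\<^sub>\<ge>\<^sub>0" using pd by (simp add: pd_kernel_def)
  then show "0 \<le> Re (hform k l l)" "hform k l l = complex_of_real ((knorm k l)\<^sup>2)"
    by (auto simp: complex_nonneg_Reals_iff knorm_def complex_eq_iff)
qed

lemma knorm_nonneg [simp]: "0 \<le> knorm k l"
  using hform_self(1) by (simp add: knorm_def)

text \<open>The form is real on \<open>\<delta>\<^sub>x + \<delta>\<^sub>y\<close> and on \<open>\<delta>\<^sub>x + \<i> \<delta>\<^sub>y\<close>; the first fact compares the imaginary parts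
of \<open>k x y\<close> and \<open>k y x\<close>, the second their real parts.\<close>

lemma pd_kernel_hermitian: "k y x = cnj (k x y)"
proof -
  have 1: "Im (hform k l l) = 0" for l by (simp add: hform_self(2) del: of_real_power)
  have "Im (k x y + k y x + k x x + k y y) = 0" 
    using 1[of "[(1,x),(1,y)]"] by (simp add: hform_def)
  moreover have "Im (k x x) = 0" "Im (k y y) = 0" using 1[of "[(1,x)]"] 1[of "[(1,y)]"]
    by (simp_all add: hform_def)
  moreover have "Re (k x y) = Re (k y x)"
    using 1[of "[(1,x),(\<i>,y)]"] \<open>Im (k x x) = 0\<close> \<open>Im (k y y) = 0\<close> by (simp add: hform_def)
  ultimately show ?thesis by (simp add: complex_eq_iff)
qed

lemma hform_commute: "hform k m l = cnj (hform k l m)"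
proof (induction l arbitrary: m)
  case (Cons p l)
  obtain a x where p: "p = (a, x)" by force
  have "hform k m [(a, x)] = cnj (hform k [(a, x)] m)"
    by (induction m) (auto simp: hform_def pd_kernel_hermitian[of _ x] algebra_simps)
  then show ?case using Cons[of m] hform_simps(3)[of k "[p]" l m] hform_simps(4)[of k m "[p]" l] 
    by (simp add: p)
qed simp

lemma hform_Cauchy_Schwarz: "cmod (hform k l m) \<le> knorm k l * knorm k m"
proof -
  define z where "z = hform k l m"
  have zz: "z * cnj z = complex_of_real ((cmod z)\<^sup>2)" by (simp only: complex_norm_square)
  have q: "0 \<le> (knorm k l)\<^sup>2 - 2 * r * (cmod z)\<^sup>2 + r\<^sup>2 * (cmod z)\<^sup>2 * (knorm k m)\<^sup>2" for r
  proof -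
    \<comment> \<open>The phase of \<open>z\<close> in the coefficient makes the mixed term real, leaving a real quadratic in \<open>r\<close>.\<close>
    let ?c = "- complex_of_real r * z"
    have "hform k (l @ lincomb_scale ?c m) (l @ lincomb_scale ?c m)
       = hform k l l - 2 * complex_of_real r * (z * cnj z) 
        + complex_of_real (r\<^sup>2) * (z * cnj z) * hform k m m"
      using hform_commute[of m l] by (simp add: z_def[symmetric] algebra_simps power2_eq_square)
    also have "\<dots> = complex_of_real ((knorm k l)\<^sup>2 - 2 * r * (cmod z)\<^sup>2 + r\<^sup>2 * (cmod z)\<^sup>2 * (knorm k m)\<^sup>2)"
      by (simp add: zz hform_self(2))
    finally show ?thesis using hform_self(1)[of "l @ lincomb_scale ?c m"] by simp
  qed
  have "(cmod z)\<^sup>2 \<le> (knorm k l * knorm k m)\<^sup>2"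
  proof (cases "knorm k m = 0")
    case True
    \<comment> \<open>The form may be degenerate: the quadratic is then affine in \<open>r\<close>, and being bounded below it
      has slope 0.\<close>
    have "(cmod z)\<^sup>2 \<le> 0"
    proof (rule ccontr)
      assume "\<not> ?thesis"
      then have "((knorm k l)\<^sup>2 + 1) / (cmod z)\<^sup>2 * (cmod z)\<^sup>2 = (knorm k l)\<^sup>2 + 1"
        by simp
      then have "0 \<le> (knorm k l)\<^sup>2 - 2 * ((knorm k l)\<^sup>2 + 1)"
        using q[of "((knorm k l)\<^sup>2 + 1) / (cmod z)\<^sup>2"] unfolding True mult.assoc by simp
      then show False using zero_le_power2[of "knorm k l"] unfolding distrib_left by linarith
    qed
    then show ?thesis using True by simp
  next
    case False
    define M where "M = (knorm k m)\<^sup>2"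
    have M: "M > 0" using False by (simp add: M_def)
    have "2 * (1 / M) * (cmod z)\<^sup>2 = 2 * ((cmod z)\<^sup>2 / M)"
      "(1 / M)\<^sup>2 * (cmod z)\<^sup>2 * M = (cmod z)\<^sup>2 / M"
      using M by (simp_all add: power2_eq_square)
    then have "(cmod z)\<^sup>2 / M \<le> (knorm k l)\<^sup>2"
      using q[of "1 / M"] unfolding M_def[symmetric] by linarith
    then have "(cmod z)\<^sup>2 \<le> (knorm k l)\<^sup>2 * M" using M by (simp only: pos_divide_le_eq)
    then show ?thesis by (simp only: M_def power_mult_distrib)
  qed
  then show ?thesis unfolding z_def by (rule power2_le_imp_le) simp
qed

lemma knorm_point: "knorm k [(1, x)] = sqrt (Re (k x x))"
  by (simp add: knorm_def hform_def)

lemma pd_kernel_Cauchy_Schwarz: "cmod (k x y) \<le> sqrt (Re (k x x)) * sqrt (Re (k y y))"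
  using hform_Cauchy_Schwarz[of "[(1, x)]" "[(1, y)]"] by (simp add: hform_singletons knorm_point)

lemma pd_kernel_diag: "k x x = complex_of_real (Re (k x x))" "0 \<le> Re (k x x)"
proof -
  have "hform k [(1, x)] [(1, x)] = k x x" by (simp add: hform_singletons)
  then show "0 \<le> Re (k x x)" "k x x = complex_of_real (Re (k x x))"
    by (metis hform_self(1), metis hform_self(2) Re_complex_of_real)
qed

text \<open>The new kernel is the old one evaluated on the projections of the \<open>\<delta>\<^sub>x\<close> onto the orthogonal complement of
\<open>\<delta>\<^sub>p\<close>: its value on a combination is the old form on that combination minus its component
along \<open>\<delta>\<^sub>p\<close>.\<close>

lemma schur_complement:
  assumes p: "k p p \<noteq> 0"
  shows "pd_kernel (\<lambda>x y. k x y - k x p * k p y / k p p)"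
proof -
  let ?k = "\<lambda>x y. k x y - k x p * k p y / k p p"
  have "hform ?k l l \<in> \<real>\<^sub>\<ge>\<^sub>0" for l
  proof -
    have k1: "kspan ?k l = (\<lambda>y. kspan k l y - (kspan k l p / k p p) * k p y)" for l
    proof (induction l)
      case (Cons q l)
      obtain a x where q: "q = (a, x)" by force
      show ?case by (simp only: q kspan.simps Cons.IH) (simp only: divide_inverse algebra_simps)
    qed simp
    have h1: "lincomb_pair (\<lambda>y. k p y) l = cnj (kspan k l p)"
      using hform_commute[of "[(1, p)]" l] by (simp add: hform_def)
    have "hform ?k l l = hform k l l - kspan k l p / k p p * lincomb_pair (\<lambda>y. k p y) l"
      by (simp only: hform_def k1 lincomb_pair_linear)
    also have "\<dots> = hform k l l - kspan k l p * cnj (kspan k l p) / k p p"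
      by (simp add: h1)
    also have "\<dots> = hform k (l @ [(- kspan k l p / k p p, p)]) (l @ [(- kspan k l p / k p p, p)])"
    proof -
      have c: "cnj (k p p) = k p p" by (rule pd_kernel_hermitian[symmetric])
      have "hform k [(a, p)] l = a * cnj (kspan k l p)" for a
        using hform_commute[of "[(a, p)]" l] by (simp add: hform_singleton_right)
      moreover have "(kspan k l p / k p p) * (cnj (kspan k l p) / k p p) * k p p
          = kspan k l p * cnj (kspan k l p) / k p p"
        using p by simp
      ultimately show ?thesis 
        by (simp add: hform_singleton_right hform_singletons c mult_ac)
    qed
    finally show ?thesis using pd by (simp only: pd_kernel_def)
  qed
  then show ?thesis by (simp add: pd_kernel_def)
qed

end

section \<open>The Schur product theorem\<close>

text \<open>Only finitely many points matter for a given combination. Eliminating a point \<open>p\<close> with \<open>k p p \<noteq> 0\<close> writes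
\<open>k\<close> as its Schur complement at \<open>p\<close>, which has fewer nonzero diagonal entries, plus a kernel
of rank one. The product of the rank one part with \<open>k'\<close> is a reweighting of \<open>k'\<close>, and induction on the number of
nonzero diagonal entries takes care of the rest. If there are none, \<open>k\<close> vanishes by the
Cauchy--Schwarz inequality.\<close>

theorem Schur_product:
  fixes k :: "'x \<Rightarrow> 'x \<Rightarrow> complex" and k' :: "'y \<Rightarrow> 'y \<Rightarrow> complex"
  assumes "pd_kernel k" and k': "pd_kernel k'"
  shows "pd_kernel (\<lambda>(x, y) (x', y'). k x x' * k' y y')"
proof -
  have "hform (\<lambda>p q. k (fst p) (fst q) * k' (snd p) (snd q)) l l \<in> \<real>\<^sub>\<ge>\<^sub>0" for l
    using \<open>pd_kernel k\<close>
  proof (induction "card {x \<in> fst ` snd ` set l. k x x \<noteq> 0}" arbitrary: k rule: less_induct)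
    case less
    note pd = \<open>pd_kernel k\<close>
    let ?S = "\<lambda>k. {x \<in> fst ` snd ` set l. k x x \<noteq> 0}"
    show ?case
    proof (cases "?S k = {}")
      case True
      have z: "k (fst p) y = 0" if "(a, p) \<in> set l" for a p y
      proof -
        have "fst p \<in> fst ` snd ` set l" using imageI[OF imageI[OF that, of snd], of fst] by simp
        then have "k (fst p) (fst p) = 0" using True by blast
        then have "cmod (k (fst p) y) \<le> 0"
          using pd_kernel_Cauchy_Schwarz[OF pd, of "fst p" y] by simp
        then show ?thesis by simp
      qed
      have "set l' \<subseteq> set l \<Longrightarrow> kspan (\<lambda>p q. k (fst p) (fst q) * k' (snd p) (snd q)) l' q = 0" for l' q
      proof (induction l')
        case (Cons t l')
        obtain a p where t: "t = (a, p)" by (rule prod.exhaust)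
        have "k (fst p) (fst q) = 0" using z[of a p] Cons.prems t by simp
        then show ?case using Cons by (simp add: t)
      qed simp
      then have "kspan (\<lambda>p q. k (fst p) (fst q) * k' (snd p) (snd q)) l = (\<lambda>q. 0)" by blast
      then show ?thesis by (simp add: hform_def)
    next
      case False
      then obtain p where p: "p \<in> ?S k" by blast
      then have kp: "k p p \<noteq> 0" by simp
      define r where "r x y = k x y - k x p * k p y / k p p" for x y
      have r: "pd_kernel r" unfolding r_def using schur_complement[OF pd kp] .
      have "r x x = 0" if "k x x = 0" for x
      proof -
        have "cmod (k x p) \<le> 0" using pd_kernel_Cauchy_Schwarz[OF pd, of x p] unfolding that by simp
        then show ?thesis using that by (simp add: r_def)
      qed
      then have "?S r \<subseteq> ?S k" by blast
      moreover have "p \<notin> ?S r" using kp by (simp add: r_def)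
      ultimately have "?S r \<subset> ?S k" using p by blast
      then have "card (?S r) < card (?S k)" by (rule psubset_card_mono[rotated]) simp
      from less.hyps[OF this r] have 1: "hform (\<lambda>p q. r (fst p) (fst q) * k' (snd p) (snd q)) l l \<in> \<real>\<^sub>\<ge>\<^sub>0" .
      define g where "g q = k (fst q) p" for q :: "'x \<times> 'y"
      define w where "w q q' = complex_of_real (1 / Re (k p p)) * (g q * cnj (g q') * k' (snd q) (snd q'))"
        for q q'
      have "pd_kernel w"
        unfolding w_def
      proof (rule pd_kernel_scale)
        show "pd_kernel (\<lambda>q q'. g q * cnj (g q') * k' (snd q) (snd q'))"
          by (rule pd_kernel_weighted[OF pd_kernel_pullback[OF k']])
        show "0 \<le> 1 / Re (k p p)" using pd_kernel_diag(2)[OF pd] by simp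
      qed
      have "k x p * k p y / k p p = complex_of_real (1 / Re (k p p)) * (k x p * cnj (k y p))" for x y
      proof -
        have "k p p = complex_of_real (Re (k p p))" "k p y = cnj (k y p)"
          by (rule pd_kernel_diag[OF pd] pd_kernel_hermitian[OF pd])+
        then have "k x p * k p y / k p p = k x p * cnj (k y p) / complex_of_real (Re (k p p))" by metis
        then show ?thesis by simp
      qed
      then have "k (fst q) (fst q') * k' (snd q) (snd q')
          = r (fst q) (fst q') * k' (snd q) (snd q') + w q q'" for q q'
        by (simp only: r_def w_def g_def left_diff_distrib mult.assoc) simp
      then show ?thesis
        using 1 \<open>pd_kernel w\<close> by (simp only: pd_kernel_def hform_kernel_linear(1) nonneg_Reals_add_I)
    qed
  qed
  then show ?thesis by (simp add: pd_kernel_def case_prod_beta')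
qed

section \<open>The Hilbert space of a positive definite kernel\<close>

text \<open>The distance between \<open>F\<close> and the combination \<open>l\<close> is measured in the norm dual to \<open>knorm\<close>, with both read as
functionals on combinations. Since this norm is defined before any inner product
on functions, the Hilbert space can be described as the closure of the kernel sections inside the
functions on the given set, which avoids equivalence classes of Cauchy sequences.\<close>

definition approximates ::
  "('x \<Rightarrow> 'x \<Rightarrow> complex) \<Rightarrow> ('x \<Rightarrow> complex) \<Rightarrow> (complex \<times> 'x) list \<Rightarrow> real \<Rightarrow> bool" where
  "approximates k F l e \<longleftrightarrow> 0 \<le> e \<and> (\<forall>m. cmod (lincomb_pair F m - hform k l m) \<le> e * knorm k m)"

definition approx_seq ::
  "('x \<Rightarrow> 'x \<Rightarrow> complex) \<Rightarrow> ('x \<Rightarrow> complex) \<Rightarrow> (nat \<Rightarrow> (complex \<times> 'x) list) \<Rightarrow> bool" where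
  "approx_seq k F l \<longleftrightarrow> (\<exists>\<delta>. \<delta> \<longlonglongrightarrow> 0 \<and> (\<forall>n. approximates k F (l n) (\<delta> n)))"

definition rkhs_carrier :: "('x \<Rightarrow> 'x \<Rightarrow> complex) \<Rightarrow> ('x \<Rightarrow> complex) set" where
  "rkhs_carrier k = {F. \<forall>e>0. \<exists>l. approximates k F l e}"

definition rkhs_seq :: "('x \<Rightarrow> 'x \<Rightarrow> complex) \<Rightarrow> ('x \<Rightarrow> complex) \<Rightarrow> nat \<Rightarrow> (complex \<times> 'x) list" where
  "rkhs_seq k F = (SOME l. approx_seq k F l)"

text \<open>Pairing with \<open>F\<close> is continuous for \<open>knorm\<close>, which makes the limit exist and independent of the
approximating sequence; see \<open>rkhs_inner_lim\<close>.\<close>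

definition rkhs_inner :: "('x \<Rightarrow> 'x \<Rightarrow> complex) \<Rightarrow> ('x \<Rightarrow> complex) \<Rightarrow> ('x \<Rightarrow> complex) \<Rightarrow> complex" where
  "rkhs_inner k F G = lim (\<lambda>n. lincomb_pair F (rkhs_seq k G n))"

definition rkhs :: "('x \<Rightarrow> 'x \<Rightarrow> complex) \<Rightarrow> ('x \<Rightarrow> complex) hspace" where
  "rkhs k = \<lparr>carrier = rkhs_carrier k, monoid.mult = undefined, one = undefined,
    zero = \<lambda>_. 0, add = \<lambda>F G x. F x + G x, smult = \<lambda>c F x. c * F x, cinner = rkhs_inner k\<rparr>"

lemma rkhs_simps [simp]:
  "carrier (rkhs k) = rkhs_carrier k" "\<zero>\<^bsub>rkhs k\<^esub> = (\<lambda>_. 0)"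
  "F \<oplus>\<^bsub>rkhs k\<^esub> G = (\<lambda>x. F x + G x)" "c \<odot>\<^bsub>rkhs k\<^esub> F = (\<lambda>x. c * F x)"
  "cinner (rkhs k) = rkhs_inner k"
  by (simp_all add: rkhs_def)

context
  fixes k :: "'x \<Rightarrow> 'x \<Rightarrow> complex"
  assumes pd: "pd_kernel k"
begin

lemma approximates_kspan: "approximates k (kspan k l) l 0"
  by (simp add: approximates_def hform_def)

lemma approximates_add:
  assumes "approximates k F l e" "approximates k G m d"
  shows "approximates k (\<lambda>x. F x + G x) (l @ m) (e + d)"
  unfolding approximates_def
proof (intro conjI allI)
  fix p
  have "cmod (lincomb_pair (\<lambda>x. F x + G x) p - hform k (l @ m) p)
      \<le> cmod (lincomb_pair F p - hform k l p) + cmod (lincomb_pair G p - hform k m p)"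
    by (rule order_trans[OF _ norm_triangle_ineq]) (simp add: algebra_simps)
  also have "\<dots> \<le> e * knorm k p + d * knorm k p"
    using assms by (intro add_mono) (auto simp: approximates_def)
  finally show "cmod (lincomb_pair (\<lambda>x. F x + G x) p - hform k (l @ m) p) \<le> (e + d) * knorm k p"
    by (simp add: distrib_right)
qed (use assms in \<open>auto simp: approximates_def\<close>)

lemma approximates_scale:
  assumes "approximates k F l e"
  shows "approximates k (\<lambda>x. c * F x) (lincomb_scale c l) (cmod c * e)"
  unfolding approximates_def
proof (intro conjI allI)
  fix p
  have "cmod (lincomb_pair (\<lambda>x. c * F x) p - hform k (lincomb_scale c l) p) = cmod c * cmod (lincomb_pair F p - hform k l p)"
    by (simp add: right_diff_distrib[symmetric] norm_mult)
  also have "\<dots> \<le> cmod c * (e * knorm k p)"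
    using assms by (intro mult_left_mono) (auto simp: approximates_def)
  finally show "cmod (lincomb_pair (\<lambda>x. c * F x) p - hform k (lincomb_scale c l) p) \<le> cmod c * e * knorm k p"
    by (simp add: mult.assoc)
qed (use assms in \<open>auto simp: approximates_def\<close>)

lemma approx_seq_add: "approx_seq k F l \<Longrightarrow> approx_seq k G m \<Longrightarrow> approx_seq k (\<lambda>x. F x + G x) (\<lambda>n. l n @ m n)"
  unfolding approx_seq_def by (elim exE conjE) (rule exI, rule conjI, erule (1) tendsto_add_zero, simp add: approximates_add)

lemma approx_seq_scale: "approx_seq k F l \<Longrightarrow> approx_seq k (\<lambda>x. c * F x) (\<lambda>n. lincomb_scale c (l n))"
proof -
  assume "approx_seq k F l"
  then obtain \<delta> where "\<delta> \<longlonglongrightarrow> 0" "\<And>n. approximates k F (l n) (\<delta> n)"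
    by (auto simp: approx_seq_def)
  then show ?thesis
    unfolding approx_seq_def
    by (intro exI[of _ "\<lambda>n. cmod c * \<delta> n"] conjI allI tendsto_mult_right_zero approximates_scale)
qed

lemma approx_seq_kspan: "approx_seq k (kspan k l) (\<lambda>n. l)"
  unfolding approx_seq_def using approximates_kspan by (intro exI[of _ "\<lambda>n. 0"]) simp

lemma rkhs_carrier_iff: "F \<in> rkhs_carrier k \<longleftrightarrow> (\<exists>l. approx_seq k F l)"
proof
  assume "F \<in> rkhs_carrier k"
  then have "\<forall>n. \<exists>l. approximates k F l (1 / real (Suc n))" by (simp add: rkhs_carrier_def)
  then obtain l where "\<forall>n. approximates k F (l n) (1 / real (Suc n))" by metis
  then show "\<exists>l. approx_seq k F l"
    unfolding approx_seq_def using LIMSEQ_Suc[OF lim_1_over_n] by blast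
next
  assume "\<exists>l. approx_seq k F l"
  then obtain l \<delta> where d: "\<delta> \<longlonglongrightarrow> 0" "\<And>n. approximates k F (l n) (\<delta> n)"
    by (auto simp: approx_seq_def)
  show "F \<in> rkhs_carrier k"
    unfolding rkhs_carrier_def
  proof (intro CollectI allI impI)
    fix e :: real assume "0 < e"
    then obtain n where "\<delta> n < e"
      using order_tendstoD(2)[OF d(1), of e] by (auto simp: eventually_sequentially)
    moreover have "\<delta> n * knorm k m \<le> e * knorm k m" for m
      using \<open>\<delta> n < e\<close> knorm_nonneg[OF pd] by (intro mult_right_mono) auto
    ultimately have "approximates k F (l n) e"
      using d(2)[of n] \<open>0 < e\<close> by (auto simp: approximates_def intro: order_trans)
    then show "\<exists>l. approximates k F l e" by blast
  qed
qed

lemma approx_seq_rkhs_seq: "F \<in> rkhs_carrier k \<Longrightarrow> approx_seq k F (rkhs_seq k F)"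
  using someI_ex[of "approx_seq k F"] by (simp add: rkhs_seq_def rkhs_carrier_iff)

lemma rkhs_closed [simp]:
  "kspan k l \<in> rkhs_carrier k"
  "F \<in> rkhs_carrier k \<Longrightarrow> G \<in> rkhs_carrier k \<Longrightarrow> (\<lambda>x. F x + G x) \<in> rkhs_carrier k"
  "F \<in> rkhs_carrier k \<Longrightarrow> (\<lambda>x. c * F x) \<in> rkhs_carrier k"
  unfolding rkhs_carrier_iff using approx_seq_add approx_seq_scale approx_seq_kspan by blast+

lemma rkhs_closed' [simp]:
  "(\<lambda>_. 0) \<in> rkhs_carrier k"
  "F \<in> rkhs_carrier k \<Longrightarrow> (\<lambda>x. - F x) \<in> rkhs_carrier k"
  "F \<in> rkhs_carrier k \<Longrightarrow> G \<in> rkhs_carrier k \<Longrightarrow> (\<lambda>x. F x - G x) \<in> rkhs_carrier k"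
  using rkhs_closed(1)[of "[]"] rkhs_closed(3)[of _ "-1"]
    rkhs_closed(2)[of F "\<lambda>x. - 1 * G x"] by simp_all

lemma approximates_bound:
  assumes "approximates k F l e"
  shows "cmod (lincomb_pair F m) \<le> (knorm k l + e) * knorm k m"
proof -
  have "cmod (lincomb_pair F m) \<le> cmod (lincomb_pair F m - hform k l m) + cmod (hform k l m)"
    using norm_triangle_ineq[of "lincomb_pair F m - hform k l m" "hform k l m"] by simp
  also have "\<dots> \<le> e * knorm k m + knorm k l * knorm k m"
    using assms hform_Cauchy_Schwarz[OF pd] by (intro add_mono) (auto simp: approximates_def)
  finally show ?thesis by (simp add: algebra_simps)
qed

lemma rkhs_bounded:
  assumes "F \<in> rkhs_carrier k"
  obtains C where "0 \<le> C" "\<And>m. cmod (lincomb_pair F m) \<le> C * knorm k m"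
proof -
  obtain l where "approximates k F l 1" using assms zero_less_one unfolding rkhs_carrier_def by blast
  then show thesis using approximates_bound knorm_nonneg[OF pd] that[of "knorm k l + 1"] by simp
qed

lemma knorm_le_of_hform:
  assumes "cmod (hform k d d) \<le> e * knorm k d" "0 \<le> e"
  shows "knorm k d \<le> e"
proof (cases "knorm k d = 0")
  case False
  then have "0 < knorm k d" using knorm_nonneg[OF pd, of d] by linarith
  moreover have "cmod (hform k d d) = knorm k d * knorm k d"
    unfolding hform_self(2)[OF pd, of d] by (simp add: power2_eq_square norm_mult)
  ultimately show ?thesis using assms(1) by simp
qed (use assms in simp)

text \<open>Testing the difference of the two combinations against itself bounds the
square of its seminorm by \<open>e + d\<close> times its seminorm.\<close>

lemma approximates_close:
  assumes "approximates k F l e" "approximates k F m d"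
  shows "knorm k (l @ lincomb_scale (-1) m) \<le> e + d"
proof (rule knorm_le_of_hform)
  let ?d = "l @ lincomb_scale (-1) m"
  have "hform k ?d ?d = (lincomb_pair F ?d - hform k m ?d) - (lincomb_pair F ?d - hform k l ?d)"
    unfolding hform_simps(3)[of k l "lincomb_scale (-1) m" ?d] hform_simps(5) by simp
  also have "cmod \<dots> \<le> d * knorm k ?d + e * knorm k ?d"
    using assms unfolding approximates_def by (intro order_trans[OF norm_triangle_ineq4 add_mono]) blast+
  finally show "cmod (hform k ?d ?d) \<le> (e + d) * knorm k ?d" by (simp only: distrib_right add.commute)
qed (use assms in \<open>simp add: approximates_def\<close>)

lemma lincomb_pair_close:
  assumes C: "\<And>m. cmod (lincomb_pair F m) \<le> C * knorm k m" "0 \<le> C"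
    and "approximates k G l e" "approximates k G m d"
  shows "cmod (lincomb_pair F l - lincomb_pair F m) \<le> C * (e + d)"
proof -
  have "lincomb_pair F l - lincomb_pair F m = lincomb_pair F (l @ lincomb_scale (-1) m)" by simp
  also have "cmod \<dots> \<le> C * knorm k (l @ lincomb_scale (-1) m)" by (rule C)
  also have "\<dots> \<le> C * (e + d)" using approximates_close[OF assms(3,4)] C(2) by (rule mult_left_mono)
  finally show ?thesis .
qed

lemma rkhs_inner_lim:
  assumes F: "F \<in> rkhs_carrier k" and l: "approx_seq k G l"
  shows "(\<lambda>n. lincomb_pair F (l n)) \<longlonglongrightarrow> rkhs_inner k F G"
proof -
  obtain C where C: "0 \<le> C" "\<And>m. cmod (lincomb_pair F m) \<le> C * knorm k m"
    using rkhs_bounded[OF F] by blast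
  have G: "G \<in> rkhs_carrier k" using l rkhs_carrier_iff by blast
  let ?s = "rkhs_seq k G"
  obtain \<delta> where d: "\<delta> \<longlonglongrightarrow> 0" "\<And>n. approximates k G (?s n) (\<delta> n)"
    using approx_seq_rkhs_seq[OF G] by (auto simp: approx_seq_def)
  obtain \<epsilon> where e: "\<epsilon> \<longlonglongrightarrow> 0" "\<And>n. approximates k G (l n) (\<epsilon> n)"
    using l by (auto simp: approx_seq_def)
  have "Cauchy (\<lambda>n. lincomb_pair F (?s n))"
  proof (rule CauchyI)
    fix r :: real assume r: "0 < r"
    have "(\<lambda>n. C * \<delta> n) \<longlonglongrightarrow> 0" using tendsto_mult_right_zero[OF d(1)] .
    then obtain N where N: "\<And>n. n \<ge> N \<Longrightarrow> C * \<delta> n < r / 2"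
      using order_tendstoD(2)[of _ 0 sequentially "r / 2"] r by (auto simp: eventually_sequentially)
    have "norm (lincomb_pair F (?s m) - lincomb_pair F (?s n)) < r" if "m \<ge> N" "n \<ge> N" for m n
      using lincomb_pair_close[OF C(2,1) d(2)[of m] d(2)[of n]] N[OF that(1)] N[OF that(2)]
      by (simp add: distrib_left)
    then show "\<exists>M. \<forall>m\<ge>M. \<forall>n\<ge>M. norm (lincomb_pair F (?s m) - lincomb_pair F (?s n)) < r" by blast
  qed
  then have "(\<lambda>n. lincomb_pair F (?s n)) \<longlonglongrightarrow> rkhs_inner k F G"
    unfolding rkhs_inner_def by (simp add: Cauchy_convergent_iff convergent_LIMSEQ_iff)
  moreover have "(\<lambda>n. lincomb_pair F (l n) - lincomb_pair F (?s n)) \<longlonglongrightarrow> 0"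
  proof (rule Lim_null_comparison)
    show "\<forall>\<^sub>F n in sequentially. norm (lincomb_pair F (l n) - lincomb_pair F (?s n)) \<le> C * (\<epsilon> n + \<delta> n)"
      using lincomb_pair_close[OF C(2,1) e(2) d(2)] by simp
    show "(\<lambda>n. C * (\<epsilon> n + \<delta> n)) \<longlonglongrightarrow> 0"
      by (rule tendsto_mult_right_zero[OF tendsto_add_zero[OF e(1) d(1)]])
  qed
  ultimately show ?thesis using tendsto_add by fastforce
qed

lemma approximates_knorm_bound:
  assumes C: "\<And>m. cmod (lincomb_pair G m) \<le> C * knorm k m" "0 \<le> C" and m: "approximates k G m d"
  shows "knorm k m \<le> C + d"
proof (rule knorm_le_of_hform)
  have "cmod (hform k m m) \<le> cmod (lincomb_pair G m) + cmod (lincomb_pair G m - hform k m m)"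
    using norm_triangle_ineq4[of "lincomb_pair G m" "lincomb_pair G m - hform k m m"] by simp
  also have "\<dots> \<le> C * knorm k m + d * knorm k m"
    using C m by (intro add_mono) (auto simp: approximates_def)
  finally show "cmod (hform k m m) \<le> (C + d) * knorm k m" by (simp only: distrib_right)
qed (use C m in \<open>simp add: approximates_def\<close>)

lemma rkhs_inner_lim2:
  assumes l: "approx_seq k F l" and m: "approx_seq k G m"
  shows "(\<lambda>n. hform k (l n) (m n)) \<longlonglongrightarrow> rkhs_inner k F G"
proof -
  have F: "F \<in> rkhs_carrier k" and G: "G \<in> rkhs_carrier k" using assms rkhs_carrier_iff by blast+
  obtain C where C: "0 \<le> C" "\<And>m. cmod (lincomb_pair G m) \<le> C * knorm k m"
    using rkhs_bounded[OF G] by blast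
  obtain \<delta> where d: "\<delta> \<longlonglongrightarrow> 0" "\<And>n. approximates k G (m n) (\<delta> n)"
    using m by (auto simp: approx_seq_def)
  obtain \<epsilon> where e: "\<epsilon> \<longlonglongrightarrow> 0" "\<And>n. approximates k F (l n) (\<epsilon> n)"
    using l by (auto simp: approx_seq_def)
  have "(\<lambda>n. lincomb_pair F (m n) - hform k (l n) (m n)) \<longlonglongrightarrow> 0"
  proof (rule Lim_null_comparison)
    have "cmod (lincomb_pair F (m n) - hform k (l n) (m n)) \<le> \<epsilon> n * (C + \<delta> n)" for n
    proof -
      have "cmod (lincomb_pair F (m n) - hform k (l n) (m n)) \<le> \<epsilon> n * knorm k (m n)"
        using e(2)[of n] by (simp add: approximates_def)
      also have "\<dots> \<le> \<epsilon> n * (C + \<delta> n)"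
        using approximates_knorm_bound[OF C(2,1) d(2)] e(2)[of n]
        by (intro mult_left_mono) (auto simp: approximates_def)
      finally show ?thesis .
    qed
    then show "\<forall>\<^sub>F n in sequentially. norm (lincomb_pair F (m n) - hform k (l n) (m n)) \<le> \<epsilon> n * (C + \<delta> n)"
      by simp
    show "(\<lambda>n. \<epsilon> n * (C + \<delta> n)) \<longlonglongrightarrow> 0"
      using tendsto_mult[OF e(1) tendsto_add[OF tendsto_const d(1), of C]] by simp
  qed
  from tendsto_diff[OF rkhs_inner_lim[OF F m] this] show ?thesis by simp
qed

lemma rkhs_inner_kspan: "F \<in> rkhs_carrier k \<Longrightarrow> rkhs_inner k F (kspan k l) = lincomb_pair F l"
  using rkhs_inner_lim[OF _ approx_seq_kspan[of l]] by (simp add: LIMSEQ_const_iff)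

lemma rkhs_inner_add:
  "F \<in> rkhs_carrier k \<Longrightarrow> G \<in> rkhs_carrier k \<Longrightarrow> E \<in> rkhs_carrier k \<Longrightarrow>
    rkhs_inner k (\<lambda>x. F x + G x) E = rkhs_inner k F E + rkhs_inner k G E"
  using LIMSEQ_unique[OF rkhs_inner_lim[of "\<lambda>x. F x + G x" E "rkhs_seq k E"]]
    tendsto_add[OF rkhs_inner_lim[of F E "rkhs_seq k E"] rkhs_inner_lim[of G E "rkhs_seq k E"]]
  by (simp add: approx_seq_rkhs_seq)

lemma rkhs_inner_smult:
  "F \<in> rkhs_carrier k \<Longrightarrow> E \<in> rkhs_carrier k \<Longrightarrow>
    rkhs_inner k (\<lambda>x. c * F x) E = c * rkhs_inner k F E"
  using LIMSEQ_unique[OF rkhs_inner_lim[of "\<lambda>x. c * F x" E "rkhs_seq k E"]]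
    tendsto_mult_left[OF rkhs_inner_lim[of F E "rkhs_seq k E"], of c]
  by (simp add: approx_seq_rkhs_seq)

lemma rkhs_inner_commute:
  assumes "F \<in> rkhs_carrier k" "G \<in> rkhs_carrier k"
  shows "rkhs_inner k G F = cnj (rkhs_inner k F G)"
proof (rule LIMSEQ_unique)
  note s = assms[THEN approx_seq_rkhs_seq]
  show "(\<lambda>n. hform k (rkhs_seq k G n) (rkhs_seq k F n)) \<longlonglongrightarrow> rkhs_inner k G F"
    by (rule rkhs_inner_lim2[OF s(2,1)])
  show "(\<lambda>n. hform k (rkhs_seq k G n) (rkhs_seq k F n)) \<longlonglongrightarrow> cnj (rkhs_inner k F G)"
    unfolding hform_commute[OF pd, of "rkhs_seq k G _"]
    by (rule tendsto_cnj[OF rkhs_inner_lim2[OF s]])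
qed

lemma knorm_tendsto:
  assumes "approx_seq k F l"
  shows "(\<lambda>n. knorm k (l n)) \<longlonglongrightarrow> hnorm (rkhs k) F"
  unfolding knorm_def hnorm_def rkhs_simps
  by (intro tendsto_real_sqrt tendsto_Re rkhs_inner_lim2 assms)

lemma rkhs_inner_self:
  assumes "F \<in> rkhs_carrier k"
  shows "0 \<le> Re (rkhs_inner k F F)"
proof (rule tendsto_lowerbound)
  note s = approx_seq_rkhs_seq[OF assms]
  show "(\<lambda>n. Re (hform k (rkhs_seq k F n) (rkhs_seq k F n))) \<longlonglongrightarrow> Re (rkhs_inner k F F)"
    by (intro tendsto_Re rkhs_inner_lim2 s)
  show "\<forall>\<^sub>F n in sequentially. 0 \<le> Re (hform k (rkhs_seq k F n) (rkhs_seq k F n))"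
    using hform_self(1)[OF pd] by simp
qed simp

text \<open>This inequality and the next one identify the Hilbert space norm of \<open>F\<close> with the norm of \<open>F\<close> as a
functional on combinations. Completeness and strong continuity are proved with
the functional norm, where no limits of inner products occur.\<close>

lemma lincomb_pair_le_hnorm:
  assumes "F \<in> rkhs_carrier k"
  shows "cmod (lincomb_pair F m) \<le> hnorm (rkhs k) F * knorm k m"
proof (rule tendsto_le)
  note s = approx_seq_rkhs_seq[OF assms]
  show "(\<lambda>n. cmod (hform k (rkhs_seq k F n) m)) \<longlonglongrightarrow> cmod (lincomb_pair F m)"
    using rkhs_inner_lim2[OF s approx_seq_kspan[of m]] rkhs_inner_kspan[OF assms] by (simp add: tendsto_norm)
  show "(\<lambda>n. knorm k (rkhs_seq k F n) * knorm k m) \<longlonglongrightarrow> hnorm (rkhs k) F * knorm k m"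
    by (intro tendsto_mult_right knorm_tendsto s)
qed (use hform_Cauchy_Schwarz[OF pd] in simp_all)

lemma hnorm_le_of_lincomb_pair:
  assumes F: "F \<in> rkhs_carrier k" and le: "\<And>m. cmod (lincomb_pair F m) \<le> e * knorm k m" and e: "0 \<le> e"
  shows "hnorm (rkhs k) F \<le> e"
proof -
  note s = approx_seq_rkhs_seq[OF F]
  have n: "0 \<le> hnorm (rkhs k) F" using rkhs_inner_self[OF F] by (simp add: hnorm_def)
  have "cmod (rkhs_inner k F F) \<le> e * hnorm (rkhs k) F"
  proof (rule tendsto_le)
    show "(\<lambda>n. cmod (lincomb_pair F (rkhs_seq k F n))) \<longlonglongrightarrow> cmod (rkhs_inner k F F)"
      by (intro tendsto_norm rkhs_inner_lim F s)
    show "(\<lambda>n. e * knorm k (rkhs_seq k F n)) \<longlonglongrightarrow> e * hnorm (rkhs k) F"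
      by (intro tendsto_mult_left knorm_tendsto s)
  qed (use le in simp_all)
  moreover have "Re (rkhs_inner k F F) = hnorm (rkhs k) F * hnorm (rkhs k) F"
    using rkhs_inner_self[OF F] by (simp add: hnorm_def)
  ultimately have "hnorm (rkhs k) F * hnorm (rkhs k) F \<le> e * hnorm (rkhs k) F"
    using complex_Re_le_cmod[of "rkhs_inner k F F"] by linarith
  then show ?thesis using n e by (cases "hnorm (rkhs k) F = 0") (auto simp: mult_le_cancel_right)
qed

lemma abelian_group_rkhs: "abelian_group (rkhs k)"
proof (rule abelian_groupI)
  fix F assume "F \<in> carrier (rkhs k)"
  then show "\<exists>G\<in>carrier (rkhs k). G \<oplus>\<^bsub>rkhs k\<^esub> F = \<zero>\<^bsub>rkhs k\<^esub>"
    by (intro bexI[of _ "\<lambda>x. - F x"]) auto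
qed (auto simp: algebra_simps)

lemma rkhs_minus:
  assumes "F \<in> rkhs_carrier k" "G \<in> rkhs_carrier k"
  shows "F \<ominus>\<^bsub>rkhs k\<^esub> G = (\<lambda>x. F x - G x)"
proof -
  interpret abelian_group "rkhs k" by (rule abelian_group_rkhs)
  have "\<ominus>\<^bsub>rkhs k\<^esub> G = (\<lambda>x. - G x)"
    using assms by (intro minus_equality) auto
  then show ?thesis using assms by (simp add: minus_eq)
qed

lemma lincomb_pair_tendsto:
  assumes "\<And>x. (\<lambda>n. \<sigma> n x) \<longlonglongrightarrow> F x"
  shows "(\<lambda>n. lincomb_pair (\<sigma> n) m) \<longlonglongrightarrow> lincomb_pair F m"
  by (induction m) (auto intro!: tendsto_intros assms)

text \<open>A Cauchy sequence converges pointwise because evaluation at a point is bounded. The Cauchy estimate in the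
functional norm passes to the pointwise limit, which is therefore a norm limit of
functions in the space, and so again approximable by combinations.\<close>

lemma rkhs_complete:
  assumes \<sigma>: "range \<sigma> \<subseteq> rkhs_carrier k"
    and C: "\<And>e. 0 < e \<Longrightarrow> \<exists>N::nat. \<forall>m\<ge>N. \<forall>n\<ge>N. hnorm (rkhs k) (\<sigma> m \<ominus>\<^bsub>rkhs k\<^esub> \<sigma> n) < e"
  shows "\<exists>F\<in>rkhs_carrier k. (\<lambda>n. hnorm (rkhs k) (\<sigma> n \<ominus>\<^bsub>rkhs k\<^esub> F)) \<longlonglongrightarrow> 0"
proof -
  have s: "\<sigma> n \<in> rkhs_carrier k" for n using \<sigma> by blast
  have d: "cmod (lincomb_pair (\<sigma> i) m - lincomb_pair (\<sigma> j) m) \<le> hnorm (rkhs k) (\<sigma> i \<ominus>\<^bsub>rkhs k\<^esub> \<sigma> j) * knorm k m" for i j m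
    using lincomb_pair_le_hnorm[of "\<lambda>x. \<sigma> i x - \<sigma> j x" m] s by (simp add: rkhs_minus)
  have "Cauchy (\<lambda>n. \<sigma> n x)" for x
  proof (rule CauchyI)
    fix e :: real assume e: "0 < e"
    let ?K = "knorm k [(1, x)]"
    have K: "0 \<le> ?K" by (rule knorm_nonneg[OF pd])
    obtain N where N: "\<And>m n. m \<ge> N \<Longrightarrow> n \<ge> N \<Longrightarrow> hnorm (rkhs k) (\<sigma> m \<ominus>\<^bsub>rkhs k\<^esub> \<sigma> n) < e / (?K + 1)"
      using C[of "e / (?K + 1)"] e K by fastforce
    have "cmod (\<sigma> m x - \<sigma> n x) < e" if "m \<ge> N" "n \<ge> N" for m n
    proof -
      have "cmod (\<sigma> m x - \<sigma> n x) \<le> hnorm (rkhs k) (\<sigma> m \<ominus>\<^bsub>rkhs k\<^esub> \<sigma> n) * ?K"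
        using d[of m "[(1, x)]" n] by simp
      also have "\<dots> \<le> e / (?K + 1) * ?K" using N[OF that] K by (intro mult_right_mono) auto
      also have "\<dots> < e" using e K by (simp add: divide_simps) 
      finally show ?thesis .
    qed
    then show "\<exists>M. \<forall>m\<ge>M. \<forall>n\<ge>M. norm (\<sigma> m x - \<sigma> n x) < e" by blast
  qed
  then have "\<forall>x. \<exists>y. (\<lambda>n. \<sigma> n x) \<longlonglongrightarrow> y" by (simp add: Cauchy_convergent_iff convergent_def)
  then obtain F where F: "\<And>x. (\<lambda>n. \<sigma> n x) \<longlonglongrightarrow> F x" by metis
  have lim: "\<exists>N. \<forall>n\<ge>N. \<forall>m. cmod (lincomb_pair (\<sigma> n) m - lincomb_pair F m) \<le> e * knorm k m" if "0 < e" for e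
  proof -
    obtain N where N: "\<And>m n. m \<ge> N \<Longrightarrow> n \<ge> N \<Longrightarrow> hnorm (rkhs k) (\<sigma> m \<ominus>\<^bsub>rkhs k\<^esub> \<sigma> n) < e"
      using C[OF \<open>0 < e\<close>] by blast
    have "cmod (lincomb_pair (\<sigma> n) m - lincomb_pair F m) \<le> e * knorm k m" if "n \<ge> N" for n m
    proof (rule tendsto_upperbound)
      show "(\<lambda>j. cmod (lincomb_pair (\<sigma> n) m - lincomb_pair (\<sigma> j) m)) \<longlonglongrightarrow> cmod (lincomb_pair (\<sigma> n) m - lincomb_pair F m)"
        by (intro tendsto_intros lincomb_pair_tendsto F)
      have "cmod (lincomb_pair (\<sigma> n) m - lincomb_pair (\<sigma> j) m) \<le> e * knorm k m" if "j \<ge> N" for j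
        using N[OF \<open>n \<ge> N\<close> that] knorm_nonneg[OF pd, of m]
        by (intro order_trans[OF d mult_right_mono]) auto
      then show "\<forall>\<^sub>F j in sequentially. cmod (lincomb_pair (\<sigma> n) m - lincomb_pair (\<sigma> j) m) \<le> e * knorm k m"
        using eventually_sequentially by blast
    qed simp
    then show ?thesis by blast
  qed
  have "\<exists>l. approximates k F l e" if e: "0 < e" for e
  proof -
    obtain n where n: "\<And>m. cmod (lincomb_pair (\<sigma> n) m - lincomb_pair F m) \<le> e / 2 * knorm k m"
      using lim[of "e / 2"] e by auto
    obtain l where l: "approximates k (\<sigma> n) l (e / 2)" using s[of n] half_gt_zero[OF e] unfolding rkhs_carrier_def by blast
    have "cmod (lincomb_pair F m - hform k l m) \<le> e * knorm k m" for m
    proof -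
      have "cmod (lincomb_pair F m - hform k l m)
          \<le> cmod (lincomb_pair (\<sigma> n) m - hform k l m) + cmod (lincomb_pair (\<sigma> n) m - lincomb_pair F m)"
        using norm_triangle_ineq4[of "lincomb_pair (\<sigma> n) m - hform k l m" "lincomb_pair (\<sigma> n) m - lincomb_pair F m"]
        by simp
      also have "\<dots> \<le> e / 2 * knorm k m + e / 2 * knorm k m"
        using l n by (intro add_mono) (auto simp: approximates_def)
      finally show ?thesis by simp
    qed
    then show ?thesis using e by (auto simp: approximates_def)
  qed
  then have Fc: "F \<in> rkhs_carrier k" by (simp add: rkhs_carrier_def)
  have "(\<lambda>n. hnorm (rkhs k) (\<sigma> n \<ominus>\<^bsub>rkhs k\<^esub> F)) \<longlonglongrightarrow> 0"
  proof (rule LIMSEQ_I)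
    fix r :: real assume r: "0 < r"
    obtain N where N: "\<And>n m. n \<ge> N \<Longrightarrow> cmod (lincomb_pair (\<sigma> n) m - lincomb_pair F m) \<le> r / 2 * knorm k m"
      using lim[of "r / 2"] r by auto
    have "norm (hnorm (rkhs k) (\<sigma> n \<ominus>\<^bsub>rkhs k\<^esub> F) - 0) < r" if "n \<ge> N" for n
    proof -
      have "hnorm (rkhs k) (\<lambda>x. \<sigma> n x - F x) \<le> r / 2"
        using s Fc N[OF that] r by (intro hnorm_le_of_lincomb_pair) auto
      moreover have "0 \<le> hnorm (rkhs k) (\<lambda>x. \<sigma> n x - F x)"
        using rkhs_inner_self[of "\<lambda>x. \<sigma> n x - F x"] s Fc by (simp add: hnorm_def)
      ultimately show ?thesis using r s Fc by (simp add: rkhs_minus)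
    qed
    then show "\<exists>no. \<forall>n\<ge>no. norm (hnorm (rkhs k) (\<sigma> n \<ominus>\<^bsub>rkhs k\<^esub> F) - 0) < r" by blast
  qed
  then show ?thesis using Fc by blast
qed

theorem complex_hilbert_space_rkhs: "complex_hilbert_space (rkhs k)"
proof (intro complex_hilbert_space.intro complex_hilbert_space_axioms.intro)
  show "module complex_ring (rkhs k)"
    by (rule moduleI) (use cring_complex_ring abelian_group_rkhs in \<open>auto simp: algebra_simps\<close>)
next
  fix F assume F: "F \<in> carrier (rkhs k)" "F \<noteq> \<zero>\<^bsub>rkhs k\<^esub>"
  show "0 < Re (cinner (rkhs k) F F)"
  proof (rule ccontr)
    assume "\<not> ?thesis"
    then have "hnorm (rkhs k) F = 0" using rkhs_inner_self[of F] F by (simp add: hnorm_def)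
    then have "F x = 0" for x using lincomb_pair_le_hnorm[of F "[(1, x)]"] F by simp
    then show False using F by auto
  qed
next
  fix \<sigma> :: "nat \<Rightarrow> 'x \<Rightarrow> complex"
  assume "range \<sigma> \<subseteq> carrier (rkhs k)"
    "\<And>e. 0 < e \<Longrightarrow> \<exists>N::nat. \<forall>m\<ge>N. \<forall>n\<ge>N. hnorm (rkhs k) (\<sigma> m \<ominus>\<^bsub>rkhs k\<^esub> \<sigma> n) < e"
  then show "\<exists>F\<in>carrier (rkhs k). (\<lambda>n. hnorm (rkhs k) (\<sigma> n \<ominus>\<^bsub>rkhs k\<^esub> F)) \<longlonglongrightarrow> 0"
    using rkhs_complete[of \<sigma>] by simp
next
  fix F G assume "F \<in> carrier (rkhs k)" "G \<in> carrier (rkhs k)"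
  then show "cinner (rkhs k) G F = cnj (cinner (rkhs k) F G)"
    using rkhs_inner_commute[of F G] by simp
qed (simp_all add: rkhs_inner_add rkhs_inner_smult)

end

section \<open>Representations from invariant kernels\<close>

text \<open>The action and the kernel live on a whole type; a kernel on a subset is extended by 0 and the
action by the identity. Continuity of the scalar functions \<open>s \<mapsto> k (act s x) y\<close> is all that
strong continuity of the resulting representation requires, since vectors are limits of combinations
and the representation is isometric.\<close>

locale invariant_kernel = topological_group G T for G (structure) and T :: "'g topology" +
  fixes act :: "'g \<Rightarrow> 'x \<Rightarrow> 'x" and k :: "'x \<Rightarrow> 'x \<Rightarrow> complex"
  assumes pd: "pd_kernel k"
    and act_one: "act \<one> x = x"
    and act_mult: "\<lbrakk>s \<in> carrier G; t \<in> carrier G\<rbrakk> \<Longrightarrow> act (s \<otimes> t) x = act s (act t x)"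
    and invariant: "s \<in> carrier G \<Longrightarrow> k (act s x) (act s y) = k x y"
    and continuous: "s\<^sub>0 \<in> carrier G \<Longrightarrow> ((\<lambda>s. k (act s x) y) \<longlongrightarrow> k (act s\<^sub>0 x) y) (atin T s\<^sub>0)"
begin

definition rkhs_rep :: "'g \<Rightarrow> ('x \<Rightarrow> complex) \<Rightarrow> 'x \<Rightarrow> complex" where
  "rkhs_rep s F = (\<lambda>x. F (act (inv\<^bsub>G\<^esub> s) x))"

lemma act_inv: "s \<in> carrier G \<Longrightarrow> act (inv\<^bsub>G\<^esub> s) (act s x) = x" "s \<in> carrier G \<Longrightarrow> act s (act (inv\<^bsub>G\<^esub> s) x) = x"
  by (simp_all add: act_mult[symmetric] act_one)

lemma kernel_act: "s \<in> carrier G \<Longrightarrow> k (act s x) y = k x (act (inv\<^bsub>G\<^esub> s) y)"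
  using invariant[of s x "act (inv\<^bsub>G\<^esub> s) y"] by (simp add: act_inv)

lemma kspan_act: "s \<in> carrier G \<Longrightarrow> kspan k (lincomb_map (act s) l) = (\<lambda>y. kspan k l (act (inv\<^bsub>G\<^esub> s) y))"
  by (induction l) (auto simp: lincomb_map_def kernel_act)

lemma lincomb_pair_rkhs_rep:
  "lincomb_pair (rkhs_rep s F) m = lincomb_pair F (lincomb_map (act (inv\<^bsub>G\<^esub> s)) m)"
  by (simp add: rkhs_rep_def lincomb_pair_translate)

lemma hform_act:
  "s \<in> carrier G \<Longrightarrow> hform k (lincomb_map (act s) l) m = hform k l (lincomb_map (act (inv\<^bsub>G\<^esub> s)) m)"
  by (simp add: hform_def lincomb_pair_translate kspan_act)

lemma lincomb_map_map: "lincomb_map f (lincomb_map g l) = lincomb_map (\<lambda>x. f (g x)) l"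
  by (induction l) (auto simp: lincomb_map_def)

lemma knorm_act: "s \<in> carrier G \<Longrightarrow> knorm k (lincomb_map (act s) l) = knorm k l"
proof -
  have "lincomb_map (\<lambda>x. x) l = l" by (induction l) (auto simp: lincomb_map_def)
  moreover assume "s \<in> carrier G"
  ultimately show ?thesis
    by (simp add: knorm_def hform_act lincomb_map_map act_inv)
qed

lemma approximates_rkhs_rep:
  assumes s: "s \<in> carrier G" and "approximates k F l e"
  shows "approximates k (rkhs_rep s F) (lincomb_map (act s) l) e"
  unfolding approximates_def
proof (intro conjI allI)
  fix m
  have "cmod (lincomb_pair F (lincomb_map (act (inv\<^bsub>G\<^esub> s)) m) - hform k l (lincomb_map (act (inv\<^bsub>G\<^esub> s)) m))
      \<le> e * knorm k (lincomb_map (act (inv\<^bsub>G\<^esub> s)) m)"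
    using assms by (simp add: approximates_def)
  then show "cmod (lincomb_pair (rkhs_rep s F) m - hform k (lincomb_map (act s) l) m) \<le> e * knorm k m"
    using s by (simp add: hform_act lincomb_pair_rkhs_rep knorm_act)
qed (use assms in \<open>simp add: approximates_def\<close>)

lemma approx_seq_rkhs_rep:
  "s \<in> carrier G \<Longrightarrow> approx_seq k F l \<Longrightarrow> approx_seq k (rkhs_rep s F) (\<lambda>n. lincomb_map (act s) (l n))"
  unfolding approx_seq_def using approximates_rkhs_rep by blast

lemma rkhs_rep_closed: "s \<in> carrier G \<Longrightarrow> F \<in> rkhs_carrier k \<Longrightarrow> rkhs_rep s F \<in> rkhs_carrier k"
  unfolding rkhs_carrier_iff[OF pd] using approx_seq_rkhs_rep by blast

lemma rkhs_rep_isometry: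
  assumes s: "s \<in> carrier G" and F: "F \<in> rkhs_carrier k" and G: "E \<in> rkhs_carrier k"
  shows "rkhs_inner k (rkhs_rep s F) (rkhs_rep s E) = rkhs_inner k F E"
proof (rule LIMSEQ_unique)
  note E = approx_seq_rkhs_seq[OF pd G]
  show "(\<lambda>n. lincomb_pair F (rkhs_seq k E n)) \<longlonglongrightarrow> rkhs_inner k F E"
    by (rule rkhs_inner_lim[OF pd F E])
  have "(\<lambda>n. lincomb_pair (rkhs_rep s F) (lincomb_map (act s) (rkhs_seq k E n)))
      \<longlonglongrightarrow> rkhs_inner k (rkhs_rep s F) (rkhs_rep s E)"
    by (rule rkhs_inner_lim[OF pd rkhs_rep_closed[OF s F] approx_seq_rkhs_rep[OF s E]])
  moreover have "lincomb_pair (rkhs_rep s F) (lincomb_map (act s) l) = lincomb_pair F l" for l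
    using s by (simp add: lincomb_pair_translate rkhs_rep_def act_inv)
  ultimately show "(\<lambda>n. lincomb_pair F (rkhs_seq k E n)) \<longlonglongrightarrow> rkhs_inner k (rkhs_rep s F) (rkhs_rep s E)"
    by simp
qed

lemma hform_act_tendsto:
  assumes "s\<^sub>0 \<in> carrier G"
  shows "((\<lambda>s. hform k (lincomb_map (act s) l) m) \<longlongrightarrow> hform k (lincomb_map (act s\<^sub>0) l) m) (atin T s\<^sub>0)"
proof -
  have 1: "((\<lambda>s. kspan k (lincomb_map (act s) l) y) \<longlongrightarrow> kspan k (lincomb_map (act s\<^sub>0) l) y) (atin T s\<^sub>0)" for y
  proof (induction l)
    case (Cons p l)
    obtain a x where p: "p = (a, x)" by (rule prod.exhaust)
    show ?case
      using tendsto_add[OF tendsto_mult_left[OF continuous[OF assms, of x y], of a] Cons.IH]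
      by (simp add: p lincomb_map_def)
  qed (simp add: lincomb_map_def)
  show ?thesis
    unfolding hform_def
  proof (induction m)
    case (Cons p m)
    obtain b y where p: "p = (b, y)" by (rule prod.exhaust)
    show ?case
      using tendsto_add[OF tendsto_mult_left[OF 1[of y], of "cnj b"] Cons.IH] by (simp add: p)
  qed simp
qed

lemma eventually_carrier: "s\<^sub>0 \<in> carrier G \<Longrightarrow> eventually (\<lambda>s. s \<in> carrier G) (atin T s\<^sub>0)"
  using topspace_eq openin_topspace[of T] by (auto simp: eventually_atin)

text \<open>Among vectors of a fixed norm weak convergence implies norm convergence: by invariance the square of the left hand
side is \<open>2 \<parallel>l\<parallel>\<^sup>2 - 2 Re \<langle>s l, s\<^sub>0 l\<rangle>\<close> with a continuous inner product.\<close>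

lemma knorm_act_diff_tendsto:
  assumes s0: "s\<^sub>0 \<in> carrier G"
  shows "((\<lambda>s. knorm k (lincomb_map (act s) l @ lincomb_scale (-1) (lincomb_map (act s\<^sub>0) l))) \<longlongrightarrow> 0) (atin T s\<^sub>0)"
proof (rule Lim_transform_eventually)
  let ?q = "\<lambda>s. hform k (lincomb_map (act s) l) (lincomb_map (act s\<^sub>0) l)"
  let ?L = "Re (hform k l l)"
  have same: "Re (hform k (lincomb_map (act s) l) (lincomb_map (act s) l)) = ?L" if "s \<in> carrier G" for s
    using knorm_act[OF that, of l] by (simp add: knorm_def)
  have "knorm k (lincomb_map (act s) l @ lincomb_scale (-1) (lincomb_map (act s\<^sub>0) l)) = sqrt (2 * ?L - 2 * Re (?q s))"
    if "s \<in> carrier G" for s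
    using same[OF that] same[OF s0] hform_commute[OF pd, of "lincomb_map (act s\<^sub>0) l" "lincomb_map (act s) l"]
    by (simp add: knorm_def)
  then show "\<forall>\<^sub>F s in atin T s\<^sub>0. sqrt (2 * ?L - 2 * Re (?q s))
      = knorm k (lincomb_map (act s) l @ lincomb_scale (-1) (lincomb_map (act s\<^sub>0) l))"
    by (intro eventually_mono[OF eventually_carrier[OF s0]]) simp
  have "((\<lambda>s. sqrt (2 * ?L - 2 * Re (?q s))) \<longlongrightarrow> sqrt (2 * ?L - 2 * Re (?q s\<^sub>0))) (atin T s\<^sub>0)"
    by (intro tendsto_real_sqrt tendsto_diff tendsto_const tendsto_mult_left tendsto_Re hform_act_tendsto s0)
  then show "((\<lambda>s. sqrt (2 * ?L - 2 * Re (?q s))) \<longlongrightarrow> 0) (atin T s\<^sub>0)"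
    using same[OF s0] by simp
qed

text \<open>The usual three-term estimate, carried out in the functional norm: \<open>F\<close> is replaced by \<open>l\<close> on both
sides at the cost of \<open>e\<close> each.\<close>

lemma rkhs_rep_diff_le:
  assumes s: "s \<in> carrier G" "t \<in> carrier G" and F: "F \<in> rkhs_carrier k" and l: "approximates k F l e"
  shows "hnorm (rkhs k) (rkhs_rep s F \<ominus>\<^bsub>rkhs k\<^esub> rkhs_rep t F)
    \<le> e + e + knorm k (lincomb_map (act s) l @ lincomb_scale (-1) (lincomb_map (act t) l))"
    (is "_ \<le> _ + knorm k ?d")
proof -
  have "cmod (lincomb_pair (\<lambda>x. rkhs_rep s F x - rkhs_rep t F x) m) \<le> (e + e + knorm k ?d) * knorm k m" for m
  proof -
    have eq: "lincomb_pair (\<lambda>x. rkhs_rep s F x - rkhs_rep t F x) m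
      = (lincomb_pair (rkhs_rep s F) m - hform k (lincomb_map (act s) l) m)
        - (lincomb_pair (rkhs_rep t F) m - hform k (lincomb_map (act t) l) m) + hform k ?d m"
      by (simp del: lincomb_pair_scale)
    have "cmod (lincomb_pair (\<lambda>x. rkhs_rep s F x - rkhs_rep t F x) m)
      \<le> cmod (lincomb_pair (rkhs_rep s F) m - hform k (lincomb_map (act s) l) m)
        + cmod (lincomb_pair (rkhs_rep t F) m - hform k (lincomb_map (act t) l) m) + cmod (hform k ?d m)"
      unfolding eq by (rule order_trans[OF norm_triangle_ineq add_right_mono[OF norm_triangle_ineq4]])
    also have "\<dots> \<le> e * knorm k m + e * knorm k m + knorm k ?d * knorm k m"
      using approximates_rkhs_rep[OF s(1) l] approximates_rkhs_rep[OF s(2) l]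
      by (intro add_mono hform_Cauchy_Schwarz[OF pd]) (simp_all add: approximates_def)
    finally show ?thesis by (simp only: distrib_right)
  qed
  note b = this
  have "0 \<le> e" using l by (simp add: approximates_def)
  then have "0 \<le> e + e + knorm k ?d" using knorm_nonneg[OF pd, of ?d] by linarith
  moreover have "(\<lambda>x. rkhs_rep s F x - rkhs_rep t F x) \<in> rkhs_carrier k"
    by (rule rkhs_closed'(3)[OF pd rkhs_rep_closed[OF s(1) F] rkhs_rep_closed[OF s(2) F]])
  ultimately show ?thesis
    unfolding rkhs_minus[OF pd rkhs_rep_closed[OF s(1) F] rkhs_rep_closed[OF s(2) F]]
    using b by (rule hnorm_le_of_lincomb_pair[OF pd, rotated 2])
qed

lemma rkhs_rep_strongly_continuous:
  assumes F: "F \<in> rkhs_carrier k" and s0: "s\<^sub>0 \<in> carrier G"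
  shows "((\<lambda>s. hnorm (rkhs k) (rkhs_rep s F \<ominus>\<^bsub>rkhs k\<^esub> rkhs_rep s\<^sub>0 F)) \<longlongrightarrow> 0) (atin T s\<^sub>0)"
proof (rule tendstoI)
  fix e :: real assume e: "0 < e"
  interpret complex_hilbert_space "rkhs k" by (rule complex_hilbert_space_rkhs[OF pd])
  obtain l where l: "approximates k F l (e / 3)"
    using F divide_pos_pos[OF e zero_less_numeral] unfolding rkhs_carrier_def by blast
  have "\<forall>\<^sub>F s in atin T s\<^sub>0. knorm k (lincomb_map (act s) l @ lincomb_scale (-1) (lincomb_map (act s\<^sub>0) l)) < e / 3"
    by (rule order_tendstoD(2)[OF knorm_act_diff_tendsto[OF s0]]) (use e in simp)
  then show "\<forall>\<^sub>F s in atin T s\<^sub>0. dist (hnorm (rkhs k) (rkhs_rep s F \<ominus>\<^bsub>rkhs k\<^esub> rkhs_rep s\<^sub>0 F)) 0 < e"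
    using eventually_carrier[OF s0]
  proof eventually_elim
    case (elim s)
    have "0 \<le> hnorm (rkhs k) (rkhs_rep s F \<ominus>\<^bsub>rkhs k\<^esub> rkhs_rep s\<^sub>0 F)"
      using F s0 elim by (intro hnorm_nonneg M.minus_closed) (simp_all add: rkhs_rep_closed)
    then show ?case using rkhs_rep_diff_le[OF elim(2) s0 F l] elim(1) by simp
  qed
qed

text \<open>Translation by \<open>s\<close> sends the section at \<open>x\<close> to the section at \<open>act s x\<close>, so invariance of the kernel makes it
isometric on combinations and then, by approximation, everywhere.\<close>

theorem unitary_rep_rkhs: "unitary_rep G T (rkhs k) rkhs_rep"
proof (intro unitary_rep.intro unitary_rep_axioms.intro)
  show "topological_group G T" by (rule topological_group_axioms)
  show "complex_hilbert_space (rkhs k)" by (rule complex_hilbert_space_rkhs[OF pd])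
next
  fix s t F assume "s \<in> carrier G" "t \<in> carrier G"
  then show "rkhs_rep (s \<otimes> t) F = rkhs_rep s (rkhs_rep t F)"
    by (simp add: rkhs_rep_def act_mult inv_mult_group)
next
  fix F s\<^sub>0 assume "F \<in> carrier (rkhs k)" "s\<^sub>0 \<in> carrier G"
  then show "((\<lambda>s. hnorm (rkhs k) (rkhs_rep s F \<ominus>\<^bsub>rkhs k\<^esub> rkhs_rep s\<^sub>0 F)) \<longlongrightarrow> 0) (atin T s\<^sub>0)"
    using rkhs_rep_strongly_continuous by simp
next
  fix s F E assume "s \<in> carrier G" "F \<in> carrier (rkhs k)" "E \<in> carrier (rkhs k)"
  then show "cinner (rkhs k) (rkhs_rep s F) (rkhs_rep s E) = cinner (rkhs k) F E"
    using rkhs_rep_isometry by simp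
next
  fix s F assume "s \<in> carrier G" "F \<in> carrier (rkhs k)"
  then show "rkhs_rep s F \<in> carrier (rkhs k)" using rkhs_rep_closed by simp
qed (simp_all add: rkhs_rep_def act_one)

lemma kernel_section_closed: "k x \<in> carrier (rkhs k)"
  using rkhs_closed(1)[OF pd, of "[(1, x)]"] by simp

lemma rkhs_rep_coefficient:
  assumes "s \<in> carrier G"
  shows "cinner (rkhs k) (rkhs_rep s (k x)) (k y) = k (act s x) y"
proof -
  have "rkhs_inner k (rkhs_rep s (k x)) (kspan k [(1, y)]) = lincomb_pair (rkhs_rep s (k x)) [(1, y)]"
    using rkhs_rep_closed[OF assms] kernel_section_closed by (intro rkhs_inner_kspan[OF pd]) simp
  then show ?thesis using assms by (simp add: rkhs_rep_def kernel_act)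
qed

lemma hnorm_kernel_section: "hnorm (rkhs k) (k x) = sqrt (Re (k x x))"
proof -
  have "rkhs_inner k (k x) (kspan k [(1, x)]) = lincomb_pair (k x) [(1, x)]"
    using kernel_section_closed by (intro rkhs_inner_kspan[OF pd]) simp
  then show ?thesis by (simp add: hnorm_def)
qed

definition kernel_coefficient :: "'x \<Rightarrow> 'x \<Rightarrow> 'g \<Rightarrow> complex" where
  "kernel_coefficient x y = (\<lambda>s. if s \<in> carrier G then k (act s x) y else 0)"

lemma kernel_coefficient_eq: "kernel_coefficient x y = coefficient G (rkhs k) rkhs_rep (k x) (k y)"
  unfolding kernel_coefficient_def coefficient_def by (intro ext if_cong refl rkhs_rep_coefficient[symmetric])

theorem kernel_coefficient_in_fourier_stieltjes: "kernel_coefficient x y \<in> fourier_stieltjes G T"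
  unfolding kernel_coefficient_eq
  by (rule coefficient_in_fourier_stieltjes[OF unitary_rep_rkhs kernel_section_closed kernel_section_closed])

end

text \<open>The pairing with a coefficient function is \<open>\<langle>\<pi>(f) \<xi>, \<eta>\<rangle>\<close>, and \<open>\<parallel>\<pi>(f)\<parallel>\<close> is at most the universal norm.\<close>

lemma pairing_coefficient_bound:
  fixes V :: "'h hspace" and G :: "('g, 'b) monoid_scheme"
  assumes r: "unitary_rep G (discrete G) V \<pi>" and \<xi>: "\<xi> \<in> carrier V" and \<eta>: "\<eta> \<in> carrier V"
    and f: "f \<in> group_algebra G"
  shows "cmod (pairing f (coefficient G V \<pi> \<xi> \<eta>)) \<le> cstar_norm G f * hnorm V \<xi> * hnorm V \<eta>"
proof -
  interpret unitary_rep G "discrete G" V \<pi> by fact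
  have S: "finite {s. f s \<noteq> 0}" "{s. f s \<noteq> 0} \<subseteq> carrier G" using f by (auto simp: group_algebra_def)
  have fb: "rep_op V \<pi> f \<xi> \<in> carrier V"
    using finsum_bound[OF S \<xi>] by (simp add: rep_op_def)
  have "pairing f (coefficient G V \<pi> \<xi> \<eta>) = (\<Sum>s | f s \<noteq> 0. f s * cinner V (\<pi> s \<xi>) \<eta>)"
    unfolding pairing_def coefficient_def using S by (intro sum.cong) auto
  also have "\<dots> = cinner V (rep_op V \<pi> f \<xi>) \<eta>"
    using finsum_bound[OF S \<xi>] \<eta> by (simp add: rep_op_def)
  finally have "cmod (pairing f (coefficient G V \<pi> \<xi> \<eta>)) \<le> hnorm V (rep_op V \<pi> f \<xi>) * hnorm V \<eta>"
    using Cauchy_Schwarz[OF fb \<eta>] by simp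
  also have "\<dots> \<le> cstar_norm G f * hnorm V \<xi> * hnorm V \<eta>"
    using rep_op_le_cstar_norm[OF r \<xi> f] \<eta> by (intro mult_right_mono) auto
  finally show ?thesis .
qed

lemma pairing_kernel_coefficient_bound:
  fixes G :: "('g, 'b) monoid_scheme"
  assumes "invariant_kernel G (discrete G) act k" and "f \<in> group_algebra G"
  shows "cmod (pairing f (invariant_kernel.kernel_coefficient G act k x y))
    \<le> cstar_norm G f * sqrt (Re (k x x)) * sqrt (Re (k y y))"
proof -
  interpret invariant_kernel G "discrete G" act k by fact
  show ?thesis
    unfolding kernel_coefficient_eq hnorm_kernel_section[symmetric]
    by (rule pairing_coefficient_bound[OF unitary_rep_rkhs kernel_section_closed kernel_section_closed assms(2)])
qed

section \<open>Stability properties of the Fourier--Stieltjes algebra\<close>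

text \<open>Punctured neighbourhoods in a discrete space can be taken empty, so over \<open>G\<^sub>d\<close> every continuity
condition is void.\<close>

lemma eventually_atin_discrete: "eventually P (atin (discrete_topology S) x)"
proof (cases "x \<in> S")
  case True
  then show ?thesis unfolding eventually_atin by (intro disjI2 exI[of _ "{x}"]) simp
qed (simp add: eventually_atin)

lemma tendsto_atin_discrete: "(f \<longlongrightarrow> l) (atin (discrete_topology S) x)"
  by (simp add: tendsto_def eventually_atin_discrete)

lemma topological_group_discrete:
  assumes "topological_group G T"
  shows "topological_group G (discrete G)"
proof -
  interpret topological_group G T by fact
  show ?thesis
    by unfold_locales (auto simp: prod_topology_discrete_topology[symmetric])
qed

lemma (in invariant_kernel) discrete_invariant_kernel: "invariant_kernel G (discrete G) act k"
proof -
  interpret d: topological_group G "discrete G"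
    by (rule topological_group_discrete[OF topological_group_axioms])
  show ?thesis
    by unfold_locales (simp_all add: pd act_one act_mult invariant tendsto_atin_discrete)
qed

text \<open>The trivial representation, as an action on one point.\<close>

lemma (in topological_group) invariant_kernel_one: "invariant_kernel G T (\<lambda>s (x :: unit). x) (\<lambda>x y. 1)"
  by unfold_locales (simp_all add: pd_kernel_one)

text \<open>Adding 1 to the kernel adds a copy of the trivial representation; the factor keeps the value 1 of
normalized coefficients.\<close>

lemma (in invariant_kernel) invariant_kernel_half:
  "invariant_kernel G T act (\<lambda>x y. complex_of_real (1 / 2) * (1 + k x y))"
proof unfold_locales
  show "pd_kernel (\<lambda>x y. complex_of_real (1 / 2) * (1 + k x y))"
    by (rule pd_kernel_scale[OF pd_kernel_add[OF pd_kernel_one pd]]) simp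
  show "((\<lambda>s. complex_of_real (1 / 2) * (1 + k (act s x) y)) \<longlongrightarrow> complex_of_real (1 / 2) * (1 + k (act s\<^sub>0 x) y))
      (atin T s\<^sub>0)" if "s\<^sub>0 \<in> carrier G" for s\<^sub>0 x y
    by (rule tendsto_mult_left[OF tendsto_add[OF tendsto_const continuous[OF that]]])
qed (simp_all add: act_one act_mult invariant)

text \<open>This kernel plays the role of the tensor product of two representations: the pair \<open>(x, y)\<close> is the elementary tensor,
and Schur's theorem replaces the construction of an inner product on tensors.\<close>

lemma invariant_kernel_prod:
  fixes k :: "'x \<Rightarrow> 'x \<Rightarrow> complex" and k' :: "'y \<Rightarrow> 'y \<Rightarrow> complex"
  assumes "invariant_kernel G T a k" "invariant_kernel G T b k'"
  shows "invariant_kernel G T (\<lambda>s. map_prod (a s) (b s)) (\<lambda>(x, y) (x', y'). k x x' * k' y y')"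
proof -
  interpret A: invariant_kernel G T a k by fact
  interpret B: invariant_kernel G T b k' by fact
  show ?thesis
  proof unfold_locales
    show "pd_kernel (\<lambda>(x, y) (x', y'). k x x' * k' y y')" by (rule Schur_product[OF A.pd B.pd])
    fix s\<^sub>0 and p q :: "'x \<times> 'y" assume s: "s\<^sub>0 \<in> carrier G"
    obtain x y x' y' where p: "p = (x, y)" "q = (x', y')" by (metis prod.exhaust)
    show "((\<lambda>s. (case map_prod (a s) (b s) p of (x, y) \<Rightarrow> \<lambda>(x', y'). k x x' * k' y y') q) \<longlongrightarrow>
      (case map_prod (a s\<^sub>0) (b s\<^sub>0) p of (x, y) \<Rightarrow> \<lambda>(x', y'). k x x' * k' y y') q) (atin T s\<^sub>0)"
      unfolding p map_prod_simp prod.case by (rule tendsto_mult[OF A.continuous[OF s] B.continuous[OF s]])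
  qed (auto simp: A.act_one B.act_one A.act_mult B.act_mult A.invariant B.invariant split: prod.splits)
qed

text \<open>Conversely, the inner product of a representation space is an invariant kernel on that space, so
coefficients of representations and coefficients of kernels are the same functions.\<close>

definition rep_kernel :: "'h hspace \<Rightarrow> 'h \<Rightarrow> 'h \<Rightarrow> complex" where
  "rep_kernel V x y = (if x \<in> carrier V \<and> y \<in> carrier V then cinner V x y else 0)"

definition rep_act :: "'h hspace \<Rightarrow> ('g \<Rightarrow> 'h \<Rightarrow> 'h) \<Rightarrow> 'g \<Rightarrow> 'h \<Rightarrow> 'h" where
  "rep_act V \<pi> s x = (if x \<in> carrier V then \<pi> s x else x)"

fun lincomb_vec :: "'h hspace \<Rightarrow> (complex \<times> 'h) list \<Rightarrow> 'h" where
  "lincomb_vec V [] = \<zero>\<^bsub>V\<^esub>"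
| "lincomb_vec V ((a, x) # l) = (if x \<in> carrier V then a \<odot>\<^bsub>V\<^esub> x \<oplus>\<^bsub>V\<^esub> lincomb_vec V l else lincomb_vec V l)"

lemma pd_kernel_rep_kernel:
  fixes V :: "'h hspace"
  assumes "complex_hilbert_space V"
  shows "pd_kernel (rep_kernel V)"
proof -
  interpret complex_hilbert_space V by fact
  have v: "lincomb_vec V l \<in> carrier V" for l
    by (induction l) auto
  have 1: "kspan (rep_kernel V) l = rep_kernel V (lincomb_vec V l)" for l
    by (induction l) (auto simp: fun_eq_iff rep_kernel_def v cinner_add cinner_smult)
  have 2: "lincomb_pair (rep_kernel V z) m = cinner V z (lincomb_vec V m)" if z: "z \<in> carrier V" for z m
    using z by (induction m) (auto simp: rep_kernel_def v cinner_right[OF _ _ z] cinner_right(4)[OF z z z])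
  show ?thesis
    unfolding pd_kernel_def hform_def 1 2[OF v] using cinner_self(2)[OF v]
    by (simp del: of_real_power)
qed

lemma (in unitary_rep) invariant_kernel_rep: "invariant_kernel G T (rep_act V \<pi>) (rep_kernel V)"
proof unfold_locales
  show "pd_kernel (rep_kernel V)"
    by (rule pd_kernel_rep_kernel) (rule complex_hilbert_space_axioms)
  fix s\<^sub>0 x y assume s: "s\<^sub>0 \<in> carrier G"
  show "((\<lambda>s. rep_kernel V (rep_act V \<pi> s x) y) \<longlongrightarrow> rep_kernel V (rep_act V \<pi> s\<^sub>0 x) y) (atin T s\<^sub>0)"
  proof (cases "x \<in> carrier V \<and> y \<in> carrier V")
    case True
    then have x: "x \<in> carrier V" and y: "y \<in> carrier V" by auto
    have ev: "\<forall>\<^sub>F s in atin T s\<^sub>0. s \<in> carrier G"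
      using s topspace_eq openin_topspace[of T] by (auto simp: eventually_atin)
    have "((\<lambda>s. rep_kernel V (rep_act V \<pi> s x) y - rep_kernel V (rep_act V \<pi> s\<^sub>0 x) y) \<longlongrightarrow> 0) (atin T s\<^sub>0)"
    proof (rule Lim_null_comparison)
      show "\<forall>\<^sub>F s in atin T s\<^sub>0. norm (rep_kernel V (rep_act V \<pi> s x) y - rep_kernel V (rep_act V \<pi> s\<^sub>0 x) y)
          \<le> hnorm V (\<pi> s x \<ominus>\<^bsub>V\<^esub> \<pi> s\<^sub>0 x) * hnorm V y"
        using ev
      proof (rule eventually_mono)
        fix t assume t: "t \<in> carrier G"
        show "norm (rep_kernel V (rep_act V \<pi> t x) y - rep_kernel V (rep_act V \<pi> s\<^sub>0 x) y)
          \<le> hnorm V (\<pi> t x \<ominus>\<^bsub>V\<^esub> \<pi> s\<^sub>0 x) * hnorm V y"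
          using Cauchy_Schwarz[of "\<pi> t x \<ominus>\<^bsub>V\<^esub> \<pi> s\<^sub>0 x" y] x y s t
          by (simp add: rep_kernel_def rep_act_def rep_closed cinner_diff)
      qed
      show "((\<lambda>s. hnorm V (\<pi> s x \<ominus>\<^bsub>V\<^esub> \<pi> s\<^sub>0 x) * hnorm V y) \<longlongrightarrow> 0) (atin T s\<^sub>0)"
        by (rule tendsto_mult_left_zero[OF strongly_continuous[OF x s]])
    qed
    then show ?thesis by (rule LIM_zero_cancel)
  next
    case False
    have "rep_kernel V (rep_act V \<pi> s x) y = 0" if "s \<in> carrier G" for s
      using False by (auto simp: rep_kernel_def rep_act_def)
    moreover have "\<forall>\<^sub>F s in atin T s\<^sub>0. s \<in> carrier G"
      using s topspace_eq openin_topspace[of T] by (auto simp: eventually_atin)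
    ultimately show ?thesis
      using s by (intro tendsto_eventually) (auto elim: eventually_mono)
  qed
qed (auto simp: rep_kernel_def rep_act_def rep_closed rep_one rep_mult rep_isometry)

lemma rep_kernel_coefficient:
  assumes "unitary_rep G T V \<pi>" and \<xi>: "\<xi> \<in> carrier V" and \<eta>: "\<eta> \<in> carrier V"
  shows "invariant_kernel.kernel_coefficient G (rep_act V \<pi>) (rep_kernel V) \<xi> \<eta> = coefficient G V \<pi> \<xi> \<eta>"
proof -
  interpret unitary_rep G T V \<pi> by fact
  interpret K: invariant_kernel G T "rep_act V \<pi>" "rep_kernel V" by (rule invariant_kernel_rep)
  show ?thesis
    using \<xi> \<eta> by (auto simp: K.kernel_coefficient_def coefficient_def rep_kernel_def rep_act_def rep_closed)
qed

lemma fourier_stieltjes_kernel: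
  fixes G :: "('g, 'b) monoid_scheme"
  assumes "u \<in> fourier_stieltjes G T"
  obtains act and k :: "'g hvec \<Rightarrow> 'g hvec \<Rightarrow> complex" and x y
  where "invariant_kernel G T act k" "u = invariant_kernel.kernel_coefficient G act k x y"
proof -
  obtain V :: "'g hvec hspace" and \<pi> \<xi> \<eta> where r: "unitary_rep G T V \<pi>"
    and v: "\<xi> \<in> carrier V" "\<eta> \<in> carrier V" and u: "u = coefficient G V \<pi> \<xi> \<eta>"
    using assms by (auto simp: fourier_stieltjes_def)
  show thesis
    using that[OF unitary_rep.invariant_kernel_rep[OF r]] rep_kernel_coefficient[OF r v] u by metis
qed

lemma fourier_stieltjes_subset_discrete:
  "fourier_stieltjes G T \<subseteq> fourier_stieltjes G (discrete G)"
proof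
  fix u assume "u \<in> fourier_stieltjes G T"
  then obtain act and k :: "'a hvec \<Rightarrow> 'a hvec \<Rightarrow> complex" and x y
    where K: "invariant_kernel G T act k" and u: "u = invariant_kernel.kernel_coefficient G act k x y"
    by (rule fourier_stieltjes_kernel)
  show "u \<in> fourier_stieltjes G (discrete G)"
    unfolding u
    by (rule invariant_kernel.kernel_coefficient_in_fourier_stieltjes[OF invariant_kernel.discrete_invariant_kernel[OF K]])
qed

lemma fourier_stieltjes_mult:
  fixes G :: "('g, 'b) monoid_scheme"
  assumes u: "u \<in> fourier_stieltjes G T" and v: "v \<in> fourier_stieltjes G T"
  shows "(\<lambda>s. u s * v s) \<in> fourier_stieltjes G T"
proof -
  obtain a and k :: "'g hvec \<Rightarrow> 'g hvec \<Rightarrow> complex" and x y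
    where K: "invariant_kernel G T a k" and u: "u = invariant_kernel.kernel_coefficient G a k x y"
    by (rule fourier_stieltjes_kernel[OF u])
  obtain b and k' :: "'g hvec \<Rightarrow> 'g hvec \<Rightarrow> complex" and x' y'
    where L: "invariant_kernel G T b k'" and v: "v = invariant_kernel.kernel_coefficient G b k' x' y'"
    by (rule fourier_stieltjes_kernel[OF v])
  let ?a = "\<lambda>s. map_prod (a s) (b s)" and ?k = "\<lambda>(x, y) (x', y'). k x x' * k' y y'"
  have P: "invariant_kernel G T ?a ?k" by (rule invariant_kernel_prod[OF K L])
  have "(\<lambda>s. u s * v s) = invariant_kernel.kernel_coefficient G ?a ?k (x, x') (y, y')"
    unfolding u v invariant_kernel.kernel_coefficient_def[OF K] invariant_kernel.kernel_coefficient_def[OF L]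
      invariant_kernel.kernel_coefficient_def[OF P] by auto
  then show ?thesis using invariant_kernel.kernel_coefficient_in_fourier_stieltjes[OF P] by simp
qed

lemma fourier_stieltjes_half:
  fixes G :: "('g, 'b) monoid_scheme"
  assumes u: "u \<in> fourier_stieltjes G T"
  shows "(\<lambda>s. (indicator (carrier G) s + u s) / 2) \<in> fourier_stieltjes G T"
proof -
  obtain a and k :: "'g hvec \<Rightarrow> 'g hvec \<Rightarrow> complex" and x y
    where K: "invariant_kernel G T a k" and u: "u = invariant_kernel.kernel_coefficient G a k x y"
    by (rule fourier_stieltjes_kernel[OF u])
  note H = invariant_kernel.invariant_kernel_half[OF K]
  have "(\<lambda>s. (indicator (carrier G) s + u s) / 2)
      = invariant_kernel.kernel_coefficient G a (\<lambda>x y. complex_of_real (1 / 2) * (1 + k x y)) x y"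
    unfolding u invariant_kernel.kernel_coefficient_def[OF K] invariant_kernel.kernel_coefficient_def[OF H]
    by (auto simp: indicator_def)
  then show ?thesis using invariant_kernel.kernel_coefficient_in_fourier_stieltjes[OF H] by simp
qed

lemma fourier_stieltjes_one:
  assumes "topological_group G T"
  shows "indicator (carrier G) \<in> fourier_stieltjes G T"
proof -
  interpret topological_group G T by fact
  note K = invariant_kernel_one
  have "indicator (carrier G) = invariant_kernel.kernel_coefficient G (\<lambda>s (x :: unit). x) (\<lambda>x y. 1) () ()"
    unfolding invariant_kernel.kernel_coefficient_def[OF K] by (auto simp: indicator_def)
  then show ?thesis using invariant_kernel.kernel_coefficient_in_fourier_stieltjes[OF K] by simp
qed

lemma cstar_norm_nonneg:
  assumes "topological_group G T" and f: "f \<in> group_algebra G"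
  shows "0 \<le> cstar_norm G f"
proof -
  interpret topological_group G "discrete G" by (rule topological_group_discrete[OF assms(1)])
  have "0 \<le> cmod (pairing f (invariant_kernel.kernel_coefficient G (\<lambda>s (x :: unit). x) (\<lambda>x y. 1) () ()))"
    by simp
  also have "\<dots> \<le> cstar_norm G f"
    using pairing_kernel_coefficient_bound[OF invariant_kernel_one f, of "()" "()"] by simp
  finally show ?thesis .
qed

lemma group_algebra_mult: "f \<in> group_algebra G \<Longrightarrow> (\<lambda>s. f s * w s) \<in> group_algebra G"
proof -
  assume f: "f \<in> group_algebra G"
  have "{s. f s * w s \<noteq> 0} \<subseteq> {s. f s \<noteq> 0}" by auto
  with f show ?thesis unfolding group_algebra_def using finite_subset by blast
qed

lemma rep_kernel_diag: 
  "complex_hilbert_space V \<Longrightarrow> x \<in> carrier V \<Longrightarrow> rep_kernel V x x = complex_of_real ((hnorm V x)\<^sup>2)"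
  using complex_hilbert_space.cinner_self(2)[of V x] by (simp add: rep_kernel_def)

text \<open>Let \<open>w = \<langle>\<pi>(\<cdot>) \<xi>, \<eta>\<rangle>\<close>, let \<open>\<rho>\<close> be any representation, and put \<open>y = \<rho>(f w) x\<close>. Then \<open>\<parallel>y\<parallel>\<^sup>2 = \<Sum> f(s) w(s) \<langle>\<rho>(s) x, y\<rangle>\<close> is the
pairing of \<open>f\<close> with the coefficient of \<open>\<pi> \<otimes> \<rho>\<close> at \<open>\<xi> \<otimes> x\<close> and \<open>\<eta> \<otimes> y\<close>, hence at most
\<open>\<parallel>f\<parallel> \<parallel>\<xi>\<parallel> \<parallel>x\<parallel> \<parallel>\<eta>\<parallel> \<parallel>y\<parallel>\<close>; cancelling \<open>\<parallel>y\<parallel>\<close> bounds \<open>\<rho>(f w)\<close> uniformly in \<open>\<rho>\<close>.\<close>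

theorem cstar_norm_mult:
  assumes w: "w \<in> fourier_stieltjes G (discrete G)"
  obtains C where "0 < C" "\<And>f. f \<in> group_algebra G \<Longrightarrow> cstar_norm G (\<lambda>s. f s * w s) \<le> C * cstar_norm G f"
proof -
  obtain V :: "'a hvec hspace" and \<pi> \<xi> \<eta> where V: "unitary_rep G (discrete G) V \<pi>"
    and \<xi>: "\<xi> \<in> carrier V" and \<eta>: "\<eta> \<in> carrier V" and w: "w = coefficient G V \<pi> \<xi> \<eta>"
    using w by (auto simp: fourier_stieltjes_def)
  interpret V: unitary_rep G "discrete G" V \<pi> by fact
  have bound: "hnorm W (rep_op W \<rho> (\<lambda>s. f s * w s) x) \<le> hnorm V \<xi> * hnorm V \<eta> * cstar_norm G f"
    if f: "f \<in> group_algebra G" and W: "unitary_rep G (discrete G) W \<rho>" and x: "x \<in> carrier W" "hnorm W x \<le> 1"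
    for f and W :: "'a hvec hspace" and \<rho> x
  proof -
    interpret W: unitary_rep G "discrete G" W \<rho> by fact
    let ?S = "{s. f s * w s \<noteq> 0}"
    have fin: "finite {s. f s \<noteq> 0}" "{s. f s \<noteq> 0} \<subseteq> carrier G" using f by (auto simp: group_algebra_def)
    have S: "finite ?S" "?S \<subseteq> carrier G" using group_algebra_mult[OF f, of w] by (auto simp: group_algebra_def)
    define y where "y = rep_op W \<rho> (\<lambda>s. f s * w s) x"
    have y: "y \<in> carrier W" "cinner W y y = (\<Sum>s\<in>?S. f s * w s * cinner W (\<rho> s x) y)"
      using W.finsum_bound[OF S x(1), of "\<lambda>s. f s * w s"] unfolding y_def rep_op_def by auto
    note P = invariant_kernel_prod[OF V.invariant_kernel_rep W.invariant_kernel_rep]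
    let ?u = "invariant_kernel.kernel_coefficient G (\<lambda>s. map_prod (rep_act V \<pi> s) (rep_act W \<rho> s))
      (\<lambda>(x, y) (x', y'). rep_kernel V x x' * rep_kernel W y y') (\<xi>, x) (\<eta>, y)"
    have u: "?u s = w s * cinner W (\<rho> s x) y" if "s \<in> carrier G" for s
      using that \<xi> \<eta> x y unfolding invariant_kernel.kernel_coefficient_def[OF P]
      by (simp add: w coefficient_def rep_kernel_def rep_act_def V.rep_closed W.rep_closed)
    have "pairing f ?u = (\<Sum>s | f s \<noteq> 0. f s * w s * cinner W (\<rho> s x) y)"
      unfolding pairing_def using fin(2) u by (intro sum.cong) auto
    also have "\<dots> = cinner W y y"
      unfolding y(2) using fin(1) by (intro sum.mono_neutral_right) auto
    finally have "(hnorm W y)\<^sup>2 = cmod (pairing f ?u)"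
      using W.cinner_self(2)[OF y(1)] by (simp add: norm_power y)
    also have "\<dots> \<le> cstar_norm G f * (hnorm V \<xi> * hnorm W x) * (hnorm V \<eta> * hnorm W y)"
    proof -
      have "sqrt (Re (rep_kernel V a a * rep_kernel W b b)) = hnorm V a * hnorm W b"
        if "a \<in> carrier V" "b \<in> carrier W" for a b
        unfolding rep_kernel_diag[OF V.complex_hilbert_space_axioms that(1)]
          rep_kernel_diag[OF W.complex_hilbert_space_axioms that(2)] 
        using that by (simp add: real_sqrt_mult del: of_real_power)
      then show ?thesis
        using pairing_kernel_coefficient_bound[OF P f, of "(\<xi>, x)" "(\<eta>, y)"] \<xi> \<eta> x y(1) by simp
    qed
    also have "\<dots> \<le> cstar_norm G f * (hnorm V \<xi> * 1) * (hnorm V \<eta> * hnorm W y)"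
      using x \<xi> \<eta> y(1) cstar_norm_nonneg[OF V.topological_group_axioms f]
      by (intro mult_right_mono mult_left_mono) auto
    finally have "hnorm W y * hnorm W y \<le> (hnorm V \<xi> * hnorm V \<eta> * cstar_norm G f) * hnorm W y"
      by (simp add: power2_eq_square mult_ac)
    then have "hnorm W y \<le> hnorm V \<xi> * hnorm V \<eta> * cstar_norm G f"
      using W.hnorm_nonneg[OF y(1)] \<xi> \<eta> cstar_norm_nonneg[OF V.topological_group_axioms f]
      by (cases "hnorm W y = 0") (auto simp: mult_le_cancel_right)
    then show ?thesis by (simp add: y_def)
  qed
  have le: "cstar_norm G (\<lambda>s. f s * w s) \<le> hnorm V \<xi> * hnorm V \<eta> * cstar_norm G f" if f: "f \<in> group_algebra G" for f
    unfolding cstar_norm_def[of G "\<lambda>s. f s * w s"]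
  proof (rule cSup_least)
    let ?X = "{hnorm V (rep_op V \<pi> (\<lambda>s. f s * w s) \<xi>) |(V :: 'a hvec hspace) \<pi> \<xi>.
      unitary_rep G (discrete G) V \<pi> \<and> \<xi> \<in> carrier V \<and> hnorm V \<xi> \<le> 1}"
    have "hnorm V (rep_op V \<pi> (\<lambda>s. f s * w s) \<zero>\<^bsub>V\<^esub>) \<in> ?X"
      using V by (intro CollectI exI[of _ V] exI[of _ \<pi>] exI[of _ "\<zero>\<^bsub>V\<^esub>"]) simp
    then show "?X \<noteq> {}" by blast
  qed (use bound[OF f] in blast)
  show thesis
  proof (rule that[of "hnorm V \<xi> * hnorm V \<eta> + 1"])
    show "0 < hnorm V \<xi> * hnorm V \<eta> + 1" using \<xi> \<eta> by (simp add: add_nonneg_pos)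
    show "cstar_norm G (\<lambda>s. f s * w s) \<le> (hnorm V \<xi> * hnorm V \<eta> + 1) * cstar_norm G f"
      if f: "f \<in> group_algebra G" for f
      using le[OF f] cstar_norm_nonneg[OF V.topological_group_axioms f] unfolding distrib_right by linarith
  qed
qed

section \<open>Positive definite functions\<close>

text \<open>This lemma and the next one translate between combinations as lists and as families of coefficients on a finite
set; repeated points have their coefficients added up.\<close>

lemma list_as_sum:
  fixes l :: "(complex \<times> 'x) list"
  assumes "finite A" "snd ` set l \<subseteq> A"
  shows "\<exists>c. (\<forall>k y. kspan k l y = (\<Sum>x\<in>A. c x * k x y)) \<and> (\<forall>F. lincomb_pair F l = (\<Sum>x\<in>A. cnj (c x) * F x))"
  using assms(2)
proof (induction l)
  case Nil
  then show ?case by (intro exI[of _ "\<lambda>x. 0"]) simp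
next
  case (Cons p l)
  obtain a z where p: "p = (a, z)" by (rule prod.exhaust)
  from Cons obtain c where c: "\<forall>k y. kspan k l y = (\<Sum>x\<in>A. c x * k x y)"
    "\<forall>F. lincomb_pair F l = (\<Sum>x\<in>A. cnj (c x) * F x)" by auto
  have z: "z \<in> A" using Cons.prems by (simp add: p)
  have "(\<Sum>x\<in>A. (c x + (if x = z then a else 0)) * k x y) = a * k z y + (\<Sum>x\<in>A. c x * k x y)" for k :: "'x \<Rightarrow> 'x \<Rightarrow> complex" and y
  proof -
    have "(c x + (if x = z then a else 0)) * k x y = c x * k x y + (if x = z then a * k x y else 0)" for x
      by (simp add: distrib_right)
    then show ?thesis using z assms(1) by (simp only: sum.distrib sum.delta) simp
  qed
  moreover have "(\<Sum>x\<in>A. cnj (c x + (if x = z then a else 0)) * F x) = cnj a * F z + (\<Sum>x\<in>A. cnj (c x) * F x)" for F :: "'x \<Rightarrow> complex"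
  proof -
    have "cnj (c x + (if x = z then a else 0)) * F x = cnj (c x) * F x + (if x = z then cnj a * F x else 0)" for x
      by (simp add: distrib_right)
    then show ?thesis using z assms(1) by (simp only: sum.distrib sum.delta) simp
  qed
  ultimately show ?case
    using c by (intro exI[of _ "\<lambda>x. c x + (if x = z then a else 0)"]) (simp add: p)
qed

lemma sum_as_list:
  assumes "finite A"
  shows "\<exists>l. (\<forall>k y. kspan k l y = (\<Sum>x\<in>A. c x * k x y)) \<and> (\<forall>F. lincomb_pair F l = (\<Sum>x\<in>A. cnj (c x) * F x))"
  using assms
proof (induction A)
  case empty
  show ?case by (intro exI[of _ "[]"]) simp
next
  case (insert z A)
  then obtain l where "\<forall>k y. kspan k l y = (\<Sum>x\<in>A. c x * k x y)"
    "\<forall>F. lincomb_pair F l = (\<Sum>x\<in>A. cnj (c x) * F x)" by auto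
  then show ?case using insert.hyps by (intro exI[of _ "(c z, z) # l"]) simp
qed

lemma hform_as_sum:
  assumes "\<forall>k y. kspan k l y = (\<Sum>x\<in>A. c x * k x y)" "\<forall>F. lincomb_pair F l = (\<Sum>x\<in>A. cnj (c x) * F x)"
  shows "hform k l l = (\<Sum>s\<in>A. \<Sum>t\<in>A. cnj (c s) * c t * k t s)"
  using assms by (simp add: hform_def sum_distrib_left mult.assoc)

text \<open>The kernel \<open>u(t\<^sup>-\<^sup>1 s)\<close>, with the transposed order of arguments that makes \<open>u\<close> itself, rather than its
conjugate, the coefficient at the identity.\<close>

definition function_kernel :: "('g, 'b) monoid_scheme \<Rightarrow> ('g \<Rightarrow> complex) \<Rightarrow> 'g \<Rightarrow> 'g \<Rightarrow> complex" where
  "function_kernel G u s t = (if s \<in> carrier G \<and> t \<in> carrier G then u (inv\<^bsub>G\<^esub> t \<otimes>\<^bsub>G\<^esub> s) else 0)"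

definition left_translation :: "('g, 'b) monoid_scheme \<Rightarrow> 'g \<Rightarrow> 'g \<Rightarrow> 'g" where
  "left_translation G s t = (if t \<in> carrier G then s \<otimes>\<^bsub>G\<^esub> t else t)"

lemma positive_definite_iff:
  "u \<in> positive_definite G \<longleftrightarrow> (\<forall>s. s \<notin> carrier G \<longrightarrow> u s = 0) \<and> pd_kernel (function_kernel G u)"
proof -
  let ?P = "\<lambda>F c. (\<Sum>s\<in>F. \<Sum>t\<in>F. cnj (c s) * c t * u (inv\<^bsub>G\<^esub> s \<otimes>\<^bsub>G\<^esub> t)) \<in> \<real>\<^sub>\<ge>\<^sub>0"
  have eq: "(\<Sum>s\<in>F. \<Sum>t\<in>F. cnj (c s) * c t * function_kernel G u t s)
      = (\<Sum>s\<in>F. \<Sum>t\<in>F. cnj (c s) * c t * u (inv\<^bsub>G\<^esub> s \<otimes>\<^bsub>G\<^esub> t))" if "F \<subseteq> carrier G" for F c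
    using that by (intro sum.cong refl) (auto simp: function_kernel_def)
  have "(\<forall>F c. finite F \<and> F \<subseteq> carrier G \<longrightarrow> ?P F c) \<longleftrightarrow> pd_kernel (function_kernel G u)"
  proof
    assume P: "\<forall>F c. finite F \<and> F \<subseteq> carrier G \<longrightarrow> ?P F c"
    show "pd_kernel (function_kernel G u)"
      unfolding pd_kernel_def
    proof
      fix l :: "(complex \<times> 'a) list"
      let ?A = "snd ` set l"
      let ?F = "?A \<inter> carrier G"
      obtain c where c: "\<forall>k y. kspan k l y = (\<Sum>x\<in>?A. c x * k x y)"
        "\<forall>F. lincomb_pair F l = (\<Sum>x\<in>?A. cnj (c x) * F x)"
        using list_as_sum[of ?A l] by auto
      have "hform (function_kernel G u) l l = (\<Sum>s\<in>?A. \<Sum>t\<in>?A. cnj (c s) * c t * function_kernel G u t s)"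
        by (rule hform_as_sum[OF c])
      also have "\<dots> = (\<Sum>s\<in>?F. \<Sum>t\<in>?A. cnj (c s) * c t * function_kernel G u t s)"
        by (intro sum.mono_neutral_right) (auto simp: function_kernel_def)
      also have "\<dots> = (\<Sum>s\<in>?F. \<Sum>t\<in>?F. cnj (c s) * c t * function_kernel G u t s)"
        by (intro sum.cong refl sum.mono_neutral_right) (auto simp: function_kernel_def)
      also have "\<dots> = (\<Sum>s\<in>?F. \<Sum>t\<in>?F. cnj (c s) * c t * u (inv\<^bsub>G\<^esub> s \<otimes>\<^bsub>G\<^esub> t))"
        by (rule eq) simp
      also have "\<dots> \<in> \<real>\<^sub>\<ge>\<^sub>0" using P by simp
      finally show "hform (function_kernel G u) l l \<in> \<real>\<^sub>\<ge>\<^sub>0" .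
    qed
  next
    assume pd: "pd_kernel (function_kernel G u)"
    show "\<forall>F c. finite F \<and> F \<subseteq> carrier G \<longrightarrow> ?P F c"
    proof (intro allI impI)
      fix F c assume F: "finite F \<and> F \<subseteq> carrier G"
      then obtain l where "\<forall>k y. kspan k l y = (\<Sum>x\<in>F. c x * k x y)"
        "\<forall>E. lincomb_pair E l = (\<Sum>x\<in>F. cnj (c x) * E x)"
        using sum_as_list[of F c] by auto
      from hform_as_sum[OF this, of "function_kernel G u"] show "?P F c"
        using pd F by (simp add: eq[symmetric] pd_kernel_def) metis
    qed
  qed
  then show ?thesis by (simp add: positive_definite_def)
qed

lemma invariant_kernel_function:
  assumes "topological_group G T" and u: "u \<in> positive_definite G"
  shows "invariant_kernel G (discrete G) (left_translation G) (function_kernel G u)"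
proof -
  interpret topological_group G "discrete G" by (rule topological_group_discrete[OF assms(1)])
  have inv: "inv\<^bsub>G\<^esub> (s \<otimes>\<^bsub>G\<^esub> t) \<otimes>\<^bsub>G\<^esub> (s \<otimes>\<^bsub>G\<^esub> r) = inv\<^bsub>G\<^esub> t \<otimes>\<^bsub>G\<^esub> r"
    if "s \<in> carrier G" "t \<in> carrier G" "r \<in> carrier G" for s t r
  proof -
    have "inv\<^bsub>G\<^esub> s \<otimes>\<^bsub>G\<^esub> (s \<otimes>\<^bsub>G\<^esub> r) = r" using that by (simp add: m_assoc[symmetric])
    then show ?thesis using that by (simp add: inv_mult_group m_assoc)
  qed
  show ?thesis
  proof unfold_locales
    show "pd_kernel (function_kernel G u)" using u by (simp add: positive_definite_iff)
  qed (auto simp: left_translation_def function_kernel_def m_assoc inv tendsto_atin_discrete)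
qed

text \<open>The GNS representation: the section at the identity is a cyclic vector \<open>\<xi>\<close>
with \<open>u(s) = \<langle>\<pi>(s) \<xi>, \<xi>\<rangle>\<close>.\<close>

lemma positive_definite_coefficient:
  assumes "topological_group G T" and u: "u \<in> positive_definite G"
  shows "u = invariant_kernel.kernel_coefficient G (left_translation G) (function_kernel G u) \<one>\<^bsub>G\<^esub> \<one>\<^bsub>G\<^esub>"
proof -
  interpret topological_group G T by fact
  show ?thesis
    using u unfolding invariant_kernel.kernel_coefficient_def[OF invariant_kernel_function[OF assms]]
    by (auto simp: function_kernel_def left_translation_def positive_definite_iff)
qed

lemma positive_definite_in_fourier_stieltjes:
  assumes "topological_group G T" and u: "u \<in> positive_definite G"
  shows "u \<in> fourier_stieltjes G (discrete G)"
  by (subst positive_definite_coefficient[OF assms])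
    (rule invariant_kernel.kernel_coefficient_in_fourier_stieltjes[OF invariant_kernel_function[OF assms]])

text \<open>Both vectors of the GNS coefficient have norm \<open>\<surd>u(1)\<close>. A representation of \<open>u\<close> by two different
vectors would only bound the norm by some constant, which is not enough for products of many factors.\<close>

lemma pairing_positive_definite_bound:
  assumes "topological_group G T" and u: "u \<in> positive_definite G" and f: "f \<in> group_algebra G"
  shows "cmod (pairing f u) \<le> cstar_norm G f * Re (u \<one>\<^bsub>G\<^esub>)"
proof -
  interpret topological_group G T by fact
  note K = invariant_kernel_function[OF assms(1,2)]
  have k1: "function_kernel G u \<one>\<^bsub>G\<^esub> \<one>\<^bsub>G\<^esub> = u \<one>\<^bsub>G\<^esub>" by (simp add: function_kernel_def)
  have "0 \<le> Re (u \<one>\<^bsub>G\<^esub>)" using pd_kernel_diag(2)[OF invariant_kernel.pd[OF K], of "\<one>\<^bsub>G\<^esub>"] k1 by simp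
  moreover have "cmod (pairing f u) \<le> cstar_norm G f * sqrt (Re (u \<one>\<^bsub>G\<^esub>)) * sqrt (Re (u \<one>\<^bsub>G\<^esub>))"
    using pairing_kernel_coefficient_bound[OF K f, of "\<one>\<^bsub>G\<^esub>" "\<one>\<^bsub>G\<^esub>"]
    unfolding positive_definite_coefficient[OF assms(1,2), symmetric] k1 .
  ultimately show ?thesis by (simp add: mult.assoc)
qed

lemma positive_definite_value_bound:
  assumes "topological_group G T" and u: "u \<in> positive_definite G" and s: "s \<in> carrier G"
  shows "cmod (u s) \<le> Re (u \<one>\<^bsub>G\<^esub>)"
proof -
  interpret topological_group G T by fact
  have pd: "pd_kernel (function_kernel G u)" using u by (simp add: positive_definite_iff)
  have k: "function_kernel G u t t = u \<one>\<^bsub>G\<^esub>" if "t \<in> carrier G" for t using that by (simp add: function_kernel_def)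
  have "cmod (function_kernel G u s \<one>\<^bsub>G\<^esub>) \<le> sqrt (Re (u \<one>\<^bsub>G\<^esub>)) * sqrt (Re (u \<one>\<^bsub>G\<^esub>))"
    using pd_kernel_Cauchy_Schwarz[OF pd, of s "\<one>\<^bsub>G\<^esub>"] k s by simp
  moreover have "0 \<le> Re (u \<one>\<^bsub>G\<^esub>)" using pd_kernel_diag(2)[OF pd, of "\<one>\<^bsub>G\<^esub>"] k by simp
  ultimately show ?thesis using s by (simp add: function_kernel_def)
qed

text \<open>Pull the product kernel back along the diagonal.\<close>

lemma pd_kernel_mult:
  assumes "pd_kernel k" "pd_kernel k'"
  shows "pd_kernel (\<lambda>x y. k x y * k' x y)"
  using pd_kernel_pullback[OF Schur_product[OF assms], of "\<lambda>x. (x, x)"] by simp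

lemma positive_definite_mult:
  assumes "u \<in> positive_definite G" "v \<in> positive_definite G"
  shows "(\<lambda>s. u s * v s) \<in> positive_definite G"
proof -
  have "function_kernel G (\<lambda>s. u s * v s) = (\<lambda>s t. function_kernel G u s t * function_kernel G v s t)"
    by (simp add: function_kernel_def fun_eq_iff)
  then show ?thesis using assms pd_kernel_mult by (auto simp: positive_definite_iff)
qed

lemma positive_definite_one:
  assumes "group G"
  shows "indicator (carrier G) \<in> positive_definite G"
proof -
  interpret group G by fact
  have "function_kernel G (indicator (carrier G)) = (\<lambda>s t. indicator (carrier G) s * cnj (indicator (carrier G) t) * 1)"
    by (auto simp: function_kernel_def indicator_def fun_eq_iff)
  then show ?thesis
    using pd_kernel_weighted[OF pd_kernel_one, of "indicator (carrier G)"] by (simp add: positive_definite_iff)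
qed

lemma positive_definite_half:
  assumes "group G" and u: "u \<in> positive_definite G"
  shows "(\<lambda>s. (indicator (carrier G) s + u s) / 2) \<in> positive_definite G"
proof -
  have "function_kernel G (\<lambda>s. (indicator (carrier G) s + u s) / 2)
      = (\<lambda>s t. complex_of_real (1 / 2) * (function_kernel G (indicator (carrier G)) s t + function_kernel G u s t))"
    by (simp add: function_kernel_def fun_eq_iff)
  moreover have "pd_kernel (\<lambda>s t. complex_of_real (1 / 2) * (function_kernel G (indicator (carrier G)) s t + function_kernel G u s t))"
    using positive_definite_one[OF assms(1)] u
    by (intro pd_kernel_scale pd_kernel_add) (simp_all add: positive_definite_iff)
  ultimately show ?thesis using u by (simp add: positive_definite_iff)
qed

lemma pd_kernel_Kronecker: "pd_kernel (\<lambda>x y. if x = y then 1 else 0)"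
  unfolding pd_kernel_def
proof
  fix l :: "(complex \<times> 'x) list"
  let ?A = "snd ` set l"
  obtain c where c: "\<forall>k y. kspan k l y = (\<Sum>x\<in>?A. c x * k x y)"
    "\<forall>F. lincomb_pair F l = (\<Sum>x\<in>?A. cnj (c x) * F x)"
    using list_as_sum[of ?A l] by auto
  have "hform (\<lambda>x y. if x = y then 1 else 0) l l = (\<Sum>s\<in>?A. \<Sum>t\<in>?A. cnj (c s) * c t * (if t = s then 1 else 0))"
    by (rule hform_as_sum[OF c])
  also have "\<dots> = (\<Sum>s\<in>?A. cnj (c s) * c s)"
    by (intro sum.cong refl) (simp add: if_distrib cong: if_cong)
  also have "\<dots> = complex_of_real (\<Sum>s\<in>?A. (cmod (c s))\<^sup>2)"
    unfolding of_real_sum by (intro sum.cong refl) (simp only: complex_norm_square mult.commute)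
  also have "\<dots> \<in> \<real>\<^sub>\<ge>\<^sub>0" by (simp only: nonneg_Reals_of_real_iff) (simp add: sum_nonneg)
  finally show "hform (\<lambda>x y. if x = y then 1 else 0) l l \<in> \<real>\<^sub>\<ge>\<^sub>0" .
qed

text \<open>The kernel of \<open>\<chi>\<^sub>H\<close> relates \<open>s\<close> and \<open>t\<close> when \<open>s H = t H\<close>, so it is the Kronecker kernel
pulled back along a map that is constant exactly on cosets.\<close>

lemma positive_definite_indicator_subgroup:
  assumes "group G" and H: "subgroup H G"
  shows "indicator H \<in> positive_definite G"
proof -
  interpret group G by fact
  interpret H: subgroup H G by fact
  \<comment> \<open>The left coset \<open>s H\<close>.\<close>
  let ?q = "\<lambda>s. {t \<in> carrier G. inv\<^bsub>G\<^esub> t \<otimes>\<^bsub>G\<^esub> s \<in> H}"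
  have coset: "inv\<^bsub>G\<^esub> t \<otimes>\<^bsub>G\<^esub> s \<in> H \<longleftrightarrow> ?q s = ?q t" if s: "s \<in> carrier G" and t: "t \<in> carrier G" for s t
  proof
    have mult: "inv\<^bsub>G\<^esub> r \<otimes>\<^bsub>G\<^esub> b = (inv\<^bsub>G\<^esub> r \<otimes>\<^bsub>G\<^esub> a) \<otimes>\<^bsub>G\<^esub> (inv\<^bsub>G\<^esub> a \<otimes>\<^bsub>G\<^esub> b)"
      if "r \<in> carrier G" "a \<in> carrier G" "b \<in> carrier G" for r a b
    proof -
      have "a \<otimes>\<^bsub>G\<^esub> (inv\<^bsub>G\<^esub> a \<otimes>\<^bsub>G\<^esub> b) = b" using that by (simp add: m_assoc[symmetric])
      then show ?thesis using that by (simp add: m_assoc)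
    qed
    assume h: "inv\<^bsub>G\<^esub> t \<otimes>\<^bsub>G\<^esub> s \<in> H"
    have "inv\<^bsub>G\<^esub> (inv\<^bsub>G\<^esub> t \<otimes>\<^bsub>G\<^esub> s) = inv\<^bsub>G\<^esub> s \<otimes>\<^bsub>G\<^esub> t"
      using s t by (simp add: inv_mult_group)
    then have h': "inv\<^bsub>G\<^esub> s \<otimes>\<^bsub>G\<^esub> t \<in> H" using H.m_inv_closed[OF h] by simp
    have "inv\<^bsub>G\<^esub> r \<otimes>\<^bsub>G\<^esub> s \<in> H \<longleftrightarrow> inv\<^bsub>G\<^esub> r \<otimes>\<^bsub>G\<^esub> t \<in> H" if r: "r \<in> carrier G" for r
      using mult[OF r s t] mult[OF r t s] H.m_closed h h' by metis
    then show "?q s = ?q t" by blast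
  next
    assume "?q s = ?q t"
    moreover have "t \<in> ?q t" using t H.one_closed by simp
    ultimately show "inv\<^bsub>G\<^esub> t \<otimes>\<^bsub>G\<^esub> s \<in> H" by blast
  qed
  have "function_kernel G (indicator H)
      = (\<lambda>s t. indicator (carrier G) s * cnj (indicator (carrier G) t) * (if ?q s = ?q t then 1 else 0))"
  proof (intro ext)
    fix s t
    show "function_kernel G (indicator H) s t
      = indicator (carrier G) s * cnj (indicator (carrier G) t) * (if ?q s = ?q t then 1 else 0)"
      using coset[of s t] by (cases "s \<in> carrier G \<and> t \<in> carrier G") (auto simp only: function_kernel_def indicator_def, simp_all)
  qed
  then have "pd_kernel (function_kernel G (indicator H))"
    using pd_kernel_weighted[OF pd_kernel_pullback[OF pd_kernel_Kronecker, of ?q], of "indicator (carrier G)"] by simp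
  then show ?thesis using H.subset by (auto simp: positive_definite_iff indicator_def)
qed

section \<open>The weak* topology\<close>

text \<open>Convergence can be tested on a subbasis, since finitely many eventual conditions hold
simultaneously.\<close>

lemma limitin_topology_generated_by:
  assumes l: "l \<in> \<Union>\<S>" and ev: "\<And>U. U \<in> \<S> \<Longrightarrow> l \<in> U \<Longrightarrow> eventually (\<lambda>i. f i \<in> U) F"
  shows "limitin (topology_generated_by \<S>) f l F"
  unfolding limitin_def
proof (intro conjI allI impI)
  show "l \<in> topspace (topology_generated_by \<S>)" using l by simp
  fix U assume "openin (topology_generated_by \<S>) U \<and> l \<in> U"
  then have "generate_topology_on \<S> U" "l \<in> U" by (auto simp: openin_topology_generated_by_iff)
  then show "eventually (\<lambda>i. f i \<in> U) F"
  proof (induction rule: generate_topology_on.induct)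
    case (UN K)
    then obtain V where "V \<in> K" "l \<in> V" by blast
    then have "eventually (\<lambda>i. f i \<in> V) F" using UN.IH by blast
    then show ?case by (rule eventually_mono) (use \<open>V \<in> K\<close> in blast)
  next
    case (Int a b)
    then show ?case by (auto intro: eventually_conj)
  qed (use ev in auto)
qed

lemma cstar_norm_zero:
  assumes "topological_group G T"
  shows "cstar_norm G (\<lambda>s. 0) = 0"
proof (rule antisym)
  have z: "(\<lambda>s. 0) \<in> group_algebra G" by (simp add: group_algebra_def)
  show "0 \<le> cstar_norm G (\<lambda>s. 0)" by (rule cstar_norm_nonneg[OF assms z])
  let ?X = "{hnorm V (rep_op V \<pi> (\<lambda>s. 0) \<xi>) | (V :: 'a hvec hspace) \<pi> \<xi>.
      unitary_rep G (discrete G) V \<pi> \<and> \<xi> \<in> carrier V \<and> hnorm V \<xi> \<le> 1}"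
  obtain V :: "'a hvec hspace" and \<pi> where V: "unitary_rep G (discrete G) V \<pi>"
    using fourier_stieltjes_one[OF topological_group_discrete[OF assms]] by (auto simp: fourier_stieltjes_def)
  interpret V: unitary_rep G "discrete G" V \<pi> by fact
  have "hnorm V (rep_op V \<pi> (\<lambda>s. 0) \<zero>\<^bsub>V\<^esub>) \<in> ?X"
    using V by (intro CollectI exI[of _ V] exI[of _ \<pi>] exI[of _ "\<zero>\<^bsub>V\<^esub>"]) simp
  moreover have "x \<le> 0" if x: "x \<in> ?X" for x
  proof -
    obtain W :: "'a hvec hspace" and \<rho> \<xi> where W: "unitary_rep G (discrete G) W \<rho>"
      and x: "x = hnorm W (rep_op W \<rho> (\<lambda>s. 0) \<xi>)" using x by blast
    interpret W: unitary_rep G "discrete G" W \<rho> by fact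
    show ?thesis by (simp add: x rep_op_def)
  qed
  ultimately show "cstar_norm G (\<lambda>s. 0) \<le> 0"
    unfolding cstar_norm_def by (intro cSup_least) blast+
qed

lemma cstar_CauchyD:
  "a \<in> cstar_Cauchy G \<Longrightarrow> 0 < e \<Longrightarrow> \<exists>N. \<forall>m\<ge>N. \<forall>n\<ge>N. cstar_norm G (\<lambda>s. a m s - a n s) < e"
  by (simp add: cstar_Cauchy_def)

context
  fixes G :: "('g, 'b) monoid_scheme" and T :: "'g topology"
  assumes tg: "topological_group G T"
begin

lemma cstar_equiv_refl: "a \<in> cstar_Cauchy G \<Longrightarrow> (a, a) \<in> cstar_equiv G"
  using cstar_norm_zero[OF tg] by (simp add: cstar_equiv_def)

lemma cstar_class:
  assumes "a \<in> cstar_Cauchy G"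
  shows "cstar_equiv G `` {a} \<in> cstar_algebra G" "a \<in> cstar_equiv G `` {a}"
  using assms cstar_equiv_refl by (auto simp: cstar_algebra_def intro: quotientI)

lemma cstar_algebra_representative:
  assumes "A \<in> cstar_algebra G"
  obtains a where "a \<in> A" "a \<in> cstar_Cauchy G"
  using assms cstar_class(2) that unfolding cstar_algebra_def by (elim quotientE) blast

lemma cstar_pairing_tendsto:
  assumes "A \<in> cstar_algebra G" "u \<in> fourier_stieltjes G (discrete G)" "a \<in> A"
  shows "(\<lambda>n. pairing (a n) u) \<longlonglongrightarrow> cstar_pairing A u"
  using theI'[OF cstar_pairing_ex1[OF assms(1,2)]] assms(3) unfolding cstar_pairing_def by blast

lemma cstar_pairing_eqI:
  assumes "A \<in> cstar_algebra G" "u \<in> fourier_stieltjes G (discrete G)" "a \<in> A"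
    "(\<lambda>n. pairing (a n) u) \<longlonglongrightarrow> z"
  shows "cstar_pairing A u = z"
  using cstar_pairing_tendsto[OF assms(1-3)] assms(4) by (rule LIMSEQ_unique)

lemma topspace_weak_star: "topspace (weak_star G) = fourier_stieltjes G (discrete G)"
proof -
  have "(\<lambda>n s. 0) \<in> cstar_Cauchy G"
    using cstar_norm_zero[OF tg] by (auto simp: cstar_Cauchy_def group_algebra_def)
  from cstar_class(1)[OF this] show ?thesis
    unfolding weak_star_def topology_generated_by_topspace using open_UNIV by blast
qed

lemma openin_weak_star:
  assumes "A \<in> cstar_algebra G" "open U"
  shows "openin (weak_star G) {u \<in> fourier_stieltjes G (discrete G). cstar_pairing A u \<in> U}"
  unfolding weak_star_def openin_topology_generated_by_iff
  using assms by (intro generate_topology_on.Basis) blast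

text \<open>A map whose composition with each functional from \<open>C\<^sup>*(G\<^sub>d)\<close> is an affine function of another such functional
pulls subbasic open sets back to subbasic open sets.\<close>

lemma continuous_map_weak_star:
  assumes \<phi>: "\<And>u. u \<in> fourier_stieltjes G (discrete G) \<Longrightarrow> \<phi> u \<in> fourier_stieltjes G (discrete G)"
    and adj: "\<And>A. A \<in> cstar_algebra G \<Longrightarrow> \<exists>B\<in>cstar_algebra G. \<exists>c d. \<forall>u\<in>fourier_stieltjes G (discrete G).
      cstar_pairing A (\<phi> u) = c + d * cstar_pairing B u"
  shows "continuous_map (weak_star G) (weak_star G) \<phi>"
  unfolding weak_star_def[of G]
proof (rule continuous_on_generated_topo, unfold weak_star_def[of G, symmetric] topspace_weak_star)
  let ?S = "{{u \<in> fourier_stieltjes G (discrete G). cstar_pairing A u \<in> U} | A U.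
        A \<in> cstar_algebra G \<and> open U}"
  have "\<Union>?S = fourier_stieltjes G (discrete G)"
    using topspace_weak_star unfolding weak_star_def topology_generated_by_topspace .
  then show "\<phi> ` fourier_stieltjes G (discrete G) \<subseteq> \<Union>?S" using \<phi> by auto
  fix W assume "W \<in> ?S"
  then obtain A U where W: "W = {u \<in> fourier_stieltjes G (discrete G). cstar_pairing A u \<in> U}"
    and A: "A \<in> cstar_algebra G" and U: "open U" by blast
  obtain B c d where B: "B \<in> cstar_algebra G" "\<And>u. u\<in>fourier_stieltjes G (discrete G) \<Longrightarrow>
      cstar_pairing A (\<phi> u) = c + d * cstar_pairing B u"
    using adj[OF A] by blast
  have "\<phi> -` W \<inter> fourier_stieltjes G (discrete G)
      = {u \<in> fourier_stieltjes G (discrete G). cstar_pairing B u \<in> (\<lambda>z. c + d * z) -` U}"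
    using \<phi> B(2) by (auto simp: W)
  moreover have "open ((\<lambda>z. c + d * z) -` U)"
    by (intro open_vimage U continuous_intros)
  from openin_weak_star[OF B(1) this]
  have "openin (weak_star G) {u \<in> fourier_stieltjes G (discrete G). cstar_pairing B u \<in> (\<lambda>z. c + d * z) -` U}" .
  ultimately show "openin (weak_star G) (\<phi> -` W \<inter> fourier_stieltjes G (discrete G))"
    by simp
qed

lemma pairing_mult: "pairing f (\<lambda>s. w s * u s) = pairing (\<lambda>s. f s * w s) u" if "f \<in> group_algebra G"
proof -
  have "pairing (\<lambda>s. f s * w s) u = (\<Sum>s | f s \<noteq> 0. f s * w s * u s)"
    using that by (intro pairing_eq_sum) (auto simp: group_algebra_def)
  then show ?thesis by (simp add: pairing_def mult.assoc)
qed

text \<open>The adjoint of multiplication by \<open>w\<close> is \<open>f \<mapsto> f w\<close> on \<open>C\<^sup>*(G\<^sub>d)\<close>; on the level of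
Cauchy sequences it acts term by term, and boundedness keeps the sequence Cauchy.\<close>

lemma continuous_map_weak_star_mult:
  assumes w: "w \<in> fourier_stieltjes G (discrete G)"
  shows "continuous_map (weak_star G) (weak_star G) (\<lambda>u s. w s * u s)"
proof (rule continuous_map_weak_star)
  show mem: "(\<lambda>s. w s * u s) \<in> fourier_stieltjes G (discrete G)"
    if "u \<in> fourier_stieltjes G (discrete G)" for u
    by (rule fourier_stieltjes_mult[OF w that])
  fix A assume A: "A \<in> cstar_algebra G"
  obtain a where a: "a \<in> A" "a \<in> cstar_Cauchy G" by (rule cstar_algebra_representative[OF A])
  have ga: "a n \<in> group_algebra G" for n using a(2) by (auto simp: cstar_Cauchy_def)
  obtain C where C: "0 < C" "\<And>f. f \<in> group_algebra G \<Longrightarrow> cstar_norm G (\<lambda>s. f s * w s) \<le> C * cstar_norm G f"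
    by (rule cstar_norm_mult[OF w]) (rule that)
  define b where "b n = (\<lambda>s. a n s * w s)" for n
  have b: "b \<in> cstar_Cauchy G"
    unfolding cstar_Cauchy_def
  proof (intro CollectI conjI allI impI)
    show "range b \<subseteq> group_algebra G" using group_algebra_mult[OF ga] by (auto simp: b_def)
    fix e :: real assume e: "0 < e"
    obtain N where N: "\<And>m n. m \<ge> N \<Longrightarrow> n \<ge> N \<Longrightarrow> cstar_norm G (\<lambda>s. a m s - a n s) < e / C"
      using cstar_CauchyD[OF a(2) divide_pos_pos[OF e C(1)]] by blast
    have "cstar_norm G (\<lambda>s. b m s - b n s) < e" if "m \<ge> N" "n \<ge> N" for m n
    proof -
      have "cstar_norm G (\<lambda>s. (a m s - a n s) * w s) \<le> C * cstar_norm G (\<lambda>s. a m s - a n s)"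
        by (rule C(2)[OF group_algebra_diff[OF ga ga]])
      also have "\<dots> < e" using N[OF that] C(1) by (simp add: field_simps)
      finally show ?thesis by (simp add: b_def left_diff_distrib)
    qed
    then show "\<exists>N. \<forall>m\<ge>N. \<forall>n\<ge>N. cstar_norm G (\<lambda>s. b m s - b n s) < e" by blast
  qed
  have "cstar_pairing A (\<lambda>s. w s * u s) = 0 + 1 * cstar_pairing (cstar_equiv G `` {b}) u"
    if u: "u \<in> fourier_stieltjes G (discrete G)" for u
  proof -
    have "(\<lambda>n. pairing (b n) u) \<longlonglongrightarrow> cstar_pairing (cstar_equiv G `` {b}) u"
      by (rule cstar_pairing_tendsto[OF cstar_class(1)[OF b] u cstar_class(2)[OF b]])
    then have "(\<lambda>n. pairing (a n) (\<lambda>s. w s * u s)) \<longlonglongrightarrow> cstar_pairing (cstar_equiv G `` {b}) u"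
      unfolding pairing_mult[OF ga] b_def .
    from cstar_pairing_eqI[OF A mem[OF u] a(1) this] show ?thesis by simp
  qed
  then show "\<exists>B\<in>cstar_algebra G. \<exists>c d. \<forall>u\<in>fourier_stieltjes G (discrete G).
      cstar_pairing A (\<lambda>s. w s * u s) = c + d * cstar_pairing B u"
    using cstar_class(1)[OF b] by blast
qed

lemma continuous_map_weak_star_half:
  "continuous_map (weak_star G) (weak_star G) (\<lambda>u s. (indicator (carrier G) s + u s) / 2)"
proof (rule continuous_map_weak_star)
  show mem: "(\<lambda>s. (indicator (carrier G) s + u s) / 2) \<in> fourier_stieltjes G (discrete G)"
    if "u \<in> fourier_stieltjes G (discrete G)" for u
    by (rule fourier_stieltjes_half[OF that])
  have one: "indicator (carrier G) \<in> fourier_stieltjes G (discrete G)"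
    by (rule fourier_stieltjes_one[OF topological_group_discrete[OF tg]])
  fix A assume A: "A \<in> cstar_algebra G"
  obtain a where a: "a \<in> A" "a \<in> cstar_Cauchy G" by (rule cstar_algebra_representative[OF A])
  have "cstar_pairing A (\<lambda>s. (indicator (carrier G) s + u s) / 2)
      = cstar_pairing A (indicator (carrier G)) / 2 + 1 / 2 * cstar_pairing A u"
    if u: "u \<in> fourier_stieltjes G (discrete G)" for u
  proof (rule cstar_pairing_eqI[OF A mem[OF u] a(1)])
    have "pairing f (\<lambda>s. (indicator (carrier G) s + u s) / 2)
        = pairing f (indicator (carrier G)) / 2 + 1 / 2 * pairing f u" for f
      by (simp add: pairing_def sum_divide_distrib[symmetric] sum.distrib distrib_left add_divide_distrib)
    then show "(\<lambda>n. pairing (a n) (\<lambda>s. (indicator (carrier G) s + u s) / 2))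
        \<longlonglongrightarrow> cstar_pairing A (indicator (carrier G)) / 2 + 1 / 2 * cstar_pairing A u"
      using tendsto_add[OF tendsto_divide[OF cstar_pairing_tendsto[OF A one a(1)] tendsto_const[of 2]]
          tendsto_mult_left[OF cstar_pairing_tendsto[OF A u a(1)], of "1 / 2"]] by simp
  qed
  then show "\<exists>B\<in>cstar_algebra G. \<exists>c d. \<forall>u\<in>fourier_stieltjes G (discrete G).
      cstar_pairing A (\<lambda>s. (indicator (carrier G) s + u s) / 2) = c + d * cstar_pairing B u"
    using A by blast
qed

lemma Bd_subset: "Bd G T \<subseteq> fourier_stieltjes G (discrete G)"
  unfolding Bd_def topspace_weak_star[symmetric] by (rule closure_of_subset_topspace)

lemma fourier_stieltjes_subset_Bd: "fourier_stieltjes G T \<subseteq> Bd G T"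
  unfolding Bd_def
  by (rule closure_of_subset) (simp add: topspace_weak_star fourier_stieltjes_subset_discrete)

lemma closedin_Bd: "closedin (weak_star G) (Bd G T)"
  by (simp add: Bd_def)

lemma Bd_stable:
  assumes "continuous_map (weak_star G) (weak_star G) \<phi>" "\<And>u. u \<in> fourier_stieltjes G T \<Longrightarrow> \<phi> u \<in> Bd G T"
    and "u \<in> Bd G T"
  shows "\<phi> u \<in> Bd G T"
proof -
  have "\<phi> ` (weak_star G closure_of fourier_stieltjes G T) \<subseteq> weak_star G closure_of \<phi> ` fourier_stieltjes G T"
    by (rule continuous_map_image_closure_subset[OF assms(1)])
  also have "\<dots> \<subseteq> Bd G T"
    by (rule closure_of_minimal[OF _ closedin_Bd]) (use assms(2) in blast)
  finally show ?thesis using assms(3) by (auto simp: Bd_def)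
qed

text \<open>Separate continuity is used twice: a product with one factor in \<open>B(G)\<close> stays in \<open>B\<^sup>d(G)\<close> by
continuity in the other factor, and this turns into the hypothesis needed to let
the first factor run through \<open>B\<^sup>d(G)\<close> as well.\<close>

lemma Bd_mult:
  assumes u: "u \<in> Bd G T" and v: "v \<in> Bd G T"
  shows "(\<lambda>s. u s * v s) \<in> Bd G T"
proof -
  have 1: "(\<lambda>s. w s * u s) \<in> Bd G T" if w: "w \<in> fourier_stieltjes G T" for w
  proof (rule Bd_stable[OF continuous_map_weak_star_mult _ u])
    show "w \<in> fourier_stieltjes G (discrete G)" using w fourier_stieltjes_subset_discrete by blast
    show "(\<lambda>s. w s * x s) \<in> Bd G T" if "x \<in> fourier_stieltjes G T" for x
      using fourier_stieltjes_mult[OF w that] fourier_stieltjes_subset_Bd by blast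
  qed
  show ?thesis
  proof (rule Bd_stable[OF continuous_map_weak_star_mult _ v])
    show "u \<in> fourier_stieltjes G (discrete G)" using u Bd_subset by blast
    show "(\<lambda>s. u s * x s) \<in> Bd G T" if "x \<in> fourier_stieltjes G T" for x
      using 1[OF that] by (simp only: mult.commute)
  qed
qed

lemma Bd_half: "u \<in> Bd G T \<Longrightarrow> (\<lambda>s. (indicator (carrier G) s + u s) / 2) \<in> Bd G T"
  by (rule Bd_stable[OF continuous_map_weak_star_half])
    (use fourier_stieltjes_half fourier_stieltjes_subset_Bd in blast)

text \<open>All functions involved have norm at most 1 as functionals, so a fixed element of \<open>C\<^sup>*(G\<^sub>d)\<close> may be
replaced by a finitely supported function with an error that is uniform along the net, and on finitely supported functions
pointwise convergence suffices.\<close>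

lemma weak_star_limit_of_normalized:
  assumes w: "\<forall>\<^sub>F i in F. w i \<in> positive_definite G \<and> w i \<one>\<^bsub>G\<^esub> = 1"
    and u: "u \<in> positive_definite G" "u \<one>\<^bsub>G\<^esub> = 1"
    and lim: "\<And>s. s \<in> carrier G \<Longrightarrow> ((\<lambda>i. w i s) \<longlongrightarrow> u s) F"
  shows "limitin (weak_star G) w u F"
  unfolding weak_star_def
proof (rule limitin_topology_generated_by)
  have mem: "v \<in> fourier_stieltjes G (discrete G)" if "v \<in> positive_definite G" for v
    by (rule positive_definite_in_fourier_stieltjes[OF tg that])
  show "u \<in> \<Union>{{u \<in> fourier_stieltjes G (discrete G). cstar_pairing A u \<in> U} | A U.
        A \<in> cstar_algebra G \<and> open U}"
    using mem[OF u(1)] topspace_weak_star unfolding weak_star_def topology_generated_by_topspace by blast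
  fix W assume "W \<in> {{u \<in> fourier_stieltjes G (discrete G). cstar_pairing A u \<in> U} | A U.
        A \<in> cstar_algebra G \<and> open U}" and "u \<in> W"
  then obtain A U where W: "W = {u \<in> fourier_stieltjes G (discrete G). cstar_pairing A u \<in> U}"
    and A: "A \<in> cstar_algebra G" and U: "open U" "cstar_pairing A u \<in> U" by blast
  obtain a where a: "a \<in> A" "a \<in> cstar_Cauchy G" by (rule cstar_algebra_representative[OF A])
  have ga: "a n \<in> group_algebra G" for n using a(2) by (auto simp: cstar_Cauchy_def)
  have "((\<lambda>i. cstar_pairing A (w i)) \<longlongrightarrow> cstar_pairing A u) F"
  proof (rule tendstoI)
    fix e :: real assume e: "0 < e"
    obtain N where N: "\<And>m n. m \<ge> N \<Longrightarrow> n \<ge> N \<Longrightarrow> cstar_norm G (\<lambda>s. a m s - a n s) < e / 3"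
      using cstar_CauchyD[OF a(2) divide_pos_pos[OF e zero_less_numeral]] by blast
    have close: "dist (cstar_pairing A v) (pairing (a N) v) \<le> e / 3"
      if v: "v \<in> positive_definite G" "v \<one>\<^bsub>G\<^esub> = 1" for v
    proof (rule tendsto_upperbound)
      show "(\<lambda>n. dist (pairing (a n) v) (pairing (a N) v)) \<longlonglongrightarrow> dist (cstar_pairing A v) (pairing (a N) v)"
        by (rule tendsto_dist[OF cstar_pairing_tendsto[OF A mem[OF v(1)] a(1)] tendsto_const])
      have "dist (pairing (a n) v) (pairing (a N) v) \<le> e / 3" if "n \<ge> N" for n
      proof -
        have "cmod (pairing (\<lambda>s. a n s - a N s) v) \<le> cstar_norm G (\<lambda>s. a n s - a N s)"
          using pairing_positive_definite_bound[OF tg v(1) group_algebra_diff[OF ga ga], of n N] v(2) by simp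
        then show ?thesis using N[OF that order_refl] by (simp add: dist_norm pairing_diff[OF ga ga])
      qed
      then show "\<forall>\<^sub>F n in sequentially. dist (pairing (a n) v) (pairing (a N) v) \<le> e / 3"
        using eventually_sequentially by blast
    qed simp
    have "((\<lambda>i. pairing (a N) (w i)) \<longlongrightarrow> pairing (a N) u) F"
      unfolding pairing_def
    proof (rule tendsto_sum)
      fix s assume "s \<in> {s. a N s \<noteq> 0}"
      then have "s \<in> carrier G" using ga[of N] by (auto simp: group_algebra_def)
      then show "((\<lambda>i. a N s * w i s) \<longlongrightarrow> a N s * u s) F" by (rule tendsto_mult_left[OF lim])
    qed
    then have "\<forall>\<^sub>F i in F. dist (pairing (a N) (w i)) (pairing (a N) u) < e / 3"
      by (rule tendstoD) (use e in simp)
    with w show "\<forall>\<^sub>F i in F. dist (cstar_pairing A (w i)) (cstar_pairing A u) < e"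
    proof eventually_elim
      case (elim i)
      have "dist (cstar_pairing A (w i)) (cstar_pairing A u)
        \<le> dist (cstar_pairing A (w i)) (pairing (a N) (w i)) + dist (pairing (a N) (w i)) (pairing (a N) u)
          + dist (cstar_pairing A u) (pairing (a N) u)"
        by metric
      then show ?case using close[of "w i"] close[OF u] elim by linarith
    qed
  qed
  then have "\<forall>\<^sub>F i in F. cstar_pairing A (w i) \<in> U" using U by (rule topological_tendstoD)
  with w show "\<forall>\<^sub>F i in F. w i \<in> W"
    by eventually_elim (use mem in \<open>auto simp: W\<close>)
qed

end

section \<open>The separation property and approximability\<close>

lemma norm_half_lt_one:
  assumes "cmod z \<le> 1" "z \<noteq> 1"
  shows "cmod ((1 + z) / 2) < 1"
proof (rule ccontr)
  assume "\<not> ?thesis"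
  then have "2 \<le> cmod (1 + z)" by (simp add: norm_divide)
  then have "4 \<le> (cmod (1 + z))\<^sup>2" using power_mono[of 2 "cmod (1 + z)" 2] by simp
  also have "(cmod (1 + z))\<^sup>2 = 1 + 2 * Re z + (cmod z)\<^sup>2"
    unfolding cmod_power2 by (simp add: power2_eq_square algebra_simps)
  finally have "4 \<le> 1 + 2 * Re z + (cmod z)\<^sup>2" .
  moreover have "(cmod z)\<^sup>2 \<le> 1" using assms(1) by (simp add: power_le_one)
  ultimately have "Re z \<ge> 1" by simp
  moreover have "Re z \<le> 1" using complex_Re_le_cmod[of z] assms(1) by linarith
  ultimately have "Re z = 1" by simp
  then have "Im z = 0" using \<open>(cmod z)\<^sup>2 \<le> 1\<close> unfolding cmod_power2 by simp
  then show False using \<open>Re z = 1\<close> assms(2) by (simp add: complex_eq_iff)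
qed

text \<open>The net is indexed by finite subsets \<open>P\<close> of the complement of \<open>H\<close> together with an exponent \<open>n\<close>. At a point
\<open>x \<notin> H\<close>, as soon as \<open>x \<in> P\<close> the factor \<open>v\<^sub>x(x)\<^sup>n\<close> dominates, because the other
factors have modulus at most 1.\<close>

lemma approximable_of_separation:
  fixes G :: "('g, 'b) monoid_scheme"
  assumes tg: "topological_group G T" and H: "subgroup H G" and sep: "discretized_separation G T H"
  shows "approximable G T (indicator H)"
proof -
  interpret topological_group G T by fact
  interpret H: subgroup H G by fact
  define M where "M = Bd G T \<inter> positive_definite_on G H"
  have M_mult: "(\<lambda>s. u s * v s) \<in> M" if "u \<in> M" "v \<in> M" for u v
    using that Bd_mult[OF tg] positive_definite_mult by (auto simp: M_def positive_definite_on_def)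
  have M_one: "indicator (carrier G) \<in> M"
    using fourier_stieltjes_one[OF tg] fourier_stieltjes_subset_Bd[OF tg] positive_definite_one[OF is_group] H.subset
    by (auto simp: M_def positive_definite_on_def)
  have "\<exists>v\<in>M. cmod (v s) < 1" if s: "s \<in> carrier G - H" for s
  proof -
    obtain u where u: "u \<in> M" "u s \<noteq> 1"
      using sep s by (auto simp: discretized_separation_def M_def)
    have pd: "u \<in> positive_definite G" "u \<one>\<^bsub>G\<^esub> = 1"
      using u(1) H.one_closed by (auto simp: M_def positive_definite_on_def)
    let ?v = "\<lambda>s. (indicator (carrier G) s + u s) / 2"
    have "?v \<in> M"
      using u(1) Bd_half[OF tg] positive_definite_half[OF is_group] H.subset
      by (auto simp: M_def positive_definite_on_def)
    have "cmod (u s) \<le> 1" using positive_definite_value_bound[OF tg pd(1), of s] s pd(2) by simp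
    then have "cmod (?v s) < 1" using norm_half_lt_one[OF _ u(2)] s by simp
    then show ?thesis using \<open>?v \<in> M\<close> by (intro bexI[of _ ?v])
  qed
  then obtain v where v: "\<And>s. s \<in> carrier G - H \<Longrightarrow> v s \<in> M" "\<And>s. s \<in> carrier G - H \<Longrightarrow> cmod (v s s) < 1"
    by metis
  \<comment> \<open>The indicator makes the empty product the constant function 1 on the group, extended by 0.\<close>
  define w where "w i = (\<lambda>x. indicator (carrier G) x * (\<Prod>s\<in>fst i. v s x ^ snd i))" for i :: "'g set \<times> nat"
  let ?F = "finite_subsets_at_top (carrier G - H) \<times>\<^sub>F sequentially"
  have M_pow: "(\<lambda>x. y x * v s x ^ n) \<in> M" if "s \<in> carrier G - H" "y \<in> M" for s y n
  proof (induction n)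
    case (Suc n)
    from M_mult[OF this v(1)[OF that(1)]] show ?case by (simp add: mult_ac)
  qed (use that in simp)
  have M_prod: "(\<lambda>x. indicator (carrier G) x * (\<Prod>s\<in>P. v s x ^ n)) \<in> M" if "finite P" "P \<subseteq> carrier G - H" for P n
    using that
  proof (induction P)
    case empty
    show ?case using M_one by simp
  next
    case (insert s P)
    then have "(\<lambda>x. (indicator (carrier G) x * (\<Prod>s\<in>P. v s x ^ n)) * v s x ^ n) \<in> M"
      by (intro M_pow) auto
    then show ?case using insert.hyps by (simp add: mult_ac)
  qed
  have ev: "\<forall>\<^sub>F i in ?F. finite (fst i) \<and> X \<subseteq> fst i \<and> fst i \<subseteq> carrier G - H"
    if "finite X" "X \<subseteq> carrier G - H" for X
  proof -
    have "\<forall>\<^sub>F P in finite_subsets_at_top (carrier G - H). finite P \<and> X \<subseteq> P \<and> P \<subseteq> carrier G - H"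
      unfolding eventually_finite_subsets_at_top using that by blast
    then show ?thesis using filterlim_fst unfolding filterlim_iff by blast
  qed
  have wM: "\<forall>\<^sub>F i in ?F. w i \<in> M"
    using ev[of "{}"] by (auto elim!: eventually_mono simp: w_def M_prod)
  have "limitin (weak_star G) w (indicator H) ?F"
  proof (rule weak_star_limit_of_normalized[OF tg])
    show "\<forall>\<^sub>F i in ?F. w i \<in> positive_definite G \<and> w i \<one>\<^bsub>G\<^esub> = 1"
      using wM by (rule eventually_mono) (simp add: M_def positive_definite_on_def)
    show "indicator H \<in> positive_definite G"
      by (rule positive_definite_indicator_subgroup[OF is_group H])
    show "indicator H \<one>\<^bsub>G\<^esub> = (1 :: complex)" by simp
    fix x assume x: "x \<in> carrier G"
    show "((\<lambda>i. w i x) \<longlongrightarrow> indicator H x) ?F"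
    proof (cases "x \<in> H")
      case True
      have "\<forall>\<^sub>F i in ?F. w i x = 1"
        using wM by (rule eventually_mono) (use True in \<open>simp add: M_def positive_definite_on_def\<close>)
      then show ?thesis using True by (simp add: tendsto_eventually)
    next
      case False
      with x have xH: "x \<in> carrier G - H" by simp
      have bound: "cmod (v s x) \<le> 1" if "s \<in> carrier G - H" for s
        using positive_definite_value_bound[OF tg _ x, of "v s"] v(1)[OF that] H.one_closed
        by (auto simp: M_def positive_definite_on_def)
      have "((\<lambda>i. w i x) \<longlongrightarrow> 0) ?F"
      proof (rule Lim_null_comparison)
        show "\<forall>\<^sub>F i in ?F. norm (w i x) \<le> cmod (v x x) ^ snd i"
          using ev[of "{x}"]
        proof (rule eventually_mono)
          fix i :: "'g set \<times> nat"
          assume i: "finite (fst i) \<and> {x} \<subseteq> fst i \<and> fst i \<subseteq> carrier G - H"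
          have "norm (w i x) = (\<Prod>s\<in>fst i. cmod (v s x) ^ snd i)"
            using x by (simp add: w_def norm_mult prod_norm[symmetric] norm_power)
          also have "\<dots> = cmod (v x x) ^ snd i * (\<Prod>s\<in>fst i - {x}. cmod (v s x) ^ snd i)"
            using i by (intro prod.remove) auto
          also have "\<dots> \<le> cmod (v x x) ^ snd i * 1"
            using i bound by (intro mult_left_mono prod_le_1) (auto intro!: power_le_one)
          finally show "norm (w i x) \<le> cmod (v x x) ^ snd i" by simp
        qed (use xH in auto)
        have "(\<lambda>n. cmod (v x x) ^ n) \<longlonglongrightarrow> 0"
          using v(2)[OF xH] by (intro LIMSEQ_realpow_zero) auto
        then show "((\<lambda>i. cmod (v x x) ^ snd i) \<longlongrightarrow> 0) ?F"
          by (rule filterlim_compose[OF _ filterlim_snd])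
      qed
      then show ?thesis using False by simp
    qed
  qed
  moreover have "\<forall>\<^sub>F i in ?F. w i \<in> Bd G T"
    using wM by (rule eventually_mono) (simp add: M_def)
  moreover have "?F \<noteq> bot"
    by (simp add: prod_filter_eq_bot)
  ultimately show ?thesis
    unfolding approximable_def by (intro limitin_closedin[OF _ closedin_Bd[OF tg]])
qed

lemma separation_of_approximable:
  assumes "topological_group G T" and H: "subgroup H G" and "approximable G T (indicator H)"
  shows "discretized_separation G T H"
proof -
  interpret topological_group G T by fact
  have "indicator H \<in> Bd G T \<inter> positive_definite_on G H"
    using assms(3) positive_definite_indicator_subgroup[OF is_group H]
    by (simp add: approximable_def positive_definite_on_def)
  then show ?thesis
    unfolding discretized_separation_def by (intro ballI bexI[of _ "indicator H"]) auto
qed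

theorem proposition4p4:
  fixes G :: "('g, 'b) monoid_scheme" and T :: "'g topology" and H :: "'g set"
  assumes "locally_compact_group G T"
    and "subgroup H G" and "closedin T H"
  shows "discretized_separation G T H \<longleftrightarrow> approximable G T (indicator H)"
proof -
  have tg: "topological_group G T" using assms(1) by (simp add: locally_compact_group_def)
  show ?thesis
    using approximable_of_separation[OF tg assms(2)] separation_of_approximable[OF tg assms(2)] by blast
qed

end
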